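(* Let $S\subset\mathbb{Z}$ be finite, and let $$\Omega=\bigcup_{j\in S}\Omega_j\times(j,j+1)\subset\mathbb{R}^2,\qquad \widetilde{\Omega}=\bigcup_{j\in S}\Omega_j\times\{j\}\subset\mathbb{R}\times\mathbb{Z},$$ where each $\Omega_j\subset\mathbb{R}$ is bounded and measurable with finite positive Lebesgue measure. Then: (a) $\Omega$ is a tile in $\mathbb{R}^2$ if and only if $\widetilde{\Omega}$ is a tile in $\mathbb{R}\times\mathbb{Z}$; (b) $\Omega$ is a weak tile in $\mathbb{R}^2$ if and only if $\widetilde{\Omega}$ is a weak tile in $\mathbb{R}\times\mathbb{Z}$; (c) $\Omega$ is a spectral set in $\mathbb{R}^2$ if and only if $\widetilde{\Omega}$ is a spectral set in $\mathbb{R}\times\mathbb{Z}$.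
   Context: Let $G$ be $\mathbb{R}^2$ with Lebesgue measure or $\mathbb{R}\times\mathbb{Z}$ with Haar measure equal to the product of Lebesgue measure and counting measure; "a.e." refers to this measure. A bounded measurable set $E\subset G$ of finite positive measure is a tile of $G$ if there is a countable $T\subset G$ with $\sum_{t\in T}\mathbf{1}_E(x-t)=1$ for a.e. $x\in G$. It is a weak tile of $G$ if there is a non-negative, locally finite Borel measure $\mu$ on $G$ with $\mathbf{1}_E*\mu=1$ a.e. on $G$ and $\mu(\{0\})=1$ (for $G=\mathbb{R}^2$ this is equivalent to the existence of a non-negative locally finite measure $\mu'$ with $\mathbf{1}_E*\mu'=\mathbf{1}_{E^c}$ a.e.). $E\subset\mathbb{R}^2$ is spectral if there is a countable $\Lambda\subset\mathbb{R}^2$ such that $\{e^{2\pi i\langle\lambda,x\rangle}\}_{\lambda\in\Lambda}$ is an orthogonal basis of $L^2(E)$. $E\subset\mathbb{R}\times\mathbb{Z}$ is spectral if there is a countable $\Sigma\subset\mathbb{R}\times\mathbb{T}$, $\mathbb{T}=\mathbb{R}/\mathbb{Z}$, such that the characters $(x,j)\mapsto e^{2\pi i(\lambda x+\eta j)}$, $(\lambda,\eta)\in\Sigma$, form an orthogonal basis of $L^2(E)$. *)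

theory Defs
  imports "HOL-Analysis.Analysis"
begin

text \<open>
  The ambient group is given by its type together with a Haar measure on its Borel sets:
  \<open>lborel\<close> on \<open>real \<times> real\<close>, and \<open>lborel_count\<close> on \<open>real \<times> int\<close>. The group structure, topology
  and metric are those of the product instances; \<open>int\<close> is discrete. Measurability of subsets
  always refers to the completion of the Haar measure, which is \<open>lebesgue\<close> in the plane.
\<close>

text \<open>The usual metric on \<open>int\<close>, needed for boundedness; it induces the discrete topology.\<close>

instantiation int :: metric_space
begin

definition dist_int :: "int \<Rightarrow> int \<Rightarrow> real" where
  "dist_int m n = \<bar>real_of_int m - real_of_int n\<bar>"

definition uniformity_int :: "(int \<times> int) filter" where
  "uniformity_int = (INF e\<in>{0 <..}. principal {(x, y). dist x y < e})"

instance
proof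
  show "uniformity = (INF e\<in>{0 <..}. principal {(x :: int, y). dist x y < e})"
    by (rule uniformity_int_def)
  show "dist m n = 0 \<longleftrightarrow> m = n" for m n :: int
    by (simp add: dist_int_def)
  show "dist m n \<le> dist m k + dist n k" for m n k :: int
    by (simp add: dist_int_def)
  have "\<forall>\<^sub>F (x', y) in uniformity. x' = x \<longrightarrow> y \<in> U" if "x \<in> U" for U :: "int set" and x
    unfolding uniformity_int_def
  proof (rule eventually_INF1[where i = 1])
    show "\<forall>\<^sub>F (x', y) in principal {(x, y). dist x y < (1 :: real)}. x' = x \<longrightarrow> y \<in> U"
    proof -
      have "x = y" if "dist x y < 1" for y
        using that unfolding dist_int_def by linarith
      then show ?thesis
        using \<open>x \<in> U\<close> by (auto simp: eventually_principal)
    qed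
  qed simp
  then show "open U \<longleftrightarrow> (\<forall>x\<in>U. \<forall>\<^sub>F (x', y) in uniformity. x' = x \<longrightarrow> y \<in> U)" for U :: "int set"
    by (simp add: open_discrete)
qed

end

definition lborel_count :: "(real \<times> int) measure" where
  "lborel_count = lborel \<Otimes>\<^sub>M count_space UNIV"

definition bounded_positive_set :: "'a::metric_space measure \<Rightarrow> 'a set \<Rightarrow> bool" where
  "bounded_positive_set M E \<longleftrightarrow>
     bounded E \<and> E \<in> fmeasurable (completion M) \<and> measure (completion M) E > 0"

definition is_tile :: "'a::{metric_space, ab_group_add} measure \<Rightarrow> 'a set \<Rightarrow> bool" where
  "is_tile M E \<longleftrightarrow> bounded_positive_set M E \<and>
     (\<exists>T. countable T \<and>
        (AE x in M. ((\<lambda>t. indicator E (x - t) :: real) has_sum 1) T))"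

definition locally_finite_borel_measure :: "'a::topological_space measure \<Rightarrow> bool" where
  "locally_finite_borel_measure \<mu> \<longleftrightarrow>
     sets \<mu> = sets borel \<and> (\<forall>x. \<exists>U. open U \<and> x \<in> U \<and> emeasure \<mu> U < \<infinity>)"

text \<open>
  The convolution of the indicator function of \<open>E\<close> with \<open>\<mu>\<close>. As \<open>E\<close> need not be Borel, the
  integral is taken over the completion of \<open>\<mu>\<close>: by Tonelli, if \<open>E\<close> is measurable for the completed
  Haar measure, then the integrand is measurable for the completion of \<open>\<mu>\<close> for almost every \<open>x\<close>.
\<close>

definition indicator_conv :: "'a::ab_group_add set \<Rightarrow> 'a measure \<Rightarrow> 'a \<Rightarrow> ennreal" where
  "indicator_conv E \<mu> x = (\<integral>\<^sup>+ t. indicator E (x - t) \<partial>completion \<mu>)"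

definition is_weak_tile :: "'a::{metric_space, ab_group_add} measure \<Rightarrow> 'a set \<Rightarrow> bool" where
  "is_weak_tile M E \<longleftrightarrow> bounded_positive_set M E \<and>
     (\<exists>\<mu>. locally_finite_borel_measure \<mu> \<and>
        (AE x in M. indicator_conv E \<mu> x = 1) \<and> emeasure \<mu> {0} = 1)"

definition L2_functions :: "'a measure \<Rightarrow> ('a \<Rightarrow> complex) set" where
  "L2_functions M = {f \<in> borel_measurable M. integrable M (\<lambda>x. (norm (f x))\<^sup>2)}"

definition L2_inner :: "'a measure \<Rightarrow> ('a \<Rightarrow> complex) \<Rightarrow> ('a \<Rightarrow> complex) \<Rightarrow> complex" where
  "L2_inner M f g = (\<integral>x. f x * cnj (g x) \<partial>M)"

text \<open>An orthogonal family of nonzero vectors whose linear span is dense in \<open>L\<^sup>2\<close>.\<close>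

definition L2_orthogonal_basis :: "'a measure \<Rightarrow> ('i \<Rightarrow> 'a \<Rightarrow> complex) \<Rightarrow> 'i set \<Rightarrow> bool" where
  "L2_orthogonal_basis M e I \<longleftrightarrow>
     (\<forall>i\<in>I. e i \<in> L2_functions M \<and> L2_inner M (e i) (e i) \<noteq> 0) \<and>
     (\<forall>i\<in>I. \<forall>j\<in>I. i \<noteq> j \<longrightarrow> L2_inner M (e i) (e j) = 0) \<and>
     (\<forall>f\<in>L2_functions M. \<forall>\<epsilon>>0. \<exists>F c. finite F \<and> F \<subseteq> I \<and>
        sqrt (\<integral>x. (norm (f x - (\<Sum>i\<in>F. c i * e i x)))\<^sup>2 \<partial>M) < \<epsilon>)"

text \<open>The parameter \<open>ch\<close> enumerates the characters of the ambient group by its dual group \<open>'d\<close>.\<close>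

definition is_spectral_wrt :: "('d \<Rightarrow> 'a \<Rightarrow> complex) \<Rightarrow> 'a measure \<Rightarrow> 'a set \<Rightarrow> bool" where
  "is_spectral_wrt ch M E \<longleftrightarrow> E \<in> sets (completion M) \<and>
     (\<exists>\<Lambda>. countable \<Lambda> \<and> L2_orthogonal_basis (restrict_space (completion M) E) ch \<Lambda>)"

definition character_plane :: "real \<times> real \<Rightarrow> real \<times> real \<Rightarrow> complex" where
  "character_plane l x = exp (2 * of_real pi * \<i> * of_real (l \<bullet> x))"

quotient_type torus = real / "\<lambda>x y. x - y \<in> \<int>"
proof (intro equivpI reflpI sympI transpI)
  fix x y z :: real
  show "x - x \<in> \<int>"
    by simp
  show "y - x \<in> \<int>" if "x - y \<in> \<int>"
    using Ints_minus[OF that] by simp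
  show "x - z \<in> \<int>" if "x - y \<in> \<int>" "y - z \<in> \<int>"
    using Ints_add[OF that] by simp
qed

lift_definition torus_character :: "torus \<Rightarrow> int \<Rightarrow> complex"
  is "\<lambda>\<eta> j. exp (2 * of_real pi * \<i> * of_real (\<eta> * of_int j))"
proof (rule ext)
  fix \<eta> \<theta> :: real and j :: int
  assume "\<eta> - \<theta> \<in> \<int>"
  then obtain n :: int where "\<eta> - \<theta> = of_int n"
    by (rule Ints_cases)
  then have "\<eta> = \<theta> + of_int n"
    by simp
  then have "2 * of_real pi * \<i> * of_real (\<eta> * of_int j)
      = 2 * of_real pi * \<i> * of_real (\<theta> * of_int j) + of_real (of_int (2 * (n * j)) * pi) * \<i>"
    by (simp add: algebra_simps)
  then show "exp (2 * of_real pi * \<i> * of_real (\<eta> * of_int j))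
      = exp (2 * of_real pi * \<i> * complex_of_real (\<theta> * of_int j))"
    by (intro iffD2[OF exp_eq] exI)
qed

definition character_real_int :: "real \<times> torus \<Rightarrow> real \<times> int \<Rightarrow> complex" where
  "character_real_int \<sigma> x =
     exp (2 * of_real pi * \<i> * of_real (fst \<sigma> * fst x)) * torus_character (snd \<sigma>) (snd x)"

definition slab_union :: "int set \<Rightarrow> (int \<Rightarrow> real set) \<Rightarrow> (real \<times> real) set" where
  "slab_union S W = (\<Union>j\<in>S. W j \<times> {real_of_int j <..< real_of_int (j + 1)})"

definition layer_union :: "int set \<Rightarrow> (int \<Rightarrow> real set) \<Rightarrow> (real \<times> int) set" where
  "layer_union S W = (\<Union>j\<in>S. W j \<times> {j})"

end

theory Submission
  imports Defs
begin

text \<open>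
  For almost every height \<open>y\<close>, the horizontal lines at heights \<open>y + j\<close> see a translated copy
  of the slab union exactly as the layers see the layer union, provided a translation vector
  \<open>t\<close> is replaced by \<open>(fst t, - \<lfloor>y - snd t\<rfloor>)\<close>. Pushing a (weak) tiling forward along
  this map gives a (weak) tiling by the layers; no two translations are identified, and no mass is
  added to the atom at the origin, because the result has total weight one on a set of positive
  measure. The converse embeds \<open>real \<times> int\<close> into the plane.

  For spectra, the \<open>L\<^sup>2\<close> space of the slab union is the tensor product of that of the layer union
  with \<open>L\<^sup>2(0, 1)\<close>. All integer translates of a spectrum of the layers form a spectrum of the
  slabs, by Parseval on \<open>(0, 1)\<close>. Conversely, let \<open>\<Lambda>\<close> be a spectrum of the slabs. For a
  function \<open>g\<close> on the layers, let \<open>\<nu>\<close> be the measure that puts the weight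
  \<open>|\<langle>g, u l\<rangle>|\<^sup>2\<close> on the second coordinate of \<open>l \<in> \<Lambda>\<close>. By orthogonality, Bessel's
  inequality bounds \<open>\<nu>\<close> of every half-open unit interval, while Parseval for \<open>g\<close> times a wave
  says that \<open>\<nu>\<close> convolved with the probability density \<open>|\<integral>\<^sub>0\<^sup>1 wave t|\<^sup>2\<close> is that same bound.
  Hence equality holds in Bessel's inequality for almost every unit window, thus by
  right-continuity for every one, and the part of \<open>\<Lambda>\<close> inside one window is a spectrum of the layers.
\<close>

section \<open>Null sets and tilings\<close>

text \<open>For spectra, the obstacle is that two points of \<open>\<Lambda>\<close> whose second
  coordinates differ by a nonzero integer are orthogonal over the slabs whatever their layer
  characters do. Reducing all of \<open>\<Lambda>\<close> modulo one therefore need not give an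
  orthogonal family. A half-open unit window contains no such pair, and the mean of a wave over (0,
  1) vanishes only at nonzero integer frequencies, so orthogonality descends at once; what has to be
  earned is completeness. That the kernel has total mass one is again Parseval on (0, 1), applied to
  a wave itself, so the integral of a squared sinc is never computed. For weak tilings, the sets
  \<open>W j\<close> are only Lebesgue measurable, while integrals against an image measure call for
  Borel integrands. Passing to Borel parts alters both unions only over one null set of first
  coordinates, and by Fubini this does not affect convolutions with an arbitrary locally finite
  measure. The height \<open>y\<close> is taken in (0, 1) because the origin is then sent to the
  origin.\<close>

instance int :: second_countable_topology
proof
  show "\<exists>B::int set set. countable B \<and> open = generate_topology B"
    by (intro exI[of _ "range lessThan \<union> range greaterThan"])
      (auto simp: open_int_def open_discrete fun_eq_iff)
qed

interpretation lborel_count_pair: pair_sigma_finite lborel "count_space (UNIV :: int set)"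
  by (intro pair_sigma_finite.intro sigma_finite_lborel sigma_finite_measure_count_space)

lemma sets_lborel_count [measurable_cong, simp]: "sets lborel_count = sets borel"
proof -
  have "sets (lborel_count) = sets (borel \<Otimes>\<^sub>M (borel :: int measure))"
    unfolding lborel_count_def
    by (intro sets_pair_measure_cong) (simp_all add: sets_borel_eq_count_space)
  then show ?thesis
    by (simp only: borel_prod)
qed

lemma space_lborel_count [simp]: "space lborel_count = UNIV"
  by (simp add: lborel_count_def space_pair_measure)

lemma sigma_finite_lborel_count: "sigma_finite_measure lborel_count"
  unfolding lborel_count_def by unfold_locales

section \<open>Null sets, completions and horizontal sections\<close>

lemma null_sets_Times:
  assumes "A \<in> null_sets M" "B \<in> sets N" "sigma_finite_measure N"
  shows "A \<times> B \<in> null_sets (M \<Otimes>\<^sub>M N)"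
  using assms sigma_finite_measure.emeasure_pair_measure_Times[OF assms(3), of A M B]
  by (simp add: null_sets_def)

text \<open>The null part of \<open>A\<close> spreads to a null strip over \<open>N\<close>, so only
  the main part contributes. The factor \<open>B\<close> stays uncompleted; it will be an open
  interval or a singleton.\<close>

lemma emeasure_completion_Times:
  assumes "A \<in> sets (completion M)" "B \<in> sets N" "sigma_finite_measure N"
  shows "A \<times> B \<in> sets (completion (M \<Otimes>\<^sub>M N))"
    and "emeasure (completion (M \<Otimes>\<^sub>M N)) (A \<times> B) = emeasure (completion M) A * emeasure N B"
proof -
  interpret N: sigma_finite_measure N by fact
  obtain K where K: "K \<in> null_sets M" "null_part M A \<subseteq> K"
    using null_part[OF assms(1)] by auto
  let ?A = "main_part M A"
  have A: "?A \<union> null_part M A = A" "?A \<in> sets M"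
    using assms(1) by simp_all
  have KN: "K \<times> space N \<in> null_sets (M \<Otimes>\<^sub>M N)"
    using K assms(3) by (auto intro: null_sets_Times)
  have sub: "null_part M A \<times> B \<subseteq> K \<times> space N"
    using K sets.sets_into_space[OF assms(2)] by auto
  have eq: "A \<times> B = ?A \<times> B \<union> null_part M A \<times> B"
    using A by auto
  show meas: "A \<times> B \<in> sets (completion (M \<Otimes>\<^sub>M N))"
    using A assms(2) by (intro sets_completionI[OF eq sub KN]) auto
  have "emeasure (completion (M \<Otimes>\<^sub>M N)) (A \<times> B) = emeasure (completion (M \<Otimes>\<^sub>M N)) (?A \<times> B)"
  proof (rule emeasure_eq_AE)
    show "AE x in completion (M \<Otimes>\<^sub>M N). (x \<in> A \<times> B) = (x \<in> ?A \<times> B)"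
      unfolding AE_completion_iff using AE_not_in[OF KN]
      by eventually_elim (use eq sub in blast)
    show "?A \<times> B \<in> sets (completion (M \<Otimes>\<^sub>M N))"
      using A assms(2) by auto
  qed fact
  also have "\<dots> = emeasure M ?A * emeasure N B"
    using A assms(2) by (simp add: N.emeasure_pair_measure_Times)
  finally show "emeasure (completion (M \<Otimes>\<^sub>M N)) (A \<times> B) = emeasure (completion M) A * emeasure N B"
    using assms(1) by simp
qed

text \<open>One null set per layer adds up to a null set, as there are countably many
  layers.\<close>

lemma AE_lborel_count_iff:
  "(AE z in lborel_count. P z) \<longleftrightarrow> (\<forall>j. AE x in lborel. P (x, j))"
proof
  assume "AE z in lborel_count. P z"
  then have "AE x in lborel. AE j in count_space UNIV. P (x, j)"
    unfolding lborel_count_def by (rule lborel_count_pair.AE_pair)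
  then show "\<forall>j. AE x in lborel. P (x, j)"
    by (simp add: AE_count_space AE_all_countable)
next
  assume "\<forall>j. AE x in lborel. P (x, j)"
  then have "\<exists>N. N \<in> null_sets lborel \<and> {x. \<not> P (x, j)} \<subseteq> N" for j
    by (auto simp: eventually_ae_filter)
  then obtain N where N: "\<And>j. N j \<in> null_sets lborel" "\<And>j. {x. \<not> P (x, j)} \<subseteq> N j"
    by metis
  have "N j \<times> {j} \<in> null_sets lborel_count" for j
    using N(1)[of j] sigma_finite_measure_count_space unfolding lborel_count_def
    by (intro null_sets_Times) auto
  then have "(\<Union>j. N j \<times> {j}) \<in> null_sets lborel_count"
    by (intro null_sets_UN')  auto
  then show "AE z in lborel_count. P z"
    by (rule AE_I') (use N in fastforce)
qed

lemma AE_lborel_prod_fst: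
  fixes P :: "real \<Rightarrow> bool"
  assumes "AE x in lborel. P x"
  shows "AE z in (lborel :: (real \<times> real) measure). P (fst z)"
proof -
  obtain N where N: "N \<in> null_sets lborel" "{x. \<not> P x} \<subseteq> N"
    using assms by (auto simp: eventually_ae_filter)
  have "N \<times> (UNIV :: real set) \<in> null_sets (lborel \<Otimes>\<^sub>M lborel)"
    using N sigma_finite_lborel by (intro null_sets_Times) auto
  then show ?thesis
    unfolding lborel_prod by (rule AE_I') (use N in fastforce)
qed

lemma AE_lborel_prod_snd:
  fixes P :: "real \<Rightarrow> bool"
  assumes "AE x in lborel. P x"
  shows "AE z in (lborel :: (real \<times> real) measure). P (snd z)"
proof -
  obtain N where N: "N \<in> null_sets lborel" "{x. \<not> P x} \<subseteq> N"
    using assms by (auto simp: eventually_ae_filter)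
  have "(UNIV :: real set) \<times> N \<in> null_sets (lborel \<Otimes>\<^sub>M lborel)"
    using N lborel.emeasure_pair_measure_Times[of UNIV lborel N]
    by (simp add: null_sets_def)
  then show ?thesis
    unfolding lborel_prod by (rule AE_I') (use N in fastforce)
qed

lemma AE_lborel_notin_countable:
  fixes A :: "real set"
  assumes "countable A"
  shows "AE x in lborel. x \<notin> A"
  using assms by (intro AE_not_in countable_imp_null_set_lborel)

text \<open>Integer heights are discarded because they lie between the open slabs, where the floor
  still names a layer. Both passages of tilings from the layers to the plane rest on this.\<close>

lemma AE_lborel_floor:
  assumes "AE z in lborel_count. P z"
  shows "AE z in (lborel :: (real \<times> real) measure). snd z \<notin> \<int> \<and> P (fst z, \<lfloor>snd z\<rfloor>)"
proof -
  have "AE x in lborel. \<forall>j. P (x, j)"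
    using assms by (simp add: AE_lborel_count_iff AE_all_countable)
  from AE_lborel_prod_fst[OF this]
    AE_lborel_prod_snd[OF AE_lborel_notin_countable[OF countable_int]]
  show ?thesis
    by eventually_elim auto
qed

lemma AE_lborel_translate:
  fixes P :: "'a::euclidean_space \<Rightarrow> bool"
  assumes "AE x in lborel. P x"
  shows "AE x in lborel. P (x - a)"
proof -
  obtain N where N: "N \<in> null_sets lborel" "{x. \<not> P x} \<subseteq> N"
    using assms by (auto simp: eventually_ae_filter)
  show ?thesis
    by (rule AE_I'[OF null_sets_translation[OF N(1), of a]]) (use N in auto)
qed

text \<open>A single height \<open>y\<close> serves all lines \<open>y + j\<close> at once, since
  each integer \<open>j\<close> excludes only a null set of \<open>y\<close>.\<close>

lemma AE_lborel_prod_sections: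
  assumes "AE z in (lborel :: (real \<times> real) measure). P z"
  shows "AE y in lborel. AE z in lborel_count. P (fst z, y + of_int (snd z))"
proof -
  \<comment> \<open>\<open>AE_pair\<close> fixes the first coordinate, whereas here the height has
    to be fixed.\<close>
  have "AE z in lborel \<Otimes>\<^sub>M lborel. P (prod.swap z)"
  proof -
    obtain N where N: "N \<in> null_sets (lborel \<Otimes>\<^sub>M lborel)" "{z. \<not> P z} \<subseteq> N"
      using assms unfolding lborel_prod[symmetric]
      by (auto simp: eventually_ae_filter space_pair_measure)
    have "AE z in distr (lborel \<Otimes>\<^sub>M lborel) (lborel \<Otimes>\<^sub>M lborel) (\<lambda>(x, y). (y, x)). z \<notin> N"
      using AE_not_in[OF N(1)] lborel_pair.distr_pair_swap by metis
    then have "AE z in lborel \<Otimes>\<^sub>M lborel. (\<lambda>(x, y). (y, x)) z \<notin> N"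
      by (rule AE_distrD[OF measurable_pair_swap'])
    then show ?thesis
      by eventually_elim (use N in auto)
  qed
  then have *: "AE y in lborel. AE x in lborel. P (x, y)"
    using lborel_pair.AE_pair by fastforce
  have "AE y in lborel. AE x in lborel. P (x, y + of_int j)" for j
    using AE_lborel_translate[OF *, of "- of_int j"] by simp
  then show ?thesis
    by (simp add: AE_lborel_count_iff AE_all_countable)
qed

text \<open>Turns almost-everywhere statements into a choice: of a height in (0, 1) for tilings, and
  of window endpoints tending to 0 from the right for spectra.\<close>

lemma AE_lborel_ex_between:
  assumes "AE y in lborel. P (y :: real)" "a < b"
  shows "\<exists>y. a < y \<and> y < b \<and> P y"
proof (rule ccontr)
  assume "\<not> ?thesis"
  then have "{a<..<b} \<subseteq> {y. \<not> P y}"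
    by auto
  moreover obtain N where "N \<in> null_sets lborel" "{y. \<not> P y} \<subseteq> N"
    using assms(1) by (auto simp: eventually_ae_filter)
  ultimately have "{a<..<b} \<in> null_sets lborel"
    using null_sets_subset[of N lborel "{a<..<b}"] by auto
  then show False
    using assms(2) by (simp add: null_sets_def)
qed

text \<open>Subtracting \<open>t\<close> from a point at height \<open>y + j\<close> lands over the
  layer \<open>j + \<lfloor>y - snd t\<rfloor>\<close>; the minus sign turns this into the
  difference of \<open>j\<close> and \<open>snd (lift_layers y t)\<close>.\<close>

definition lift_layers :: "real \<Rightarrow> real \<times> real \<Rightarrow> real \<times> int" where
  "lift_layers y t = (fst t, - \<lfloor>y - snd t\<rfloor>)"

lemma mem_slab_union_iff:
  assumes "y \<notin> \<int>"
  shows "(x, y) \<in> slab_union S W \<longleftrightarrow> (x, \<lfloor>y\<rfloor>) \<in> layer_union S W"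
proof -
  have "j < y \<and> y < j + 1 \<longleftrightarrow> j = \<lfloor>y\<rfloor>" for j :: int
  proof -
    have "y \<noteq> of_int \<lfloor>y\<rfloor>"
      using assms by (metis Ints_of_int)
    then show ?thesis
      by linarith
  qed
  then show ?thesis
    by (auto simp: slab_union_def layer_union_def)
qed

lemma floor_diff_notin_Ints: "(y - of_int k :: real) \<notin> \<int> \<longleftrightarrow> y \<notin> \<int>"
  by (metis Ints_add Ints_diff Ints_of_int diff_add_cancel)

text \<open>The value type is left open because tilings sum real indicators and weak tilings
  integrate \<open>ennreal\<close> ones.\<close>

lemma indicator_slab_diff_embed:
  assumes "y \<notin> \<int>"
  shows "(indicator (slab_union S W) ((x, y) - (fst t, of_int (snd t))) :: 'a::zero_neq_one)
       = indicator (layer_union S W) ((x, \<lfloor>y\<rfloor>) - t)"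
  using mem_slab_union_iff[of "y - of_int (snd t)" "x - fst t" S W] assms
  by (simp add: indicator_def floor_diff_notin_Ints minus_prod_def)

lemma indicator_slab_diff_lift:
  assumes "y - snd t \<notin> \<int>"
  shows "(indicator (slab_union S W) ((x, y + of_int j) - t) :: 'a::zero_neq_one)
       = indicator (layer_union S W) ((x, j) - lift_layers y t)"
proof -
  have eq: "y + of_int j - snd t = y - snd t - of_int (- j)"
    by simp
  have "y + of_int j - snd t \<notin> \<int>"
    unfolding eq floor_diff_notin_Ints by fact
  moreover have "\<lfloor>y + of_int j - snd t\<rfloor> = j + \<lfloor>y - snd t\<rfloor>"
    unfolding eq by simp
  ultimately show ?thesis
    using mem_slab_union_iff[of "y + of_int j - snd t" "x - fst t" S W]
    by (simp add: indicator_def minus_prod_def lift_layers_def)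
qed

section \<open>The two unions under the hypotheses of the theorem, and their tilings\<close>

locale finite_slabs =
  fixes S :: "int set" and W :: "int \<Rightarrow> real set"
  assumes finite_S: "finite S"
    and bounded_W: "\<And>j. j \<in> S \<Longrightarrow> bounded (W j)"
    and lmeasurable_W: "\<And>j. j \<in> S \<Longrightarrow> W j \<in> lmeasurable"
    and measure_W: "\<And>j. j \<in> S \<Longrightarrow> measure lebesgue (W j) > 0"
begin

lemma fmeasurable_slab:
  assumes "j \<in> S"
  shows "W j \<times> {real_of_int j<..<real_of_int (j + 1)} \<in> fmeasurable (completion lborel)"
    and "measure (completion lborel) (W j \<times> {real_of_int j<..<real_of_int (j + 1)}) > 0"
  using lmeasurable_W[OF assms] measure_W[OF assms]
    emeasure_completion_Times[of "W j" lborel "{real_of_int j<..<real_of_int (j + 1)}" lborel]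
  by (auto simp: lborel_prod fmeasurable_def measure_def sigma_finite_lborel)

lemma fmeasurable_layer:
  assumes "j \<in> S"
  shows "W j \<times> {j} \<in> fmeasurable (completion lborel_count)"
    and "measure (completion lborel_count) (W j \<times> {j}) > 0"
  using lmeasurable_W[OF assms] measure_W[OF assms]
    emeasure_completion_Times[of "W j" lborel "{j}" "count_space UNIV"]
  by (auto simp: lborel_count_def fmeasurable_def measure_def sigma_finite_measure_count_space)

lemma fmeasurable_unions:
  "slab_union S W \<in> fmeasurable (completion lborel)"
  "layer_union S W \<in> fmeasurable (completion lborel_count)"
  unfolding slab_union_def layer_union_def
  using fmeasurable_slab fmeasurable_layer finite_S by (auto intro!: fmeasurable.finite_UN)

lemma bounded_unions: "bounded (slab_union S W)" "bounded (layer_union S W)"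
proof -
  have "bounded (W j \<times> {real_of_int j<..<real_of_int (j + 1)})" "bounded (W j \<times> {j})" if "j \<in> S" for j
    using bounded_W[OF that] by (auto intro!: bounded_Times)
  then show "bounded (slab_union S W)" "bounded (layer_union S W)"
    unfolding slab_union_def layer_union_def using finite_S by auto
qed

text \<open>The side condition in the definitions of tiles thus becomes \<open>S \<noteq> {}\<close>
  for the slabs and for the layers alike, and only the existence of translations or measures has to
  be transferred.\<close>

lemma bounded_positive_set_slab_iff: "bounded_positive_set lborel (slab_union S W) \<longleftrightarrow> S \<noteq> {}"
proof -
  have "measure (completion lborel) (slab_union S W) > 0" if "j \<in> S" for j
  proof -
    have "W j \<times> {real_of_int j<..<real_of_int (j + 1)} \<subseteq> slab_union S W"
      using that by (auto simp: slab_union_def)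
    from measure_mono_fmeasurable[OF this _ fmeasurable_unions(1)] fmeasurable_slab[OF that]
    show ?thesis
      by (auto simp: fmeasurableD)
  qed
  moreover have "slab_union {} W = {}"
    by (simp add: slab_union_def)
  ultimately show ?thesis
    unfolding bounded_positive_set_def using bounded_unions fmeasurable_unions by auto
qed

lemma bounded_positive_set_layer_iff:
  "bounded_positive_set lborel_count (layer_union S W) \<longleftrightarrow> S \<noteq> {}"
proof -
  have "measure (completion lborel_count) (layer_union S W) > 0" if "j \<in> S" for j
  proof -
    have "W j \<times> {j} \<subseteq> layer_union S W"
      using that by (auto simp: layer_union_def)
    from measure_mono_fmeasurable[OF this _ fmeasurable_unions(2)] fmeasurable_layer[OF that]
    show ?thesis
      by (auto simp: fmeasurableD)
  qed
  moreover have "layer_union {} W = {}"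
    by (simp add: layer_union_def)
  ultimately show ?thesis
    unfolding bounded_positive_set_def using bounded_unions fmeasurable_unions by auto
qed

text \<open>Some \<open>W j\<close> is not null, so no translate of the layer union fits into the
  exceptional set of \<open>P\<close>. Evaluating a tiling identity at such a point rules out
  collisions of translations and excess mass at the origin.\<close>

lemma AE_layer_union_translate_ex:
  assumes "S \<noteq> {}" "AE z in lborel_count. P z"
  shows "\<exists>z. P z \<and> z - a \<in> layer_union S W"
proof -
  obtain j where j: "j \<in> S"
    using assms by auto
  have "AE x in lborel. P (x, j + snd a)"
    using assms(2) by (simp add: AE_lborel_count_iff)
  from AE_lborel_translate[OF this, of "- fst a"]
  obtain N where N: "N \<in> null_sets lborel" "{x. \<not> P (x + fst a, j + snd a)} \<subseteq> N"
    by (auto simp: eventually_ae_filter)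
  have "\<not> W j \<subseteq> N"
  proof
    assume "W j \<subseteq> N"
    then have "W j \<in> null_sets lebesgue"
      by (rule null_sets_completion_subset[OF _ null_sets_completionI[OF N(1)]])
    then have "measure lebesgue (W j) = 0"
      by (rule measure_eq_0_null_sets)
    with measure_W[OF j] show False
      by linarith
  qed
  then obtain x where "x \<in> W j" "P (x + fst a, j + snd a)"
    using N(2) by auto
  then show ?thesis
    using j by (intro exI[of _ "(x + fst a, j + snd a)"]) (simp add: layer_union_def minus_prod_def)
qed

lemma is_tile_slab_iff_layer:
  "is_tile lborel (slab_union S W) \<longleftrightarrow> is_tile lborel_count (layer_union S W)"
proof (cases "S = {}")
  case True
  then show ?thesis
    using bounded_positive_set_slab_iff bounded_positive_set_layer_iff by (simp add: is_tile_def)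
next
  case False
  have "\<exists>T'. countable T' \<and>
      (AE z in lborel_count. ((\<lambda>t. indicator (layer_union S W) (z - t) :: real) has_sum 1) T')"
    if T: "countable T"
      and ae: "AE z in lborel. ((\<lambda>t. indicator (slab_union S W) (z - t) :: real) has_sum 1) T" for T
  proof -
    \<comment> \<open>These are the heights at which some translated slab ends. As \<open>T\<close>
      is countable, almost every \<open>y\<close> avoids all of them simultaneously.\<close>
    have "countable (\<Union>t\<in>T. (\<lambda>n. snd t + of_int n :: real) ` UNIV)"
      using T by auto
    from AE_lborel_notin_countable[OF this] AE_lborel_prod_sections[OF ae]
    have "AE y in lborel. (\<forall>t\<in>T. y - snd t \<notin> \<int>) \<and> (AE z in lborel_count.
        ((\<lambda>t. indicator (slab_union S W) ((fst z, y + of_int (snd z)) - t) :: real) has_sum 1) T)"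
    proof eventually_elim
      case (elim y)
      have "y - snd t \<notin> \<int>" if "t \<in> T" for t
        using elim(1) that by (force elim!: Ints_cases simp: algebra_simps)
      with elim(2) show ?case
        by blast
    qed
    then obtain y where y: "\<And>t. t \<in> T \<Longrightarrow> y - snd t \<notin> \<int>" and "AE z in lborel_count.
        ((\<lambda>t. indicator (slab_union S W) ((fst z, y + of_int (snd z)) - t) :: real) has_sum 1) T"
      using AE_lborel_ex_between[OF _ zero_less_one] by blast
    then have ae': "AE z in lborel_count.
        ((\<lambda>t. indicator (layer_union S W) (z - lift_layers y t) :: real) has_sum 1) T"
      by (simp add: indicator_slab_diff_lift cong: has_sum_cong)
    \<comment> \<open>A set of translations has no multiplicities, so the sum can be reindexed only
      along an injective map. If \<open>s\<close> and \<open>t\<close> collided, their two terms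
      alone would contribute 2 at the point \<open>z\<close>.\<close>
    have "inj_on (lift_layers y) T"
    proof (rule inj_onI, rule ccontr)
      fix s t assume st: "s \<in> T" "t \<in> T" "lift_layers y s = lift_layers y t" "s \<noteq> t"
      obtain z where z: "((\<lambda>t. indicator (layer_union S W) (z - lift_layers y t) :: real) has_sum 1) T"
        "z - lift_layers y s \<in> layer_union S W"
        using AE_layer_union_translate_ex[OF False ae'] by blast
      have "(\<Sum>t\<in>{s, t}. indicator (layer_union S W) (z - lift_layers y t) :: real) \<le> 1"
        by (rule has_sum_mono2[OF has_sum_finite z(1)]) (use st in auto)
      then show False
        using st z(2) by simp
    qed
    then have "AE z in lborel_count.
        ((\<lambda>t. indicator (layer_union S W) (z - t) :: real) has_sum 1) (lift_layers y ` T)"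
      using ae' by (simp add: has_sum_reindex o_def)
    then show ?thesis
      using T by blast
  qed
  moreover have "\<exists>T'. countable T' \<and>
      (AE z in lborel. ((\<lambda>t. indicator (slab_union S W) (z - t) :: real) has_sum 1) T')"
    if T: "countable T" and ae:
      "AE z in lborel_count. ((\<lambda>t. indicator (layer_union S W) (z - t) :: real) has_sum 1) T" for T
  proof -
    have inj: "inj_on (\<lambda>t. (fst t, real_of_int (snd t))) T"
      by (auto simp: inj_on_def)
    have "AE z in lborel. ((\<lambda>t. indicator (slab_union S W) (z - t) :: real) has_sum 1)
        ((\<lambda>t. (fst t, real_of_int (snd t))) ` T)"
      using AE_lborel_floor[OF ae]
    proof eventually_elim
      case (elim z)
      then show ?case
        using inj indicator_slab_diff_embed[of "snd z" S W "fst z", where 'a = real]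
        by (simp add: has_sum_reindex o_def)
    qed
    then show ?thesis
      using T by blast
  qed
  ultimately show ?thesis
    unfolding is_tile_def bounded_positive_set_slab_iff bounded_positive_set_layer_iff by blast
qed

end

section \<open>Weak tilings\<close>

text \<open>Completing the measure changes no nonnegative integral, so the later arguments work over
  \<open>\<mu>\<close> itself.\<close>

lemma indicator_conv_eq: "indicator_conv E \<mu> x = (\<integral>\<^sup>+ t. indicator E (x - t) \<partial>\<mu>)"
  by (simp add: indicator_conv_def nn_integral_completion)

text \<open>Only the mass at the origin is kept in the integral. At a point of \<open>E\<close>
  where the convolution is 1, the atom is hence at most 1.\<close>

lemma indicator_conv_ge_atom:
  assumes "{0} \<in> sets \<mu>"
  shows "indicator E x * emeasure \<mu> {0} \<le> indicator_conv E \<mu> x"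
proof -
  have "indicator E x * emeasure \<mu> {0} = (\<integral>\<^sup>+ t. indicator E x * indicator {0} t \<partial>\<mu>)"
    using assms by (simp add: nn_integral_cmult_indicator)
  also have "\<dots> \<le> indicator_conv E \<mu> x"
    unfolding indicator_conv_eq by (intro nn_integral_mono) (auto simp: indicator_def)
  finally show ?thesis .
qed

text \<open>By Lindelof, countably many open sets of finite measure cover the space. This opens the
  way to Fubini for \<open>\<mu>\<close> and the Haar measure.\<close>

lemma locally_finite_borel_measure_sigma_finite:
  fixes \<mu> :: "'a::second_countable_topology measure"
  assumes "locally_finite_borel_measure \<mu>"
  shows "sigma_finite_measure \<mu>"
proof -
  let ?F = "{U. open U \<and> emeasure \<mu> U < \<infinity>}"
  have sets: "sets \<mu> = sets borel" and U: "\<Union>?F = UNIV"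
    using assms by (auto simp: locally_finite_borel_measure_def)
  obtain F where F: "F \<subseteq> ?F" "countable F" "\<Union>F = \<Union>?F"
    using Lindelof[of ?F] by auto
  have "space \<mu> = UNIV"
    using sets_eq_imp_space_eq[OF sets] by simp
  moreover have "F \<subseteq> sets \<mu>" "\<forall>U\<in>F. emeasure \<mu> U \<noteq> \<infinity>"
    using F(1) sets by auto
  ultimately show ?thesis
    using F(2,3) U by (intro sigma_finite_measure.intro exI[of _ F]) simp
qed

text \<open>A finite subcover by neighbourhoods of finite measure. Image measures are shown to be
  locally finite by putting preimages of small open sets into compact ones.\<close>

lemma locally_finite_borel_measure_compact:
  assumes "locally_finite_borel_measure \<mu>" "compact K"
  shows "emeasure \<mu> K < \<infinity>"
proof -
  have sets: "sets \<mu> = sets borel"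
    using assms(1) by (simp add: locally_finite_borel_measure_def)
  obtain U where U: "\<And>x. open (U x)" "\<And>x. x \<in> U x" "\<And>x. emeasure \<mu> (U x) < \<infinity>"
    using assms(1) unfolding locally_finite_borel_measure_def by metis
  have "K \<subseteq> (\<Union>x\<in>K. U x)"
    using U(2) by auto
  then obtain C where C: "C \<subseteq> K" "finite C" "K \<subseteq> (\<Union>x\<in>C. U x)"
    using compactE_image[OF assms(2), of K U] U(1) by metis
  have "emeasure \<mu> K \<le> emeasure \<mu> (\<Union>x\<in>C. U x)"
    using C U(1) sets by (intro emeasure_mono) auto
  also have "\<dots> \<le> (\<Sum>x\<in>C. emeasure \<mu> (U x))"
    using C U(1) sets by (intro emeasure_subadditive_finite) auto
  also have "\<dots> < \<infinity>"
    using C U(3) by simp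
  finally show ?thesis .
qed

text \<open>For fixed \<open>t\<close> the bad \<open>z\<close> have first coordinate in a translate
  of \<open>N\<close>, which is null; Fubini exchanges the quantifiers. The measure \<open>M\<close>
  is kept general to cover the plane and the layers together.\<close>

lemma AE_AE_fst_diff_notin_null:
  fixes M \<mu> :: "(real \<times> 'b::second_countable_topology) measure"
  assumes "sigma_finite_measure M" "sets M = sets borel"
    and "\<And>P. (AE x in lborel. P x) \<Longrightarrow> (AE z in M. P (fst z))"
    and "locally_finite_borel_measure \<mu>"
    and "N \<in> null_sets lborel"
  shows "AE z in M. AE t in \<mu>. fst z - fst t \<notin> N"
proof -
  interpret pair_sigma_finite M \<mu>
    using assms(1) locally_finite_borel_measure_sigma_finite[OF assms(4)]
    by (rule pair_sigma_finite.intro)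
  have sets: "sets \<mu> = sets borel"
    using assms(4) by (simp add: locally_finite_borel_measure_def)
  have [measurable]: "N \<in> sets borel"
    using assms(5) by auto
  have [measurable]: "(fst :: real \<times> 'b \<Rightarrow> real) \<in> borel_measurable borel"
    by (intro borel_measurable_continuous_onI continuous_intros)
  note [measurable_cong] = assms(2) sets
  have "AE z in M. fst z - fst t \<notin> N" for t :: "real \<times> 'b"
    using assms(3)[OF AE_lborel_translate[OF AE_not_in[OF assms(5)]]] .
  then have "AE t in \<mu>. AE z in M. fst z - fst t \<notin> N"
    by simp
  moreover have "{z \<in> space (M \<Otimes>\<^sub>M \<mu>). fst (fst z) - fst (snd z) \<notin> N} \<in> sets (M \<Otimes>\<^sub>M \<mu>)"
    by measurable
  ultimately show ?thesis
    using AE_commute[of "\<lambda>z t. fst z - fst t \<notin> N"] by simp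
qed

text \<open>A Borel subset of \<open>W j\<close> with null difference. It makes the indicators of
  both unions Borel, as integration against an image measure demands.\<close>

definition borel_part :: "(int \<Rightarrow> real set) \<Rightarrow> int \<Rightarrow> real set" where
  "borel_part W j = main_part lborel (W j)"

section \<open>Borel maps between the two groups, and local finiteness of image measures\<close>

lemma borel_real_int_measurable:
  "f \<in> borel_measurable M \<Longrightarrow> g \<in> M \<rightarrow>\<^sub>M count_space UNIV \<Longrightarrow>
    (\<lambda>x. (f x, g x)) \<in> M \<rightarrow>\<^sub>M (borel :: (real \<times> int) measure)"
  unfolding borel_prod[symmetric]
  by (rule measurable_Pair) (simp_all add: measurable_cong_sets[OF refl sets_borel_eq_count_space])

lemma measurable_fst_real_int [measurable]: "fst \<in> (borel :: (real \<times> int) measure) \<rightarrow>\<^sub>M borel"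
  by (intro borel_measurable_continuous_onI continuous_intros)

lemma measurable_snd_real_int [measurable]:
  "snd \<in> (borel :: (real \<times> int) measure) \<rightarrow>\<^sub>M count_space UNIV"
proof -
  have "snd \<in> (borel :: (real \<times> int) measure) \<rightarrow>\<^sub>M borel"
    by (intro borel_measurable_continuous_onI continuous_intros)
  then show ?thesis
    by (simp only: measurable_cong_sets[OF refl sets_borel_eq_count_space])
qed

lemma measurable_lift_layers: "lift_layers y \<in> borel \<rightarrow>\<^sub>M borel"
proof -
  have [measurable]: "(snd :: real \<times> real \<Rightarrow> real) \<in> borel_measurable borel"
    "(fst :: real \<times> real \<Rightarrow> real) \<in> borel_measurable borel"
    by (intro borel_measurable_continuous_onI continuous_intros)+
  show ?thesis
    unfolding lift_layers_def[abs_def] by (intro borel_real_int_measurable) measurable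
qed

lemma measurable_embed_layers:
  "(\<lambda>t. (fst t, real_of_int (snd t))) \<in> (borel :: (real \<times> int) measure) \<rightarrow>\<^sub>M borel"
proof -
  have "(\<lambda>t. (fst t, real_of_int (snd t))) \<in> (borel :: (real \<times> int) measure) \<rightarrow>\<^sub>M borel \<Otimes>\<^sub>M borel"
    by measurable
  then show ?thesis
    unfolding borel_prod .
qed

lemma borel_slab_union:
  assumes "finite S" "\<And>j. j \<in> S \<Longrightarrow> W j \<in> sets borel"
  shows "slab_union S W \<in> sets borel"
  unfolding slab_union_def borel_prod[symmetric] using assms by (intro sets.finite_UN) auto

lemma borel_layer_union:
  assumes "finite S" "\<And>j. j \<in> S \<Longrightarrow> W j \<in> sets borel"
  shows "layer_union S W \<in> sets borel"
  unfolding layer_union_def borel_prod[symmetric] using assms by (intro sets.finite_UN) auto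

text \<open>The heights sent to layer \<open>k\<close> form the interval from
  \<open>y + k - 1\<close> (excluded) to \<open>y + k\<close>, so the preimage of a bounded piece of
  one layer lies in a compact rectangle.\<close>

lemma locally_finite_distr_lift_layers:
  assumes "locally_finite_borel_measure \<mu>"
  shows "locally_finite_borel_measure (distr \<mu> borel (lift_layers y))"
  unfolding locally_finite_borel_measure_def
proof (intro conjI allI)
  fix p :: "real \<times> int"
  have sets: "sets \<mu> = sets borel" and sp: "space \<mu> = UNIV"
    using assms sets_eq_imp_space_eq[of \<mu> borel] by (auto simp: locally_finite_borel_measure_def)
  have m: "lift_layers y \<in> \<mu> \<rightarrow>\<^sub>M borel"
    using measurable_lift_layers sets by (simp cong: measurable_cong_sets)
  let ?U = "ball (fst p) 1 \<times> {snd p}"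
  let ?K = "cball (fst p) 1 \<times> {y + snd p - 1 .. y + snd p + 1}"
  have U: "open ?U"
    by (intro open_Times open_ball open_discrete)
  have K: "compact ?K"
    by (intro compact_Times) auto
  have "emeasure (distr \<mu> borel (lift_layers y)) ?U = emeasure \<mu> (lift_layers y -` ?U)"
    using U by (subst emeasure_distr[OF m]) (auto simp: sp)
  also have "\<dots> \<le> emeasure \<mu> ?K"
  proof (rule emeasure_mono)
    show "lift_layers y -` ?U \<subseteq> ?K"
      by (auto simp: lift_layers_def) linarith+
    show "?K \<in> sets \<mu>"
      using K sets by (simp add: compact_imp_closed)
  qed
  also have "\<dots> < \<infinity>"
    by (rule locally_finite_borel_measure_compact[OF assms K])
  finally show "\<exists>U. open U \<and> p \<in> U \<and> emeasure (distr \<mu> borel (lift_layers y)) U < \<infinity>"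
    using U by (intro exI[of _ ?U]) (auto simp: mem_Times_iff)
qed simp

text \<open>A ball of radius 1 meets only finitely many integer heights, and a finite set of
  integers is compact.\<close>

lemma locally_finite_distr_embed_layers:
  fixes \<mu> :: "(real \<times> int) measure"
  assumes "locally_finite_borel_measure \<mu>"
  shows "locally_finite_borel_measure (distr \<mu> borel (\<lambda>t. (fst t, real_of_int (snd t))))"
    (is "locally_finite_borel_measure (distr \<mu> borel ?e)")
  unfolding locally_finite_borel_measure_def
proof (intro conjI allI)
  fix p :: "real \<times> real"
  have sets: "sets \<mu> = sets borel" and sp: "space \<mu> = UNIV"
    using assms sets_eq_imp_space_eq[of \<mu> borel] by (auto simp: locally_finite_borel_measure_def)
  have m: "?e \<in> \<mu> \<rightarrow>\<^sub>M borel"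
    using measurable_embed_layers sets by (simp cong: measurable_cong_sets)
  let ?U = "ball (fst p) 1 \<times> ball (snd p) 1"
  let ?K = "cball (fst p) 1 \<times> {\<lfloor>snd p\<rfloor> - 1 .. \<lfloor>snd p\<rfloor> + 2}"
  have U: "open ?U"
    by (intro open_Times open_ball)
  have K: "compact ?K"
    by (intro compact_Times compact_cball) (simp add: finite_imp_compact)
  have "emeasure (distr \<mu> borel ?e) ?U = emeasure \<mu> (?e -` ?U)"
    using U by (subst emeasure_distr[OF m]) (auto simp: sp)
  also have "\<dots> \<le> emeasure \<mu> ?K"
  proof (rule emeasure_mono)
    show "?e -` ?U \<subseteq> ?K"
    proof
      fix t assume t: "t \<in> ?e -` ?U"
      then have "\<bar>snd p - snd t\<bar> < 1"
        by (auto simp: dist_real_def)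
      then have "\<lfloor>snd p\<rfloor> - 1 \<le> snd t \<and> snd t \<le> \<lfloor>snd p\<rfloor> + 2"
        by linarith
      then show "t \<in> ?K"
        using t by (cases t) auto
    qed
    show "?K \<in> sets \<mu>"
      using K sets by (simp add: compact_imp_closed)
  qed
  also have "\<dots> < \<infinity>"
    by (rule locally_finite_borel_measure_compact[OF assms K])
  finally show "\<exists>U. open U \<and> p \<in> U \<and> emeasure (distr \<mu> borel ?e) U < \<infinity>"
    using U by (intro exI[of _ ?U]) (auto simp: mem_Times_iff)
qed simp

section \<open>Weak tilings by Borel slabs and layers\<close>

locale finite_borel_slabs = finite_slabs +
  assumes borel_W: "\<And>j. j \<in> S \<Longrightarrow> W j \<in> sets borel"
begin

lemma weak_tile_slab_imp_layer:
  assumes "S \<noteq> {}" "locally_finite_borel_measure \<mu>"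
    and ae: "AE z in lborel. indicator_conv (slab_union S W) \<mu> z = 1"
    and atom: "emeasure \<mu> {0} = 1"
  shows "\<exists>\<mu>'. locally_finite_borel_measure \<mu>' \<and>
    (AE z in lborel_count. indicator_conv (layer_union S W) \<mu>' z = 1) \<and> emeasure \<mu>' {0} = 1"
proof -
  have sets: "sets \<mu> = sets borel" and sp: "space \<mu> = UNIV"
    using assms(2) sets_eq_imp_space_eq[of \<mu> borel] by (auto simp: locally_finite_borel_measure_def)
  interpret pair_sigma_finite lborel \<mu>
    using assms(2) by (intro pair_sigma_finite.intro locally_finite_borel_measure_sigma_finite
        sigma_finite_lborel)
  note [measurable_cong] = sets
  have [measurable]: "(snd :: real \<times> real \<Rightarrow> real) \<in> borel_measurable borel"
    by (intro borel_measurable_continuous_onI continuous_intros)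
  have [measurable]: "(\<int> :: real set) \<in> sets borel"
    by (simp add: countable_int borel_closed closed_Ints)
  \<comment> \<open>The measure need not be carried by a countable set, so avoiding every bad height
    is too much to ask. For each \<open>t\<close> almost every \<open>y\<close> is good, and Fubini
    yields a \<open>y\<close> that is good for almost every \<open>t\<close>.\<close>
  have "AE y in lborel. y - snd t \<notin> \<int>" for t :: "real \<times> real"
    using AE_lborel_translate[OF AE_lborel_notin_countable[OF countable_int]] .
  then have "AE t in \<mu>. AE y in lborel. y - snd t \<notin> \<int>"
    by simp
  moreover have "{z \<in> space (lborel \<Otimes>\<^sub>M \<mu>). fst z - snd (snd z) \<notin> \<int>} \<in> sets (lborel \<Otimes>\<^sub>M \<mu>)"
    by measurable
  ultimately have "AE y in lborel. AE t in \<mu>. y - snd t \<notin> \<int>"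
    using AE_commute[of "\<lambda>y t. y - snd t \<notin> \<int>"] by simp
  with AE_lborel_prod_sections[OF ae]
  have "AE y in lborel. (AE t in \<mu>. y - snd t \<notin> \<int>) \<and> (AE z in lborel_count.
      indicator_conv (slab_union S W) \<mu> (fst z, y + of_int (snd z)) = 1)"
    by eventually_elim blast
  \<comment> \<open>The bounds on \<open>y\<close> give \<open>\<lfloor>y\<rfloor> = 0\<close>,
    which makes \<open>lift_layers y\<close> fix the origin, so that the image keeps at least the
    original atom.\<close>
  then obtain y where y: "0 < y" "y < 1" "AE t in \<mu>. y - snd t \<notin> \<int>"
    and conv: "AE z in lborel_count. indicator_conv (slab_union S W) \<mu> (fst z, y + of_int (snd z)) = 1"
    using AE_lborel_ex_between[OF _ zero_less_one] by blast
  let ?\<mu> = "distr \<mu> borel (lift_layers y)"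
  have m: "lift_layers y \<in> \<mu> \<rightarrow>\<^sub>M borel"
    using measurable_lift_layers sets by (simp cong: measurable_cong_sets)
  have lf: "locally_finite_borel_measure ?\<mu>"
    by (rule locally_finite_distr_lift_layers) fact
  have eq: "indicator_conv (layer_union S W) ?\<mu> z
      = indicator_conv (slab_union S W) \<mu> (fst z, y + of_int (snd z))" for z
  proof -
    have [measurable]: "layer_union S W \<in> sets borel"
      by (rule borel_layer_union[OF finite_S borel_W])
    have [measurable]: "(\<lambda>t. z - t) \<in> borel \<rightarrow>\<^sub>M (borel :: (real \<times> int) measure)"
      unfolding minus_prod_def by (intro borel_real_int_measurable) measurable
    have "indicator_conv (layer_union S W) ?\<mu> z
        = (\<integral>\<^sup>+ t. indicator (layer_union S W) (z - lift_layers y t) \<partial>\<mu>)"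
      unfolding indicator_conv_eq by (rule nn_integral_distr[OF m]) measurable
    also have "\<dots> = (\<integral>\<^sup>+ t. indicator (slab_union S W) ((fst z, y + of_int (snd z)) - t) \<partial>\<mu>)"
    proof (rule nn_integral_cong_AE)
      show "AE t in \<mu>. (indicator (layer_union S W) (z - lift_layers y t) :: ennreal)
          = indicator (slab_union S W) ((fst z, y + of_int (snd z)) - t)"
        using y(3) by eventually_elim (simp add: indicator_slab_diff_lift)
    qed
    finally show ?thesis
      by (simp add: indicator_conv_eq)
  qed
  have ae': "AE z in lborel_count. indicator_conv (layer_union S W) ?\<mu> z = 1"
    unfolding eq by (rule conv)
  have "emeasure ?\<mu> {0} = 1"
  proof (rule antisym)
    obtain z where "indicator_conv (layer_union S W) ?\<mu> z = 1" "z - 0 \<in> layer_union S W"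
      using AE_layer_union_translate_ex[OF assms(1) ae'] by blast
    then show "emeasure ?\<mu> {0} \<le> 1"
      using indicator_conv_ge_atom[of ?\<mu> "layer_union S W" z] by simp
    have "\<lfloor>y\<rfloor> = 0"
      using y(1,2) by linarith
    then have "lift_layers y 0 = 0"
      by (simp add: lift_layers_def zero_prod_def)
    then have "emeasure \<mu> {0} \<le> emeasure \<mu> (lift_layers y -` {0} \<inter> space \<mu>)"
      using measurable_sets[OF m, of "{0}"] by (intro emeasure_mono) (auto simp: sp)
    then show "1 \<le> emeasure ?\<mu> {0}"
      using atom by (simp add: emeasure_distr[OF m])
  qed
  with lf ae' show ?thesis
    by blast
qed

lemma weak_tile_layer_imp_slab:
  assumes "locally_finite_borel_measure \<mu>"
    and ae: "AE z in lborel_count. indicator_conv (layer_union S W) \<mu> z = 1"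
    and atom: "emeasure \<mu> {0} = 1"
  shows "\<exists>\<mu>'. locally_finite_borel_measure \<mu>' \<and>
    (AE z in lborel. indicator_conv (slab_union S W) \<mu>' z = 1) \<and> emeasure \<mu>' {0} = 1"
proof -
  have sets: "sets \<mu> = sets borel" and sp: "space \<mu> = UNIV"
    using assms(1) sets_eq_imp_space_eq[of \<mu> borel] by (auto simp: locally_finite_borel_measure_def)
  let ?e = "\<lambda>t. (fst t, real_of_int (snd t))"
  let ?\<mu> = "distr \<mu> borel ?e"
  have m: "?e \<in> \<mu> \<rightarrow>\<^sub>M borel"
    using measurable_embed_layers sets by (simp cong: measurable_cong_sets)
  have [measurable]: "slab_union S W \<in> sets borel"
    by (rule borel_slab_union[OF finite_S borel_W])
  have [measurable]: "(\<lambda>t. z - t) \<in> borel \<rightarrow>\<^sub>M borel" for z :: "real \<times> real"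
    by measurable
  have eq: "indicator_conv (slab_union S W) ?\<mu> z = indicator_conv (layer_union S W) \<mu> (fst z, \<lfloor>snd z\<rfloor>)"
    if "snd z \<notin> \<int>" for z
  proof -
    have "indicator_conv (slab_union S W) ?\<mu> z
        = (\<integral>\<^sup>+ t. indicator (slab_union S W) (z - ?e t) \<partial>\<mu>)"
      unfolding indicator_conv_eq by (rule nn_integral_distr[OF m]) measurable
    also have "\<dots> = indicator_conv (layer_union S W) \<mu> (fst z, \<lfloor>snd z\<rfloor>)"
      using indicator_slab_diff_embed[OF that, of S W "fst z", where 'a = ennreal]
      by (simp add: indicator_conv_eq)
    finally show ?thesis .
  qed
  have "AE z in lborel. indicator_conv (slab_union S W) ?\<mu> z = 1"
    using AE_lborel_floor[OF ae] by eventually_elim (simp add: eq)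
  moreover have "emeasure ?\<mu> {0} = 1"
  proof -
    \<comment> \<open>The embedding is injective, hence the atom at the origin is carried over with
      nothing added.\<close>
    have "?e -` {0} \<inter> space \<mu> = {0}"
      by (auto simp: sp zero_prod_def)
    then show ?thesis
      using atom by (simp add: emeasure_distr[OF m])
  qed
  ultimately show ?thesis
    using locally_finite_distr_embed_layers[OF assms(1)] by blast
qed

lemma borel_is_weak_tile_slab_iff_layer:
  "is_weak_tile lborel (slab_union S W) \<longleftrightarrow> is_weak_tile lborel_count (layer_union S W)"
  unfolding is_weak_tile_def bounded_positive_set_slab_iff bounded_positive_set_layer_iff
  using weak_tile_slab_imp_layer weak_tile_layer_imp_slab by blast

end

lemma AE_eq_const_cong:
  assumes "AE x in M. f x = g x"
  shows "(AE x in M. f x = c) \<longleftrightarrow> (AE x in M. g x = c)"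
  using assms by (intro eventually_subst) (auto elim!: eventually_mono)

section \<open>Reduction of weak tilings to Borel layers\<close>

context finite_slabs
begin

lemma finite_borel_slabs_borel_part: "finite_borel_slabs S (borel_part W)"
proof
  show "finite S"
    by (rule finite_S)
  fix j assume j: "j \<in> S"
  have W: "W j \<in> sets (completion lborel)"
    using lmeasurable_W[OF j] by (rule fmeasurableD)
  then show "borel_part W j \<in> sets borel"
    using main_part_sets[OF W] by (simp add: borel_part_def)
  have sub: "borel_part W j \<subseteq> W j"
    using main_part_null_part_Un[OF W] by (auto simp: borel_part_def)
  show "bounded (borel_part W j)"
    by (rule bounded_subset[OF bounded_W[OF j] sub])
  have eq: "emeasure lebesgue (borel_part W j) = emeasure lebesgue (W j)"
    using emeasure_completion[OF W] main_part_sets[OF W] by (simp add: borel_part_def)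
  then show "borel_part W j \<in> lmeasurable"
    using lmeasurable_W[OF j] main_part_sets[OF W]
    by (auto simp: fmeasurable_def borel_part_def)
  show "0 < measure lebesgue (borel_part W j)"
    using measure_W[OF j] eq by (simp add: measure_def)
qed

text \<open>One null set of first coordinates serves all layers. It is a subset of the line, so the
  same \<open>N\<close> controls the exceptional strips in both groups.\<close>

lemma ex_null_set_borel_part:
  "\<exists>N\<in>null_sets lborel. \<forall>j\<in>S. W j - N = borel_part W j - N"
proof -
  have "\<exists>N\<in>null_sets lborel. null_part lborel (W j) \<subseteq> N" if "j \<in> S" for j
    using null_part[of "W j" lborel] fmeasurableD[OF lmeasurable_W[OF that]] by auto
  then obtain N where N: "\<And>j. j \<in> S \<Longrightarrow> N j \<in> null_sets lborel"
    "\<And>j. j \<in> S \<Longrightarrow> null_part lborel (W j) \<subseteq> N j"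
    by metis
  have "(\<Union>j\<in>S. N j) \<in> null_sets lborel"
    using N(1) finite_S by (intro null_sets_UN') (auto simp: countable_finite)
  moreover have "W j - (\<Union>j\<in>S. N j) = borel_part W j - (\<Union>j\<in>S. N j)" if "j \<in> S" for j
    using N(2)[OF that] main_part_null_part_Un[OF fmeasurableD[OF lmeasurable_W[OF that]]] that
    unfolding borel_part_def by blast
  ultimately show ?thesis
    by blast
qed

lemma slab_union_borel_part_cong:
  assumes "\<forall>j\<in>S. W j - N = borel_part W j - N" "fst z \<notin> N"
  shows "z \<in> slab_union S W \<longleftrightarrow> z \<in> slab_union S (borel_part W)"
  using assms by (fastforce simp: slab_union_def)

lemma layer_union_borel_part_cong:
  assumes "\<forall>j\<in>S. W j - N = borel_part W j - N" "fst z \<notin> N"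
  shows "z \<in> layer_union S W \<longleftrightarrow> z \<in> layer_union S (borel_part W)"
  using assms by (fastforce simp: layer_union_def)

text \<open>A measure that works for \<open>W\<close> works for \<open>borel_part W\<close> and
  conversely: at almost every point, almost every translation avoids the exceptional strip, so the
  two convolutions agree there.\<close>

lemma is_weak_tile_slab_iff_layer:
  "is_weak_tile lborel (slab_union S W) \<longleftrightarrow> is_weak_tile lborel_count (layer_union S W)"
proof -
  interpret borel_part: finite_borel_slabs S "borel_part W"
    by (rule finite_borel_slabs_borel_part)
  obtain N where N: "N \<in> null_sets lborel" "\<forall>j\<in>S. W j - N = borel_part W j - N"
    using ex_null_set_borel_part by blast
  have "AE z in lborel. indicator_conv (slab_union S W) \<mu> z = indicator_conv (slab_union S (borel_part W)) \<mu> z"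
    if "locally_finite_borel_measure \<mu>" for \<mu>
  proof -
    have "AE z in lborel. AE t in \<mu>. fst (z :: real \<times> real) - fst t \<notin> N"
    proof (rule AE_AE_fst_diff_notin_null[OF sigma_finite_lborel _ _ that N(1)])
      show "AE z in (lborel :: (real \<times> real) measure). P (fst z)" if "AE x in lborel. P x" for P :: "real \<Rightarrow> bool"
        using that by (rule AE_lborel_prod_fst)
    qed simp
    then show ?thesis
      unfolding indicator_conv_eq
      by eventually_elim (auto intro!: nn_integral_cong_AE elim!: eventually_mono
          simp: indicator_def slab_union_borel_part_cong[OF N(2)])
  qed
  then have 1: "is_weak_tile lborel (slab_union S W) \<longleftrightarrow> is_weak_tile lborel (slab_union S (borel_part W))"
    unfolding is_weak_tile_def bounded_positive_set_slab_iff borel_part.bounded_positive_set_slab_iff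
    by (intro conj_cong ex_cong1 refl AE_eq_const_cong) blast
  have "AE z in lborel_count. indicator_conv (layer_union S W) \<mu> z = indicator_conv (layer_union S (borel_part W)) \<mu> z"
    if "locally_finite_borel_measure \<mu>" for \<mu>
  proof -
    have "AE z in lborel_count. AE t in \<mu>. fst z - fst t \<notin> N"
      using that N(1) by (intro AE_AE_fst_diff_notin_null sigma_finite_lborel_count)
        (auto simp: AE_lborel_count_iff)
    then show ?thesis
      unfolding indicator_conv_eq
      by eventually_elim (auto intro!: nn_integral_cong_AE elim!: eventually_mono
          simp: indicator_def layer_union_borel_part_cong[OF N(2)])
  qed
  then have 2: "is_weak_tile lborel_count (layer_union S W) \<longleftrightarrow> is_weak_tile lborel_count (layer_union S (borel_part W))"
    unfolding is_weak_tile_def bounded_positive_set_layer_iff borel_part.bounded_positive_set_layer_iff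
    by (intro conj_cong ex_cong1 refl AE_eq_const_cong) blast
  show ?thesis
    unfolding 1 2 by (rule borel_part.borel_is_weak_tile_slab_iff_layer)
qed

end

section \<open>Orthogonal bases and Parseval's identity\<close>

lemma L2_functions_iff:
  "f \<in> L2_functions M \<longleftrightarrow> f \<in> borel_measurable M \<and> integrable M (\<lambda>x. (cmod (f x))\<^sup>2)"
  by (simp add: L2_functions_def)

lemma L2_functions_measurable [measurable_dest]: "f \<in> L2_functions M \<Longrightarrow> f \<in> borel_measurable M"
  by (simp add: L2_functions_def)

lemma L2_functions_integrable: "f \<in> L2_functions M \<Longrightarrow> integrable M (\<lambda>x. (cmod (f x))\<^sup>2)"
  by (simp add: L2_functions_def)

lemma L2_functions_add:
  assumes f: "f \<in> L2_functions M" and g: "g \<in> L2_functions M"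
  shows "(\<lambda>x. f x + g x) \<in> L2_functions M"
  unfolding L2_functions_iff
proof
  note [measurable] = f g
  show "(\<lambda>x. f x + g x) \<in> borel_measurable M"
    by measurable
  have "(cmod (f x + g x))\<^sup>2 \<le> 2 * (cmod (f x))\<^sup>2 + 2 * (cmod (g x))\<^sup>2" for x
  proof -
    have "(cmod (f x + g x))\<^sup>2 \<le> (cmod (f x) + cmod (g x))\<^sup>2"
      by (intro power_mono norm_triangle_ineq) auto
    also have "\<dots> \<le> 2 * (cmod (f x))\<^sup>2 + 2 * (cmod (g x))\<^sup>2"
      using sum_squares_bound[of "cmod (f x)" "cmod (g x)"] by (simp add: power2_sum)
    finally show ?thesis .
  qed
  then have "AE x in M. norm ((cmod (f x + g x))\<^sup>2) \<le> norm (2 * (cmod (f x))\<^sup>2 + 2 * (cmod (g x))\<^sup>2)"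
    by simp
  moreover have "integrable M (\<lambda>x. 2 * (cmod (f x))\<^sup>2 + 2 * (cmod (g x))\<^sup>2)"
    using L2_functions_integrable[OF f] L2_functions_integrable[OF g] by simp
  ultimately show "integrable M (\<lambda>x. (cmod (f x + g x))\<^sup>2)"
    by (rule Bochner_Integration.integrable_bound[rotated 2]) measurable
qed

lemma L2_functions_cmult:
  assumes "f \<in> L2_functions M"
  shows "(\<lambda>x. c * f x) \<in> L2_functions M"
  using assms by (auto simp: L2_functions_iff norm_mult power_mult_distrib)

lemma L2_functions_zero: "(\<lambda>x. 0) \<in> L2_functions M"
  by (simp add: L2_functions_iff)

lemma L2_functions_sum:
  "(\<And>i. i \<in> F \<Longrightarrow> f i \<in> L2_functions M) \<Longrightarrow> (\<lambda>x. \<Sum>i\<in>F. f i x) \<in> L2_functions M"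
  by (induction F rule: infinite_finite_induct) (auto intro: L2_functions_add L2_functions_zero)

lemma L2_functions_diff:
  assumes "f \<in> L2_functions M" "g \<in> L2_functions M"
  shows "(\<lambda>x. f x - g x) \<in> L2_functions M"
  using L2_functions_add[OF assms(1) L2_functions_cmult[OF assms(2), of "-1"]] by simp

lemma L2_functions_bounded:
  assumes "finite_measure M" "f \<in> borel_measurable M" "\<And>x. x \<in> space M \<Longrightarrow> cmod (f x) \<le> B"
  shows "f \<in> L2_functions M"
  unfolding L2_functions_iff
proof
  interpret finite_measure M by fact
  show "integrable M (\<lambda>x. (cmod (f x))\<^sup>2)"
    using assms(2,3) by (intro integrable_const_bound[where B = "B\<^sup>2"]) (auto intro!: power_mono)
qed fact

lemma L2_functions_bounded_mult:
  assumes f: "f \<in> L2_functions M" and [measurable]: "h \<in> borel_measurable M"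
    and "\<And>x. x \<in> space M \<Longrightarrow> cmod (h x) \<le> 1"
  shows "(\<lambda>x. f x * h x) \<in> L2_functions M"
  unfolding L2_functions_iff
proof
  note [measurable] = f
  show "(\<lambda>x. f x * h x) \<in> borel_measurable M"
    by measurable
  have "(cmod (f x) * cmod (h x))\<^sup>2 \<le> (cmod (f x))\<^sup>2" if "x \<in> space M" for x
    using assms(3)[OF that] by (intro power_mono mult_left_le) auto
  then have "AE x in M. norm ((cmod (f x * h x))\<^sup>2) \<le> norm ((cmod (f x))\<^sup>2)"
    by (simp add: norm_mult)
  then show "integrable M (\<lambda>x. (cmod (f x * h x))\<^sup>2)"
    by (rule Bochner_Integration.integrable_bound[OF L2_functions_integrable[OF f], rotated]) measurable
qed

lemma borel_measurable_cnj [measurable (raw)]: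
  "f \<in> borel_measurable M \<Longrightarrow> (\<lambda>x. cnj (f x)) \<in> borel_measurable M"
  by (rule borel_measurable_continuous_on[of cnj]) (auto intro: continuous_intros)

text \<open>Domination by the sum of the two squares, from the inequality of arithmetic and
  geometric means.\<close>

lemma L2_mult_integrable:
  assumes f: "f \<in> L2_functions M" and g: "g \<in> L2_functions M"
  shows "integrable M (\<lambda>x. f x * cnj (g x))"
proof -
  note [measurable] = f g
  have "cmod (f x) * cmod (g x) \<le> (cmod (f x))\<^sup>2 + (cmod (g x))\<^sup>2" for x
    using sum_squares_bound[of "cmod (f x)" "cmod (g x)"]
      mult_nonneg_nonneg[OF norm_ge_zero norm_ge_zero, of "f x" "g x"] by linarith
  then have "AE x in M. norm (f x * cnj (g x)) \<le> norm ((cmod (f x))\<^sup>2 + (cmod (g x))\<^sup>2)"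
    by (simp add: norm_mult)
  moreover have "integrable M (\<lambda>x. (cmod (f x))\<^sup>2 + (cmod (g x))\<^sup>2)"
    using L2_functions_integrable[OF f] L2_functions_integrable[OF g] by simp
  ultimately show ?thesis
    by (rule Bochner_Integration.integrable_bound[rotated 2]) measurable
qed

lemma L2_functions_imp_integrable:
  assumes "finite_measure M" "f \<in> L2_functions M"
  shows "integrable M f"
  using L2_mult_integrable[OF assms(2) L2_functions_bounded[OF assms(1), of "\<lambda>_. 1" 1]] by simp

lemma L2_inner_cnj: "cnj (L2_inner M f g) = L2_inner M g f"
  unfolding L2_inner_def by (subst Bochner_Integration.integral_cnj[symmetric]) (simp add: mult.commute)

lemma L2_inner_self: "L2_inner M f f = of_real (\<integral>x. (cmod (f x))\<^sup>2 \<partial>M)"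
  unfolding L2_inner_def by (simp add: complex_norm_square[symmetric] flip: integral_complex_of_real of_real_power)

lemma L2_inner_diff_left:
  assumes "f \<in> L2_functions M" "g \<in> L2_functions M" "h \<in> L2_functions M"
  shows "L2_inner M (\<lambda>x. f x - g x) h = L2_inner M f h - L2_inner M g h"
  using assms by (simp add: L2_inner_def left_diff_distrib L2_mult_integrable)

lemma L2_inner_diff_right:
  assumes "f \<in> L2_functions M" "g \<in> L2_functions M" "h \<in> L2_functions M"
  shows "L2_inner M h (\<lambda>x. f x - g x) = L2_inner M h f - L2_inner M h g"
  using assms by (simp add: L2_inner_def right_diff_distrib L2_mult_integrable)

lemma L2_inner_sum_left:
  assumes "\<And>i. i \<in> F \<Longrightarrow> e i \<in> L2_functions M" "h \<in> L2_functions M"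
  shows "L2_inner M (\<lambda>x. \<Sum>i\<in>F. c i * e i x) h = (\<Sum>i\<in>F. c i * L2_inner M (e i) h)"
proof -
  have "L2_inner M (\<lambda>x. \<Sum>i\<in>F. c i * e i x) h = (\<integral>x. (\<Sum>i\<in>F. c i * (e i x * cnj (h x))) \<partial>M)"
    unfolding L2_inner_def by (simp add: sum_distrib_right mult.assoc)
  also have "\<dots> = (\<Sum>i\<in>F. c i * L2_inner M (e i) h)"
    using assms unfolding L2_inner_def
    by (subst Bochner_Integration.integral_sum) (auto intro!: L2_mult_integrable)
  finally show ?thesis .
qed

lemma L2_inner_sum_right:
  assumes "\<And>i. i \<in> F \<Longrightarrow> e i \<in> L2_functions M" "h \<in> L2_functions M"
  shows "L2_inner M h (\<lambda>x. \<Sum>i\<in>F. c i * e i x) = (\<Sum>i\<in>F. cnj (c i) * L2_inner M h (e i))"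
  using arg_cong[OF L2_inner_sum_left[where F = F and e = e and h = h and M = M and c = c, OF assms],
      of cnj]
  by (simp add: L2_inner_cnj)

text \<open>Completing the square in each coefficient.\<close>

lemma L2_dist_orthogonal_sum:
  assumes f: "f \<in> L2_functions M" and F: "finite F"
    and e: "\<And>i. i \<in> F \<Longrightarrow> e i \<in> L2_functions M"
    and norm: "\<And>i. i \<in> F \<Longrightarrow> L2_inner M (e i) (e i) = of_real C" and C: "C > 0"
    and orth: "\<And>i j. i \<in> F \<Longrightarrow> j \<in> F \<Longrightarrow> i \<noteq> j \<Longrightarrow> L2_inner M (e i) (e j) = 0"
  shows "(\<integral>x. (cmod (f x - (\<Sum>i\<in>F. c i * e i x)))\<^sup>2 \<partial>M)
    = (\<integral>x. (cmod (f x))\<^sup>2 \<partial>M) - (\<Sum>i\<in>F. (cmod (L2_inner M f (e i)))\<^sup>2) / C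
      + (\<Sum>i\<in>F. (cmod (C * c i - L2_inner M f (e i)))\<^sup>2) / C"
proof -
  let ?g = "\<lambda>x. \<Sum>i\<in>F. c i * e i x"
  define a where "a i = L2_inner M f (e i)" for i
  have g: "?g \<in> L2_functions M"
    using e by (intro L2_functions_sum L2_functions_cmult)
  have fg: "L2_inner M f ?g = (\<Sum>i\<in>F. cnj (c i) * a i)"
    unfolding a_def using e f by (rule L2_inner_sum_right)
  have gf: "L2_inner M ?g f = (\<Sum>i\<in>F. c i * cnj (a i))"
    using arg_cong[OF fg, of cnj] by (simp add: L2_inner_cnj)
  have "L2_inner M (e i) ?g = cnj (c i) * C" if "i \<in> F" for i
  proof -
    have "L2_inner M (e i) ?g = (\<Sum>j\<in>F. cnj (c j) * L2_inner M (e i) (e j))"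
      using e that by (intro L2_inner_sum_right) auto
    also have "\<dots> = (\<Sum>j\<in>F. if j = i then cnj (c j) * C else 0)"
      using that norm orth by (intro sum.cong) auto
    finally show ?thesis
      using F that by simp
  qed
  then have gg: "L2_inner M ?g ?g = (\<Sum>i\<in>F. c i * (cnj (c i) * C))"
    using L2_inner_sum_left[where F = F and c = c, OF e g] by simp
  have "complex_of_real (\<integral>x. (cmod (f x - ?g x))\<^sup>2 \<partial>M)
      = L2_inner M f f - L2_inner M f ?g - (L2_inner M ?g f - L2_inner M ?g ?g)"
    unfolding L2_inner_self[symmetric]
    by (subst L2_inner_diff_left[OF f g L2_functions_diff[OF f g]])
      (simp add: L2_inner_diff_right[OF f g f] L2_inner_diff_right[OF f g g])
  also have "\<dots> = L2_inner M f f
      + (\<Sum>i\<in>F. c i * (cnj (c i) * C) - cnj (c i) * a i - c i * cnj (a i))"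
    unfolding fg gf gg by (simp add: sum_subtractf)
  also have "(\<Sum>i\<in>F. c i * (cnj (c i) * C) - cnj (c i) * a i - c i * cnj (a i))
      = (\<Sum>i\<in>F. of_real (((cmod (C * c i - a i))\<^sup>2 - (cmod (a i))\<^sup>2) / C))"
  proof (rule sum.cong[OF refl])
    fix i
    have "complex_of_real ((cmod (C * c i - a i))\<^sup>2 - (cmod (a i))\<^sup>2)
        = (C * c i - a i) * cnj (C * c i - a i) - a i * cnj (a i)"
      by (simp only: of_real_diff complex_norm_square)
    also have "\<dots> = C * (c i * (cnj (c i) * C) - cnj (c i) * a i - c i * cnj (a i))"
      by (simp add: algebra_simps)
    finally show "c i * (cnj (c i) * C) - cnj (c i) * a i - c i * cnj (a i)
        = of_real (((cmod (C * c i - a i))\<^sup>2 - (cmod (a i))\<^sup>2) / C)"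
      using C by (simp add: field_simps)
  qed
  finally have "complex_of_real (\<integral>x. (cmod (f x - ?g x))\<^sup>2 \<partial>M)
      = of_real ((\<integral>x. (cmod (f x))\<^sup>2 \<partial>M) + (\<Sum>i\<in>F. ((cmod (C * c i - a i))\<^sup>2 - (cmod (a i))\<^sup>2) / C))"
    by (simp add: L2_inner_self)
  then show ?thesis
    unfolding of_real_eq_iff a_def
    by (simp add: sum_subtractf sum_divide_distrib diff_divide_distrib)
qed

section \<open>Bessel's inequality, Parseval's identity and the transport of bases\<close>

lemma nn_integral_count_space_le:
  fixes f :: "'i \<Rightarrow> ennreal"
  assumes "countable I" "\<And>F. finite F \<Longrightarrow> F \<subseteq> I \<Longrightarrow> (\<Sum>i\<in>F. f i) \<le> B"
  shows "(\<integral>\<^sup>+i. f i \<partial>count_space I) \<le> B"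
proof (cases "finite I")
  case True
  then show ?thesis
    using assms(2)[of I] by (simp add: nn_integral_count_space_finite)
next
  case False
  note bij = bij_betw_from_nat_into[OF \<open>countable I\<close> False]
  have "(\<integral>\<^sup>+i. f i \<partial>count_space I) = (\<Sum>n. f (from_nat_into I n))"
    by (simp add: nn_integral_bij_count_space[symmetric, OF bij] nn_integral_count_space_nat)
  also have "\<dots> \<le> B"
  proof (rule suminf_le_const)
    fix n
    have "inj_on (from_nat_into I) {..<n}" "from_nat_into I ` {..<n} \<subseteq> I"
      using bij by (auto simp: bij_betw_def intro: inj_on_subset)
    then show "(\<Sum>i<n. f (from_nat_into I i)) \<le> B"
      using assms(2)[of "from_nat_into I ` {..<n}"] by (simp add: sum.reindex)
  qed simp
  finally show ?thesis .
qed

lemma nn_integral_count_space_ge: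
  fixes f :: "'i \<Rightarrow> ennreal"
  assumes "finite F" "F \<subseteq> I"
  shows "(\<Sum>i\<in>F. f i) \<le> (\<integral>\<^sup>+i. f i \<partial>count_space I)"
proof -
  have "(\<Sum>i\<in>F. f i) = (\<integral>\<^sup>+i. f i * indicator F i \<partial>count_space I)"
    using assms by (subst nn_integral_count_space'[of F]) (auto simp: indicator_def)
  also have "\<dots> \<le> (\<integral>\<^sup>+i. f i \<partial>count_space I)"
    by (intro nn_integral_mono) (auto simp: indicator_def)
  finally show ?thesis .
qed

text \<open>The coefficients \<open>L2_inner M f (e i) / C\<close> minimise the distance, and the
  minimum is nonnegative. The squared norm is a common constant \<open>C\<close> instead of 1,
  because characters restricted to a set have the measure of that set as squared norm.\<close>

lemma Bessel_inequality:
  assumes f: "f \<in> L2_functions M" and I: "countable I"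
    and e: "\<And>i. i \<in> I \<Longrightarrow> e i \<in> L2_functions M"
    and norm: "\<And>i. i \<in> I \<Longrightarrow> L2_inner M (e i) (e i) = of_real C" and C: "C > 0"
    and orth: "\<And>i j. i \<in> I \<Longrightarrow> j \<in> I \<Longrightarrow> i \<noteq> j \<Longrightarrow> L2_inner M (e i) (e j) = 0"
  shows "(\<integral>\<^sup>+i. ennreal ((cmod (L2_inner M f (e i)))\<^sup>2) \<partial>count_space I) \<le> ennreal (C * (\<integral>x. (cmod (f x))\<^sup>2 \<partial>M))"
proof (rule nn_integral_count_space_le[OF I])
  fix F assume F: "finite F" "F \<subseteq> I"
  have "0 \<le> (\<integral>x. (cmod (f x - (\<Sum>i\<in>F. (L2_inner M f (e i) / C) * e i x)))\<^sup>2 \<partial>M)"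
    by (rule integral_nonneg_AE) simp
  also have "\<dots> = (\<integral>x. (cmod (f x))\<^sup>2 \<partial>M) - (\<Sum>i\<in>F. (cmod (L2_inner M f (e i)))\<^sup>2) / C"
    using F e norm orth C by (subst L2_dist_orthogonal_sum[OF f F(1)]) (auto simp: subset_eq)
  finally have "(\<Sum>i\<in>F. (cmod (L2_inner M f (e i)))\<^sup>2) \<le> C * (\<integral>x. (cmod (f x))\<^sup>2 \<partial>M)"
    using C by (simp add: field_simps)
  then show "(\<Sum>i\<in>F. ennreal ((cmod (L2_inner M f (e i)))\<^sup>2)) \<le> ennreal (C * (\<integral>x. (cmod (f x))\<^sup>2 \<partial>M))"
    by (simp add: sum_ennreal ennreal_leI)
qed

text \<open>Density supplies some finite combination close to \<open>f\<close>; completing the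
  square shows that the optimal coefficients on the same index set do at least as well.\<close>

lemma L2_orthogonal_basis_Parseval:
  assumes basis: "L2_orthogonal_basis M e I" and I: "countable I"
    and norm: "\<And>i. i \<in> I \<Longrightarrow> L2_inner M (e i) (e i) = of_real C" and C: "C > 0"
    and f: "f \<in> L2_functions M"
  shows "(\<integral>\<^sup>+i. ennreal ((cmod (L2_inner M f (e i)))\<^sup>2) \<partial>count_space I) = ennreal (C * (\<integral>x. (cmod (f x))\<^sup>2 \<partial>M))"
proof (rule antisym)
  have e: "e i \<in> L2_functions M" if "i \<in> I" for i
    using basis that by (simp add: L2_orthogonal_basis_def)
  have orth: "L2_inner M (e i) (e j) = 0" if "i \<in> I" "j \<in> I" "i \<noteq> j" for i j
    using basis that by (simp add: L2_orthogonal_basis_def)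
  show "(\<integral>\<^sup>+i. ennreal ((cmod (L2_inner M f (e i)))\<^sup>2) \<partial>count_space I) \<le> ennreal (C * (\<integral>x. (cmod (f x))\<^sup>2 \<partial>M))"
    by (rule Bessel_inequality[OF f I e norm C orth])
  show "ennreal (C * (\<integral>x. (cmod (f x))\<^sup>2 \<partial>M)) \<le> (\<integral>\<^sup>+i. ennreal ((cmod (L2_inner M f (e i)))\<^sup>2) \<partial>count_space I)"
  proof (rule ennreal_le_epsilon)
    fix d :: real assume d: "0 < d"
    \<comment> \<open>Multiplication of the squared distance by \<open>C\<close> will turn this
      tolerance into \<open>d\<close>.\<close>
    then have "sqrt (d / C) > 0"
      using C by simp
    then obtain F c where F: "finite F" "F \<subseteq> I"
      and lt: "sqrt (\<integral>x. (cmod (f x - (\<Sum>i\<in>F. c i * e i x)))\<^sup>2 \<partial>M) < sqrt (d / C)"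
      using basis f unfolding L2_orthogonal_basis_def by meson
    have "(\<integral>x. (cmod (f x))\<^sup>2 \<partial>M) - (\<Sum>i\<in>F. (cmod (L2_inner M f (e i)))\<^sup>2) / C
        \<le> (\<integral>x. (cmod (f x - (\<Sum>i\<in>F. c i * e i x)))\<^sup>2 \<partial>M)"
      using F e norm orth C
      by (subst L2_dist_orthogonal_sum[OF f F(1)]) (auto simp: subset_eq intro!: divide_nonneg_nonneg sum_nonneg)
    also have "\<dots> < d / C"
      using lt by simp
    finally have "C * ((\<integral>x. (cmod (f x))\<^sup>2 \<partial>M) - (\<Sum>i\<in>F. (cmod (L2_inner M f (e i)))\<^sup>2) / C) < C * (d / C)"
      using C by (rule mult_strict_left_mono)
    then have "C * (\<integral>x. (cmod (f x))\<^sup>2 \<partial>M) \<le> (\<Sum>i\<in>F. (cmod (L2_inner M f (e i)))\<^sup>2) + d"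
      using C by (simp add: right_diff_distrib)
    then have "ennreal (C * (\<integral>x. (cmod (f x))\<^sup>2 \<partial>M)) \<le> ennreal (\<Sum>i\<in>F. (cmod (L2_inner M f (e i)))\<^sup>2) + ennreal d"
      using d by (subst ennreal_plus[symmetric]) (auto intro!: ennreal_leI sum_nonneg)
    also have "ennreal (\<Sum>i\<in>F. (cmod (L2_inner M f (e i)))\<^sup>2) = (\<Sum>i\<in>F. ennreal ((cmod (L2_inner M f (e i)))\<^sup>2))"
      by (simp add: sum_ennreal)
    also have "\<dots> \<le> (\<integral>\<^sup>+i. ennreal ((cmod (L2_inner M f (e i)))\<^sup>2) \<partial>count_space I)"
      by (rule nn_integral_count_space_ge[OF F])
    finally show "ennreal (C * (\<integral>x. (cmod (f x))\<^sup>2 \<partial>M))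
        \<le> (\<integral>\<^sup>+i. ennreal ((cmod (L2_inner M f (e i)))\<^sup>2) \<partial>count_space I) + ennreal d"
      by (simp add: add_right_mono)
  qed
qed

text \<open>Converse of Parseval: if all finite subfamilies missed \<open>f\<close> by at least
  \<open>\<epsilon>\<close>, the coefficient sums would stay below the norm by a fixed gap. Equality
  in Bessel thereby becomes density.\<close>

lemma L2_orthogonal_basisI:
  assumes I: "countable I"
    and e: "\<And>i. i \<in> I \<Longrightarrow> e i \<in> L2_functions M"
    and norm: "\<And>i. i \<in> I \<Longrightarrow> L2_inner M (e i) (e i) = of_real C" and C: "C > 0"
    and orth: "\<And>i j. i \<in> I \<Longrightarrow> j \<in> I \<Longrightarrow> i \<noteq> j \<Longrightarrow> L2_inner M (e i) (e j) = 0"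
    and parseval: "\<And>f. f \<in> L2_functions M \<Longrightarrow> ennreal (C * (\<integral>x. (cmod (f x))\<^sup>2 \<partial>M))
      \<le> (\<integral>\<^sup>+i. ennreal ((cmod (L2_inner M f (e i)))\<^sup>2) \<partial>count_space I)"
  shows "L2_orthogonal_basis M e I"
  unfolding L2_orthogonal_basis_def
proof (intro conjI ballI allI impI)
  fix f \<epsilon> assume f: "f \<in> L2_functions M" and \<epsilon>: "(0::real) < \<epsilon>"
  let ?N = "\<integral>x. (cmod (f x))\<^sup>2 \<partial>M"
  have "\<exists>F. finite F \<and> F \<subseteq> I \<and> ?N - (\<Sum>i\<in>F. (cmod (L2_inner M f (e i)))\<^sup>2) / C < \<epsilon>\<^sup>2"
  proof (rule ccontr)
    assume neg: "\<not> ?thesis"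
    have le: "(\<Sum>i\<in>F. (cmod (L2_inner M f (e i)))\<^sup>2) \<le> C * ?N - C * \<epsilon>\<^sup>2" if "finite F" "F \<subseteq> I" for F
    proof -
      have "(\<Sum>i\<in>F. (cmod (L2_inner M f (e i)))\<^sup>2) / C \<le> ?N - \<epsilon>\<^sup>2"
        using neg that by (auto simp: not_less)
      then show ?thesis
        using C by (simp add: field_simps)
    qed
    have "ennreal (C * ?N) \<le> (\<integral>\<^sup>+i. ennreal ((cmod (L2_inner M f (e i)))\<^sup>2) \<partial>count_space I)"
      by (rule parseval[OF f])
    also have "\<dots> \<le> ennreal (C * ?N - C * \<epsilon>\<^sup>2)"
      using le by (intro nn_integral_count_space_le I) (auto simp: sum_ennreal intro!: ennreal_leI)
    \<comment> \<open>The empty family in \<open>le\<close> shows that the right-hand side is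
      nonnegative; otherwise \<open>ennreal\<close> would truncate it to 0.\<close>
    finally have "C * ?N \<le> C * ?N - C * \<epsilon>\<^sup>2"
      using le[of "{}"] by (subst (asm) ennreal_le_iff) auto
    moreover have "C * \<epsilon>\<^sup>2 > 0"
      using C \<epsilon> by simp
    ultimately show False
      by linarith
  qed
  then obtain F where F: "finite F" "F \<subseteq> I"
    "?N - (\<Sum>i\<in>F. (cmod (L2_inner M f (e i)))\<^sup>2) / C < \<epsilon>\<^sup>2"
    by blast
  have "(\<integral>x. (cmod (f x - (\<Sum>i\<in>F. (L2_inner M f (e i) / C) * e i x)))\<^sup>2 \<partial>M)
      = ?N - (\<Sum>i\<in>F. (cmod (L2_inner M f (e i)))\<^sup>2) / C"
    using F e norm orth C by (subst L2_dist_orthogonal_sum[OF f F(1)]) (auto simp: subset_eq)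
  then have "sqrt (\<integral>x. (cmod (f x - (\<Sum>i\<in>F. (L2_inner M f (e i) / C) * e i x)))\<^sup>2 \<partial>M) < \<epsilon>"
    using F(3) \<epsilon> real_sqrt_less_mono by fastforce
  with F show "\<exists>F c. finite F \<and> F \<subseteq> I \<and>
      sqrt (\<integral>x. (cmod (f x - (\<Sum>i\<in>F. c i * e i x)))\<^sup>2 \<partial>M) < \<epsilon>"
    by (intro exI[of _ F] exI[of _ "\<lambda>i. L2_inner M f (e i) / C"]) auto
qed (use e norm C orth in auto)

text \<open>Density moves along as soon as every \<open>g\<close> has a partner \<open>f\<close> at
  the same distance from all combinations. The partner may depend on \<open>g\<close> arbitrarily,
  so it can be chosen only up to null sets.\<close>

lemma L2_orthogonal_basis_transfer:
  assumes basis: "L2_orthogonal_basis M e I"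
    and d: "\<And>i. i \<in> I \<Longrightarrow> d i \<in> L2_functions N"
    and inner: "\<And>i j. i \<in> I \<Longrightarrow> j \<in> I \<Longrightarrow> L2_inner N (d i) (d j) = L2_inner M (e i) (e j)"
    and dist: "\<And>g. g \<in> L2_functions N \<Longrightarrow> \<exists>f\<in>L2_functions M. \<forall>F c. F \<subseteq> I \<longrightarrow>
      (\<integral>x. (cmod (g x - (\<Sum>i\<in>F. c i * d i x)))\<^sup>2 \<partial>N) = (\<integral>x. (cmod (f x - (\<Sum>i\<in>F. c i * e i x)))\<^sup>2 \<partial>M)"
  shows "L2_orthogonal_basis N d I"
  unfolding L2_orthogonal_basis_def
proof (intro conjI ballI allI impI)
  fix g \<epsilon> assume g: "g \<in> L2_functions N" and \<epsilon>: "(0::real) < \<epsilon>"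
  obtain f where f: "f \<in> L2_functions M" and eq: "\<And>F c. F \<subseteq> I \<Longrightarrow>
      (\<integral>x. (cmod (g x - (\<Sum>i\<in>F. c i * d i x)))\<^sup>2 \<partial>N) = (\<integral>x. (cmod (f x - (\<Sum>i\<in>F. c i * e i x)))\<^sup>2 \<partial>M)"
    using dist[OF g] by blast
  obtain F c where "finite F" "F \<subseteq> I" "sqrt (\<integral>x. (cmod (f x - (\<Sum>i\<in>F. c i * e i x)))\<^sup>2 \<partial>M) < \<epsilon>"
    using basis f \<epsilon> unfolding L2_orthogonal_basis_def by meson
  then show "\<exists>F c. finite F \<and> F \<subseteq> I \<and> sqrt (\<integral>x. (cmod (g x - (\<Sum>i\<in>F. c i * d i x)))\<^sup>2 \<partial>N) < \<epsilon>"
    by (intro exI[of _ F] exI[of _ c]) (simp add: eq)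
qed (use basis d inner in \<open>auto simp: L2_orthogonal_basis_def\<close>)

text \<open>Serves to pass between real frequencies, their classes modulo one, and frequencies
  paired with integer shifts.\<close>

lemma L2_orthogonal_basis_reindex:
  assumes basis: "L2_orthogonal_basis M (e \<circ> \<pi>) I" and inj: "inj_on \<pi> I"
  shows "L2_orthogonal_basis M e (\<pi> ` I)"
  unfolding L2_orthogonal_basis_def
proof (intro conjI ballI allI impI)
  fix f \<epsilon> assume f: "f \<in> L2_functions M" and \<epsilon>: "(0::real) < \<epsilon>"
  obtain F c where F: "finite F" "F \<subseteq> I" "sqrt (\<integral>x. (cmod (f x - (\<Sum>i\<in>F. c i * (e \<circ> \<pi>) i x)))\<^sup>2 \<partial>M) < \<epsilon>"
    using basis f \<epsilon> unfolding L2_orthogonal_basis_def by meson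
  have inj': "inj_on \<pi> F"
    using inj F(2) by (rule inj_on_subset)
  have "(\<Sum>i\<in>\<pi> ` F. c (inv_into F \<pi> i) * e i x) = (\<Sum>i\<in>F. c i * (e \<circ> \<pi>) i x)" for x
    using inj' by (simp add: sum.reindex inv_into_f_f)
  with F show "\<exists>F c. finite F \<and> F \<subseteq> \<pi> ` I \<and> sqrt (\<integral>x. (cmod (f x - (\<Sum>i\<in>F. c i * e i x)))\<^sup>2 \<partial>M) < \<epsilon>"
    by (intro exI[of _ "\<pi> ` F"] exI[of _ "\<lambda>i. c (inv_into F \<pi> i)"]) auto
qed (use basis inj in \<open>auto simp: L2_orthogonal_basis_def inj_on_def\<close>)

section \<open>Fourier series on the unit interval\<close>

definition unit_lborel :: "real measure" where
  "unit_lborel = restrict_space lborel {0<..<1}"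

definition wave :: "real \<Rightarrow> real \<Rightarrow> complex" where
  "wave t s = exp (2 * of_real pi * \<i> * of_real (t * s))"

lemma wave_eq_cis: "wave t s = cis (2 * pi * t * s)"
  by (simp add: wave_def cis_conv_exp algebra_simps)

lemma norm_wave [simp]: "cmod (wave t s) = 1"
  by (simp add: wave_eq_cis)

lemma wave_add_left: "wave (t + t') s = wave t s * wave t' s"
  by (simp add: wave_eq_cis cis_mult algebra_simps)

lemma wave_add_right: "wave t (s + s') = wave t s * wave t s'"
  by (simp add: wave_eq_cis cis_mult algebra_simps)

lemma cnj_wave: "cnj (wave t s) = wave (- t) s"
  by (simp add: wave_eq_cis cis_cnj)

lemma wave_mult_cnj: "wave t s * cnj (wave t' s) = wave (t - t') s"
  by (simp add: cnj_wave wave_add_left[symmetric])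

lemma wave_0 [simp]: "wave 0 s = 1" "wave t 0 = 1"
  by (simp_all add: wave_def)

lemma wave_0_eq [simp]: "wave 0 = (\<lambda>_. 1)"
  by (simp add: fun_eq_iff)

lemma wave_int_int: "wave (of_int k) (of_int j) = 1"
  unfolding wave_eq_cis by (metis cis_multiple_2pi Ints_of_int of_int_mult mult.assoc)

lemma continuous_on_wave [continuous_intros]:
  "continuous_on A f \<Longrightarrow> continuous_on A g \<Longrightarrow> continuous_on A (\<lambda>x. wave (f x) (g x))"
  unfolding wave_def by (intro continuous_intros)

lemma borel_measurable_wave [measurable (raw)]:
  "f \<in> borel_measurable M \<Longrightarrow> g \<in> borel_measurable M \<Longrightarrow> (\<lambda>x. wave (f x) (g x)) \<in> borel_measurable M"
  unfolding wave_def by measurable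

lemma space_unit_lborel [simp]: "space unit_lborel = {0<..<1}"
  by (simp add: unit_lborel_def space_restrict_space)

lemma emeasure_unit_lborel: "emeasure unit_lborel {0<..<1} = 1"
  by (simp add: unit_lborel_def emeasure_restrict_space)

lemma measurable_unit_lborel [measurable (raw)]:
  "f \<in> borel_measurable borel \<Longrightarrow> f \<in> borel_measurable unit_lborel"
  unfolding unit_lborel_def by (intro measurable_restrict_space1) simp

interpretation unit_lborel: finite_measure unit_lborel
  by standard (simp add: emeasure_unit_lborel)

lemma measure_unit_lborel [simp]: "measure unit_lborel {0<..<1} = 1"
  by (simp add: measure_def emeasure_unit_lborel)

lemma wave_L2: "wave t \<in> L2_functions unit_lborel"
  by (rule L2_functions_bounded[of _ _ 1]) (simp_all add: unit_lborel.finite_measure_axioms)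

text \<open>The endpoints are null; the right-hand side is the gauge integral, to which the
  fundamental theorem of calculus applies.\<close>

lemma integral_unit_lborel_eq:
  fixes f :: "real \<Rightarrow> complex"
  assumes "continuous_on {0..1} f"
  shows "(\<integral>s. f s \<partial>unit_lborel) = integral {0..1} f"
proof -
  have int: "set_integrable lborel {0..1} f"
    using assms by (intro borel_integrable_atLeastAtMost') auto
  have "(\<integral>s. f s \<partial>unit_lborel) = set_lebesgue_integral lborel {0<..<1} f"
    unfolding unit_lborel_def set_lebesgue_integral_def by (simp add: integral_restrict_space)
  also have "\<dots> = set_lebesgue_integral lborel {0..1} f"
  proof (rule set_integral_cong_set)
    have int': "set_integrable lborel {0<..<1} f"
      by (rule set_integrable_subset[OF int]) auto
    show "set_borel_measurable lborel {0<..<1} f"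
      unfolding set_borel_measurable_def
      by (rule borel_measurable_integrable[OF int'[unfolded set_integrable_def]])
    show "set_borel_measurable lborel {0..1} f"
      unfolding set_borel_measurable_def
      by (rule borel_measurable_integrable[OF int[unfolded set_integrable_def]])
    have "AE x in lborel. x \<notin> {0, 1::real}"
      by (intro AE_not_in countable_imp_null_set_lborel) auto
    then show "AE x in lborel. (x \<in> {0..1::real}) = (x \<in> {0<..<1})"
      by eventually_elim auto
  qed
  also have "\<dots> = integral {0..1} f"
    using int by (rule set_borel_integral_eq_integral(2))
  finally show ?thesis .
qed

lemma integral_wave:
  assumes "t \<noteq> 0"
  shows "(\<integral>s. wave t s \<partial>unit_lborel) = (wave t 1 - 1) / (2 * of_real pi * \<i> * of_real t)"
proof -
  let ?c = "2 * of_real pi * \<i> * complex_of_real t"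
  have "((\<lambda>s. wave t s / ?c) has_vector_derivative wave t s) (at s within {0..1})" for s
  proof -
    have "((\<lambda>z. exp (?c * z) / ?c) has_field_derivative exp (?c * of_real s)) (at (of_real s))"
      using assms by (auto intro!: derivative_eq_intros)
    from has_vector_derivative_real_field[OF this, of "{0..1}"] show ?thesis
      by (simp add: wave_def mult.assoc)
  qed
  then have "(wave t has_integral wave t 1 / ?c - wave t 0 / ?c) {0..1}"
    by (intro fundamental_theorem_of_calculus) auto
  then show ?thesis
    by (subst integral_unit_lborel_eq)
      (auto intro!: continuous_intros simp: integral_unique diff_divide_distrib)
qed

text \<open>Used in both directions: zeros at the nonzero integers make integer shifts orthogonal,
  and the absence of other zeros lets orthogonality over the slabs descend to the layers.\<close>

lemma integral_wave_eq_0_iff: "(\<integral>s. wave t s \<partial>unit_lborel) = 0 \<longleftrightarrow> t \<in> \<int> - {0}"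
proof (cases "t = 0")
  case False
  have "wave t 1 = 1 \<longleftrightarrow> t \<in> \<int>"
  proof
    assume "wave t 1 = 1"
    then obtain n :: int where "2 * pi * t = of_int n * (2 * pi)"
      unfolding wave_def by (auto simp: exp_eq_1 mult_ac)
    then have "t = of_int n"
      by simp
    then show "t \<in> \<int>"
      by simp
  next
    assume "t \<in> \<int>"
    then show "wave t 1 = 1"
      using wave_int_int[of _ 1] by (auto elim!: Ints_cases)
  qed
  then show ?thesis
    using False by (simp add: integral_wave)
qed simp

lemma L2_inner_wave: "L2_inner unit_lborel (wave t) (wave t') = (\<integral>s. wave (t - t') s \<partial>unit_lborel)"
  by (simp add: L2_inner_def wave_mult_cnj)

section \<open>Uniform density of trigonometric polynomials\<close>

definition trig_poly :: "(real \<Rightarrow> complex) \<Rightarrow> bool" where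
  "trig_poly h \<longleftrightarrow> (\<exists>F c. finite F \<and> h = (\<lambda>s. \<Sum>k\<in>F. c k * wave (of_int k) s))"

lemma trig_poly_monom: "trig_poly (\<lambda>s. c * wave (of_int k) s)"
  unfolding trig_poly_def by (intro exI[of _ "{k}"] exI[of _ "\<lambda>_. c"]) simp

lemma trig_poly_const: "trig_poly (\<lambda>s. c)"
  using trig_poly_monom[of c 0] by simp

lemma trig_poly_add:
  assumes "trig_poly f" "trig_poly g"
  shows "trig_poly (\<lambda>s. f s + g s)"
proof -
  obtain F c G d where F: "finite F" "f = (\<lambda>s. \<Sum>k\<in>F. c k * wave (of_int k) s)"
    and G: "finite G" "g = (\<lambda>s. \<Sum>k\<in>G. d k * wave (of_int k) s)"
    using assms unfolding trig_poly_def by blast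
  let ?b = "\<lambda>k. (if k \<in> F then c k else 0) + (if k \<in> G then d k else 0)"
  have "(\<Sum>k\<in>F \<union> G. ?b k * wave (of_int k) s) = f s + g s" for s
  proof -
    have "(\<Sum>k\<in>F \<union> G. ?b k * wave (of_int k) s)
        = (\<Sum>k\<in>F \<union> G. if k \<in> F then c k * wave (of_int k) s else 0)
          + (\<Sum>k\<in>F \<union> G. if k \<in> G then d k * wave (of_int k) s else 0)"
      unfolding sum.distrib[symmetric] by (intro sum.cong) (auto simp: distrib_right)
    also have "\<dots> = f s + g s"
      using F G by (simp add: sum.If_cases Int_absorb1)
    finally show ?thesis .
  qed
  then show ?thesis
    using F(1) G(1) unfolding trig_poly_def by (intro exI[of _ "F \<union> G"] exI[of _ ?b]) auto
qed

lemma trig_poly_sum: "(\<And>i. i \<in> F \<Longrightarrow> trig_poly (f i)) \<Longrightarrow> trig_poly (\<lambda>s. \<Sum>i\<in>F. f i s)"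
  by (induction F rule: infinite_finite_induct) (auto intro: trig_poly_add trig_poly_const)

lemma trig_poly_mult:
  assumes "trig_poly f" "trig_poly g"
  shows "trig_poly (\<lambda>s. f s * g s)"
proof -
  obtain F c G d where F: "finite F" "f = (\<lambda>s. \<Sum>k\<in>F. c k * wave (of_int k) s)"
    and G: "finite G" "g = (\<lambda>s. \<Sum>k\<in>G. d k * wave (of_int k) s)"
    using assms unfolding trig_poly_def by blast
  have "(\<lambda>s. f s * g s) = (\<lambda>s. \<Sum>k\<in>F. \<Sum>l\<in>G. (c k * d l) * wave (of_int (k + l)) s)"
    unfolding F G by (simp add: sum_product wave_add_left mult_ac)
  moreover have "trig_poly (\<lambda>s. \<Sum>k\<in>F. \<Sum>l\<in>G. (c k * d l) * wave (of_int (k + l)) s)"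
    by (intro trig_poly_sum trig_poly_monom)
  ultimately show ?thesis
    by (simp only:)
qed

text \<open>Induction over polynomials in the real coordinates of a point of the circle. Only the
  linear case has content: the coordinates are combinations of \<open>wave 1\<close> and
  \<open>wave (- 1)\<close>.\<close>

lemma trig_poly_real_polynomial_function:
  assumes "real_polynomial_function r"
  shows "trig_poly (\<lambda>s. of_real (r (wave 1 s)))"
  using assms
proof induction
  case (linear f)
  note lin = bounded_linear.linear[OF linear]
  have "complex_of_real (f (wave 1 s))
      = ((of_real (f 1) - \<i> * of_real (f \<i>)) / 2) * wave (of_int 1) s
      + ((of_real (f 1) + \<i> * of_real (f \<i>)) / 2) * wave (of_int (- 1)) s" for s
  proof -
    have "wave 1 s = Re (wave 1 s) *\<^sub>R 1 + Im (wave 1 s) *\<^sub>R \<i>"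
      by (simp add: complex_eq_iff)
    then have "f (wave 1 s) = f (Re (wave 1 s) *\<^sub>R 1 + Im (wave 1 s) *\<^sub>R \<i>)"
      by (rule arg_cong)
    also have "\<dots> = Re (wave 1 s) * f 1 + Im (wave 1 s) * f \<i>"
      by (simp only: linear_add[OF lin] linear_scale[OF lin] real_scaleR_def)
    finally have "f (wave 1 s) = Re (wave 1 s) * f 1 + Im (wave 1 s) * f \<i>" .
    moreover have "wave (- 1) s = cnj (wave 1 s)"
      by (simp add: cnj_wave)
    ultimately show ?thesis
      by (simp add: complex_eq_iff field_simps)
  qed
  then show ?case
    using trig_poly_add[OF trig_poly_monom trig_poly_monom] by presburger
qed (auto intro: trig_poly_const trig_poly_add trig_poly_mult)

text \<open>A closed path factors through the circle, where Stone-Weierstrass gives a polynomial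
  approximation; composing with \<open>wave 1\<close> leads back to the interval.\<close>

lemma trig_poly_uniform_dense:
  assumes p: "continuous_on {0..1} p" "p 0 = p 1" and \<epsilon>: "\<epsilon> > 0"
  shows "\<exists>h. trig_poly h \<and> (\<forall>s\<in>{0..1}. cmod (p s - h s) < \<epsilon>)"
proof -
  have "path p"
    using p by (simp add: path_def)
  \<comment> \<open>The factor through \<open>Arg2pi\<close> must be continuous across the branch
    cut. The trivial homotopy of the loop \<open>p\<close> to itself provides this by way of circle
    maps.\<close>
  then have "homotopic_loops UNIV p p"
    using p by (simp add: homotopic_loops_refl pathstart_def pathfinish_def)
  from homotopic_loops_imp_homotopic_circlemaps[OF this]
  have cont: "continuous_on (sphere 0 1) (p \<circ> (\<lambda>z. Arg2pi z / (2 * pi)))"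
    using homotopic_with_imp_continuous by blast
  then obtain q where q: "polynomial_function q"
    "\<And>z. z \<in> sphere 0 1 \<Longrightarrow> cmod ((p \<circ> (\<lambda>z. Arg2pi z / (2 * pi))) z - q z) < \<epsilon>"
    using Stone_Weierstrass_polynomial_function[OF compact_sphere cont \<epsilon>] by blast
  define h where "h s = q (wave 1 s)" for s
  have "trig_poly (\<lambda>s. of_real (Re (h s)) + \<i> * of_real (Im (h s)))"
    unfolding h_def
    by (intro trig_poly_add trig_poly_mult trig_poly_const)
      (use q(1) trig_poly_real_polynomial_function[of "Re \<circ> q"] trig_poly_real_polynomial_function[of "Im \<circ> q"]
        in \<open>auto simp: polynomial_function_def bounded_linear_Re bounded_linear_Im o_def\<close>)
  then have "trig_poly h"
    by (simp flip: complex_eq)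
  moreover have "cmod (p s - h s) < \<epsilon>" if s: "s \<in> {0..1}" for s
  proof -
    have "p (Arg2pi (wave 1 s) / (2 * pi)) = p s"
    \<comment> \<open>The angle of \<open>wave 1 1\<close> is 0 and not \<open>2 * pi\<close>, so at
      the right endpoint closedness of \<open>p\<close> supplies the value.\<close>
    proof (cases "s = 1")
      case True
      have "Arg2pi 1 = 0"
        by (rule Arg2pi_unique[of 1]) auto
      then show ?thesis
        using True wave_int_int[of 1 1] p(2) by simp
    next
      case False
      have "Arg2pi (wave 1 s) = 2 * pi * s"
        using s False by (intro Arg2pi_unique[of 1]) (auto simp: wave_def mult_ac)
      then show ?thesis
        by simp
    qed
    then show ?thesis
      using q(2)[of "wave 1 s"] by (simp add: h_def)
  qed
  ultimately show ?thesis
    by blast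
qed

lemma complex_square_triangle:
  "(cmod (a + b + c))\<^sup>2 \<le> 3 * ((cmod a)\<^sup>2 + (cmod b)\<^sup>2 + (cmod c)\<^sup>2)"
proof -
  have "cmod (a + b + c) \<le> cmod a + cmod b + cmod c"
    using norm_triangle_ineq[of "a + b" c] norm_triangle_ineq[of a b] by linarith
  then have "(cmod (a + b + c))\<^sup>2 \<le> (cmod a + cmod b + cmod c)\<^sup>2"
    by (intro power_mono) auto
  also have "\<dots> \<le> 3 * ((cmod a)\<^sup>2 + (cmod b)\<^sup>2 + (cmod c)\<^sup>2)"
    using sum_squares_bound[of "cmod a" "cmod b"] sum_squares_bound[of "cmod a" "cmod c"]
      sum_squares_bound[of "cmod b" "cmod c"]
    by (simp add: power2_eq_square algebra_simps)
  finally show ?thesis .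
qed

text \<open>At each point the truncation eventually equals \<open>f\<close>, and the error is
  dominated by the square of \<open>f\<close>.\<close>

lemma L2_truncation:
  assumes f: "f \<in> L2_functions M" and \<epsilon>: "\<epsilon> > 0"
  shows "\<exists>n::nat. (\<integral>x. (cmod (f x - (if cmod (f x) \<le> n then f x else 0)))\<^sup>2 \<partial>M) < \<epsilon>"
proof -
  let ?h = "\<lambda>n x. (cmod (f x - (if cmod (f x) \<le> real n then f x else 0)))\<^sup>2"
  note [measurable] = f
  have "(\<lambda>n. \<integral>x. ?h n x \<partial>M) \<longlonglongrightarrow> (\<integral>x. 0 \<partial>M)"
  proof (rule integral_dominated_convergence[where w = "\<lambda>x. (cmod (f x))\<^sup>2"])
    show "AE x in M. (\<lambda>n. ?h n x) \<longlonglongrightarrow> 0"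
    proof (rule AE_I2)
      fix x
      obtain N where "cmod (f x) \<le> real N"
        using real_arch_simple by blast
      then have "?h n x = 0" if "N \<le> n" for n
        using that by simp
      then have "\<forall>\<^sub>F n in sequentially. ?h n x = 0"
        unfolding eventually_sequentially by blast
      then show "(\<lambda>n. ?h n x) \<longlonglongrightarrow> 0"
        by (rule tendsto_eventually)
    qed
    show "AE x in M. norm (?h n x) \<le> (cmod (f x))\<^sup>2" for n
      by simp
  qed (use f in \<open>auto simp: L2_functions_iff\<close>)
  then have "\<forall>\<^sub>F n in sequentially. (\<integral>x. ?h n x \<partial>M) < \<epsilon>"
    using \<epsilon> by (simp add: order_tendstoD(2))
  then show ?thesis
    by (auto simp: eventually_sequentially)
qed

text \<open>The factor is the radial retraction onto the disc of radius \<open>B\<close>. It bounds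
  the sequence while fixing a limit inside the disc.\<close>

lemma clip_tendsto:
  fixes g :: "nat \<Rightarrow> complex"
  assumes "g \<longlonglongrightarrow> z" "cmod z \<le> B" "B > 0"
  shows "(\<lambda>n. g n * of_real (B / max B (cmod (g n)))) \<longlonglongrightarrow> z"
proof -
  have "(\<lambda>n. g n * of_real (B / max B (cmod (g n)))) \<longlonglongrightarrow> z * of_real (B / max B (cmod z))"
    using assms by (intro tendsto_intros) (auto simp: max_def)
  then show ?thesis
    using assms by (simp add: max_absorb1)
qed

text \<open>Almost-everywhere limits of continuous functions become limits in the mean once they are
  bounded, by dominated convergence. Clipping gives the bound, and a cutoff gives equal values at
  the endpoints.\<close>

lemma unit_L2_continuous_approx:
  assumes f: "f \<in> borel_measurable unit_lborel" and bound: "\<And>s. s \<in> {0<..<1} \<Longrightarrow> cmod (f s) \<le> B"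
    and B: "B > 0" and \<epsilon>: "\<epsilon> > 0"
  shows "\<exists>p. continuous_on {0..1} p \<and> p 0 = p 1 \<and> (\<integral>s. (cmod (f s - p s))\<^sup>2 \<partial>unit_lborel) < \<epsilon>"
proof -
  let ?f = "\<lambda>s. if s \<in> {0<..<1} then f s else 0"
  have "?f \<in> borel_measurable borel"
    using f unfolding unit_lborel_def
    by (subst (asm) measurable_restrict_space_iff[where c = 0]) (auto simp: if_distrib)
  then have "?f \<in> borel_measurable lebesgue"
    by (intro measurable_completion) simp
  then have "?f measurable_on UNIV"
    by (rule lebesgue_measurable_imp_measurable_on) simp
  then obtain N g where N: "negligible N" and g: "\<And>n. continuous_on UNIV (g n)"
    and lim: "\<And>s. s \<notin> N \<Longrightarrow> (\<lambda>n. g n s) \<longlonglongrightarrow> ?f s"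
    unfolding measurable_on_def by auto
  define clip where "clip n s = g n s * of_real (B / max B (cmod (g n s)))" for n s
  \<comment> \<open>Zero at both endpoints and eventually 1 at each interior point. It is negative
    outside the unit interval, hence the maximum with 0 in \<open>p\<close>.\<close>
  define cut where "cut n s = min 1 (real n * (s * (1 - s)))" for n s
  define p where "p n s = clip n s * of_real (max 0 (cut n s))" for n s
  have cont: "continuous_on UNIV (p n)" for n
    unfolding p_def clip_def cut_def using B
    by (intro continuous_intros g) auto
  then have [measurable]: "p n \<in> borel_measurable borel" for n
    by (rule borel_measurable_continuous_onI)
  have zero: "p n 0 = 0" "p n 1 = 0" for n
    by (simp_all add: p_def cut_def)
  have cut: "(\<lambda>n. cut n s) \<longlonglongrightarrow> 1" if "s \<in> {0<..<1}" for s
  proof (rule tendsto_eventually)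
    have pos: "s * (1 - s) > 0"
      using that by simp
    obtain m where m: "1 / (s * (1 - s)) \<le> real m"
      using real_arch_simple by blast
    have "cut n s = 1" if "m \<le> n" for n
    proof -
      have "1 / (s * (1 - s)) \<le> real n"
        using m that by linarith
      then have "1 \<le> real n * (s * (1 - s))"
        using pos by (simp add: pos_divide_le_eq)
      then show ?thesis
        by (simp add: cut_def)
    qed
    then show "\<forall>\<^sub>F n in sequentially. cut n s = 1"
      by (auto simp: eventually_sequentially)
  qed
  have p_bound: "cmod (p n s) \<le> B" for n s
  proof -
    have "cmod (clip n s) \<le> B"
      using B by (simp add: clip_def norm_mult norm_divide max_def field_simps)
    moreover have "\<bar>max 0 (cut n s)\<bar> \<le> 1"
      by (simp add: cut_def)
    ultimately have "cmod (clip n s) * \<bar>max 0 (cut n s)\<bar> \<le> B * 1"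
      using B by (intro mult_mono) auto
    then show ?thesis
      by (simp add: p_def norm_mult)
  qed
  have p_lim: "(\<lambda>n. p n s) \<longlonglongrightarrow> f s" if s: "s \<in> {0<..<1}" "s \<notin> N" for s
  proof -
    have "(\<lambda>n. clip n s) \<longlonglongrightarrow> f s"
      unfolding clip_def using lim[OF s(2)] s(1) by (intro clip_tendsto bound B) auto
    moreover have "(\<lambda>n. complex_of_real (max 0 (cut n s))) \<longlonglongrightarrow> of_real (max 0 1)"
      by (intro tendsto_intros cut s)
    ultimately show ?thesis
      unfolding p_def using tendsto_mult by fastforce
  qed
  have "AE s in lborel. s \<notin> N"
    using AE_not_in[of N lebesgue] N by (simp add: negligible_iff_null_sets AE_completion_iff)
  then have aeN: "AE s in unit_lborel. s \<notin> N"
    unfolding unit_lborel_def by (subst AE_restrict_space_iff) auto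
  have "(\<lambda>n. \<integral>s. (cmod (f s - p n s))\<^sup>2 \<partial>unit_lborel) \<longlonglongrightarrow> (\<integral>s. 0 \<partial>unit_lborel)"
  proof (rule integral_dominated_convergence[where w = "\<lambda>_. (2 * B)\<^sup>2"])
    show "AE s in unit_lborel. (\<lambda>n. (cmod (f s - p n s))\<^sup>2) \<longlonglongrightarrow> 0"
      using aeN AE_space
    proof eventually_elim
      case (elim s)
      have "(\<lambda>n. (cmod (f s - p n s))\<^sup>2) \<longlonglongrightarrow> (cmod (f s - f s))\<^sup>2"
        using elim by (intro tendsto_intros p_lim) auto
      then show ?case
        by simp
    qed
    show "AE s in unit_lborel. norm ((cmod (f s - p n s))\<^sup>2) \<le> (2 * B)\<^sup>2" for n
      using AE_space
    proof eventually_elim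
      case (elim s)
      have "cmod (f s - p n s) \<le> 2 * B"
        using norm_triangle_ineq4[of "f s" "p n s"] bound[of s] p_bound[of n s] elim by simp
      from power_mono[OF this norm_ge_zero, of 2] show ?case
        by simp
    qed
  qed (use f in auto)
  then have "\<forall>\<^sub>F n in sequentially. (\<integral>s. (cmod (f s - p n s))\<^sup>2 \<partial>unit_lborel) < \<epsilon>"
    using \<epsilon> by (simp add: order_tendstoD(2))
  then obtain n where "(\<integral>s. (cmod (f s - p n s))\<^sup>2 \<partial>unit_lborel) < \<epsilon>"
    by (auto simp: eventually_sequentially)
  then show ?thesis
    using cont zero by (intro exI[of _ "p n"]) (auto intro: continuous_on_subset)
qed

lemma trig_poly_L2_dense:
  assumes f: "f \<in> L2_functions unit_lborel" and \<epsilon>: "\<epsilon> > 0"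
  shows "\<exists>h. trig_poly h \<and> (\<integral>s. (cmod (f s - h s))\<^sup>2 \<partial>unit_lborel) < \<epsilon>"
proof -
  \<comment> \<open>The error is split into truncation, continuous and uniform approximation, at the
    price of a factor 3: \<open>3 * (\<epsilon> / 9 + \<epsilon> / 9 + \<epsilon> / 18)\<close> is
    below \<open>\<epsilon>\<close>.\<close>
  let ?d = "\<epsilon> / 9"
  have d: "?d > 0"
    using \<epsilon> by simp
  obtain n :: nat where n: "(\<integral>s. (cmod (f s - (if cmod (f s) \<le> n then f s else 0)))\<^sup>2 \<partial>unit_lborel) < ?d"
    using L2_truncation[OF f d] by blast
  define g where "g s = (if cmod (f s) \<le> n then f s else 0)" for s
  note [measurable] = f
  have g: "g \<in> borel_measurable unit_lborel"
    unfolding g_def[abs_def] by measurable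
  \<comment> \<open>One is added to keep the bound positive even when \<open>n = 0\<close>.\<close>
  have gB: "cmod (g s) \<le> real n + 1" for s
    by (simp add: g_def)
  obtain p where p: "continuous_on {0..1} p" "p 0 = p 1"
    "(\<integral>s. (cmod (g s - p s))\<^sup>2 \<partial>unit_lborel) < ?d"
    using unit_L2_continuous_approx[OF g gB _ d] by auto
  have "sqrt (\<epsilon> / 18) > 0"
    using \<epsilon> by simp
  then obtain h where h: "trig_poly h" "\<And>s. s \<in> {0..1} \<Longrightarrow> cmod (p s - h s) < sqrt (\<epsilon> / 18)"
    using trig_poly_uniform_dense[OF p(1,2)] by blast
  have h_meas: "h \<in> borel_measurable unit_lborel"
    using h(1) unfolding trig_poly_def by auto
  have "(\<lambda>s. indicator {0..1} s *\<^sub>R p s) \<in> borel_measurable borel"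
    using p(1) by (intro borel_measurable_continuous_on_indicator) auto
  then have "(\<lambda>s. indicator {0..1} s *\<^sub>R p s) \<in> borel_measurable unit_lborel"
    by (rule measurable_unit_lborel)
  then have p_meas: "p \<in> borel_measurable unit_lborel"
    by (subst measurable_cong[of _ _ "\<lambda>s. indicator {0..1} s *\<^sub>R p s"]) auto
  have "bounded (p ` {0..1})"
    using p(1) by (intro compact_imp_bounded compact_continuous_image) auto
  then obtain B where "\<forall>z\<in>p ` {0..1}. cmod z \<le> B"
    by (auto simp: bounded_iff)
  then have B: "cmod (p s) \<le> B" if "s \<in> {0..1}" for s
    using that by blast
  note fin = unit_lborel.finite_measure_axioms
  have pL2: "p \<in> L2_functions unit_lborel"
    by (rule L2_functions_bounded[OF fin p_meas, of B]) (simp add: B)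
  have gL2: "g \<in> L2_functions unit_lborel"
    by (rule L2_functions_bounded[OF fin g gB])
  have phL2: "(\<lambda>s. p s - h s) \<in> L2_functions unit_lborel"
    using p_meas h_meas h(2) by (intro L2_functions_bounded[OF fin, of _ "sqrt (\<epsilon> / 18)"]) (auto intro: less_imp_le)
  have hL2: "h \<in> L2_functions unit_lborel"
    using L2_functions_diff[OF pL2 phL2] by simp
  have sq: "(cmod (p s - h s))\<^sup>2 \<le> \<epsilon> / 18" if "s \<in> {0<..<1}" for s
    using power_mono[OF less_imp_le[OF h(2)[of s]] norm_ge_zero, of 2] that \<epsilon> by simp
  have "(\<integral>s. (cmod (p s - h s))\<^sup>2 \<partial>unit_lborel) \<le> (\<integral>s. \<epsilon> / 18 \<partial>unit_lborel)"
  proof (rule integral_mono)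
    show "(cmod (p s - h s))\<^sup>2 \<le> \<epsilon> / 18" if "s \<in> space unit_lborel" for s
      using that by (intro sq) simp
  qed (use L2_functions_integrable[OF phL2] in simp_all)
  then have 3: "(\<integral>s. (cmod (p s - h s))\<^sup>2 \<partial>unit_lborel) \<le> \<epsilon> / 18"
    by simp
  let ?I = "\<lambda>u. \<integral>s. (cmod (u s))\<^sup>2 \<partial>unit_lborel"
  note int = L2_functions_integrable[OF L2_functions_diff[OF f gL2]]
    L2_functions_integrable[OF L2_functions_diff[OF gL2 pL2]] L2_functions_integrable[OF phL2]
  have "?I (\<lambda>s. f s - h s) \<le> (\<integral>s. 3 * ((cmod (f s - g s))\<^sup>2 + (cmod (g s - p s))\<^sup>2 + (cmod (p s - h s))\<^sup>2) \<partial>unit_lborel)"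
  proof (rule integral_mono)
    show "integrable unit_lborel (\<lambda>s. (cmod (f s - h s))\<^sup>2)"
      by (rule L2_functions_integrable[OF L2_functions_diff[OF f hL2]])
    show "integrable unit_lborel
        (\<lambda>s. 3 * ((cmod (f s - g s))\<^sup>2 + (cmod (g s - p s))\<^sup>2 + (cmod (p s - h s))\<^sup>2))"
      using int by simp
    show "(cmod (f s - h s))\<^sup>2 \<le> 3 * ((cmod (f s - g s))\<^sup>2 + (cmod (g s - p s))\<^sup>2 + (cmod (p s - h s))\<^sup>2)" for s
      using complex_square_triangle[of "f s - g s" "g s - p s" "p s - h s"] by simp
  qed
  also have "\<dots> = 3 * (?I (\<lambda>s. f s - g s) + ?I (\<lambda>s. g s - p s) + ?I (\<lambda>s. p s - h s))"
    using int by simp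
  also have "\<dots> < \<epsilon>"
    using n p(3) 3 \<epsilon> unfolding g_def[symmetric] by simp
  finally show ?thesis
    using h(1) by blast
qed

lemma L2_inner_wave_int:
  "L2_inner unit_lborel (wave (t + of_int k)) (wave (t + of_int l)) = (if k = l then 1 else 0)"
proof -
  have "t + real_of_int k - (t + real_of_int l) = of_int (k - l)"
    by simp
  moreover have "k \<noteq> l \<Longrightarrow> (\<integral>s. wave (of_int (k - l)) s \<partial>unit_lborel) = 0"
    by (subst integral_wave_eq_0_iff) auto
  ultimately show ?thesis
    by (simp add: L2_inner_wave)
qed

lemma Fourier_basis: "L2_orthogonal_basis unit_lborel (\<lambda>k::int. wave (of_int k)) UNIV"
  unfolding L2_orthogonal_basis_def
proof (intro conjI ballI allI impI)
  show "wave (of_int k) \<in> L2_functions unit_lborel" for k :: int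
    by (rule wave_L2)
  show "L2_inner unit_lborel (wave (of_int k)) (wave (of_int k)) \<noteq> 0" for k :: int
    using L2_inner_wave_int[of 0 k k] by simp
  show "L2_inner unit_lborel (wave (of_int k)) (wave (of_int l)) = 0" if "k \<noteq> l" for k l :: int
    using L2_inner_wave_int[of 0 k l] that by simp
  fix f \<epsilon> assume f: "f \<in> L2_functions unit_lborel" and \<epsilon>: "(0::real) < \<epsilon>"
  have "\<epsilon>\<^sup>2 > 0"
    using \<epsilon> by simp
  then obtain h where h: "trig_poly h" "(\<integral>s. (cmod (f s - h s))\<^sup>2 \<partial>unit_lborel) < \<epsilon>\<^sup>2"
    using trig_poly_L2_dense[OF f] by blast
  obtain F c where F: "finite F" "h = (\<lambda>s. \<Sum>k\<in>F. c k * wave (of_int k) s)"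
    using h(1) unfolding trig_poly_def by blast
  have "sqrt (\<integral>s. (cmod (f s - h s))\<^sup>2 \<partial>unit_lborel) < \<epsilon>"
    using real_sqrt_less_mono[OF h(2)] \<epsilon> by simp
  then show "\<exists>F c. finite F \<and> F \<subseteq> UNIV \<and>
      sqrt (\<integral>s. (cmod (f s - (\<Sum>k\<in>F. c k * wave (of_int k) s)))\<^sup>2 \<partial>unit_lborel) < \<epsilon>"
    using F by (intro exI[of _ F] exI[of _ c]) simp
qed

text \<open>Multiplication by \<open>wave (- t)\<close> preserves the modulus and moves the
  frequencies \<open>t + k\<close> to the integers.\<close>

lemma Fourier_Parseval:
  assumes f: "f \<in> L2_functions unit_lborel"
  shows "(\<integral>\<^sup>+k. ennreal ((cmod (L2_inner unit_lborel f (wave (t + of_int k))))\<^sup>2) \<partial>count_space UNIV)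
    = ennreal (\<integral>s. (cmod (f s))\<^sup>2 \<partial>unit_lborel)"
proof -
  let ?g = "\<lambda>s. f s * wave (- t) s"
  have g: "?g \<in> L2_functions unit_lborel"
    by (rule L2_functions_bounded_mult[OF f]) simp_all
  have eq: "L2_inner unit_lborel f (wave (t + of_int k)) = L2_inner unit_lborel ?g (wave (of_int k))" for k
    unfolding L2_inner_def by (simp add: wave_add_left cnj_wave mult_ac)
  show ?thesis
    using L2_orthogonal_basis_Parseval[OF Fourier_basis _ _ _ g, of 1] L2_inner_wave_int[of 0]
    by (simp add: eq norm_mult)
qed

section \<open>Bases of product form\<close>

lemma (in pair_sigma_finite) product_mult_integral:
  fixes f :: "'a \<Rightarrow> 'c::{real_normed_field, banach, second_countable_topology}"
  assumes f: "integrable M1 f" and g: "integrable M2 g"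
  shows "integrable (M1 \<Otimes>\<^sub>M M2) (\<lambda>x. f (fst x) * g (snd x))"
    and "(\<integral>x. f (fst x) * g (snd x) \<partial>(M1 \<Otimes>\<^sub>M M2)) = (\<integral>x. f x \<partial>M1) * (\<integral>x. g x \<partial>M2)"
proof -
  have [measurable]: "f \<in> borel_measurable M1" "g \<in> borel_measurable M2"
    using f g by auto
  show int: "integrable (M1 \<Otimes>\<^sub>M M2) (\<lambda>x. f (fst x) * g (snd x))"
  proof (rule Fubini_integrable)
    show "(\<lambda>x. f (fst x) * g (snd x)) \<in> borel_measurable (M1 \<Otimes>\<^sub>M M2)"
      by measurable
    show "integrable M1 (\<lambda>x. \<integral>y. norm (f (fst (x, y)) * g (snd (x, y))) \<partial>M2)"
      using f by (simp add: norm_mult)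
    show "AE x in M1. integrable M2 (\<lambda>y. f (fst (x, y)) * g (snd (x, y)))"
      using g by simp
  qed
  show "(\<integral>x. f (fst x) * g (snd x) \<partial>(M1 \<Otimes>\<^sub>M M2)) = (\<integral>x. f x \<partial>M1) * (\<integral>x. g x \<partial>M2)"
    using integral_fst'[OF int] by simp
qed

text \<open>Apart from the null set of integers, the line is the disjoint union of the open unit
  intervals.\<close>

lemma nn_integral_real_fold:
  assumes [measurable]: "\<phi> \<in> borel_measurable borel"
  shows "(\<integral>\<^sup>+y. \<phi> y \<partial>lborel) = (\<integral>\<^sup>+j. \<integral>\<^sup>+s. \<phi> (of_int j + s) \<partial>unit_lborel \<partial>count_space UNIV)"
proof -
  have "(\<integral>\<^sup>+s. \<phi> (of_int j + s) \<partial>unit_lborel)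
      = (\<integral>\<^sup>+y. \<phi> y * indicator {of_int j<..<of_int j + 1} y \<partial>lborel)" for j :: int
  proof -
    have "(\<integral>\<^sup>+s. \<phi> (of_int j + s) \<partial>unit_lborel) = (\<integral>\<^sup>+s. \<phi> (of_int j + s) * indicator {0<..<1} s \<partial>lborel)"
      unfolding unit_lborel_def by (rule nn_integral_restrict_space) simp
    also have "\<dots> = (\<integral>\<^sup>+s. \<phi> (of_int j + 1 * s) * indicator {of_int j<..<of_int j + 1} (of_int j + 1 * s) \<partial>lborel)"
      by (intro nn_integral_cong) (auto simp: indicator_def)
    also have "\<dots> = (\<integral>\<^sup>+y. \<phi> y * indicator {of_int j<..<of_int j + 1} y \<partial>lborel)"
      by (subst nn_integral_real_affine[where c = 1 and t = "of_int j"]) auto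
    finally show ?thesis .
  qed
  then have "(\<integral>\<^sup>+j. \<integral>\<^sup>+s. \<phi> (of_int j + s) \<partial>unit_lborel \<partial>count_space UNIV)
      = (\<integral>\<^sup>+y. \<integral>\<^sup>+j. \<phi> y * indicator {of_int j<..<of_int j + 1} y \<partial>count_space (UNIV :: int set) \<partial>lborel)"
    by (subst nn_integral_count_space_nn_integral) auto
  also have "\<dots> = (\<integral>\<^sup>+y. \<phi> y \<partial>lborel)"
  proof (rule nn_integral_cong_AE)
    show "AE y in lborel. (\<integral>\<^sup>+j. \<phi> y * indicator {of_int j<..<of_int j + 1} y \<partial>count_space (UNIV :: int set)) = \<phi> y"
      using AE_lborel_notin_countable[OF countable_int]
    proof eventually_elim
      case (elim y)
      have 1: "of_int \<lfloor>y\<rfloor> < y"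
      proof -
        have "of_int \<lfloor>y\<rfloor> \<noteq> y"
          using elim by (metis Ints_of_int)
        with of_int_floor_le[of y] show ?thesis
          by linarith
      qed
      have 2: "\<lfloor>y\<rfloor> = j" if "of_int j < y" "y < of_int j + 1" for j
        using that by linarith
      have "(\<integral>\<^sup>+j. \<phi> y * indicator {of_int j<..<of_int j + 1} y \<partial>count_space (UNIV :: int set))
          = (\<Sum>j\<in>{\<lfloor>y\<rfloor>}. \<phi> y * indicator {of_int j<..<of_int j + 1} y)"
      proof (rule nn_integral_count_space')
        fix j :: int assume "j \<notin> {\<lfloor>y\<rfloor>}"
        then have "\<not> (of_int j < y \<and> y < of_int j + 1)"
          using 2[of j] by blast
        then show "\<phi> y * indicator {of_int j<..<of_int j + 1} y = 0"
          by (simp add: indicator_def)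
      qed auto
      then show ?case
        using 1 by (simp add: indicator_def)
    qed
  qed
  finally show ?thesis ..
qed

lemma borel_measurable_nn_integral_count_space:
  fixes f :: "'i \<Rightarrow> 'a \<Rightarrow> ennreal"
  assumes I: "countable I" and [measurable]: "\<And>i. i \<in> I \<Longrightarrow> f i \<in> borel_measurable M"
  shows "(\<lambda>x. \<integral>\<^sup>+i. f i x \<partial>count_space I) \<in> borel_measurable M"
proof (cases "finite I")
  case True
  then show ?thesis
    by (simp add: nn_integral_count_space_finite)
next
  case False
  note bij = bij_betw_from_nat_into[OF I False]
  have "(\<lambda>x. \<integral>\<^sup>+i. f i x \<partial>count_space I) = (\<lambda>x. \<Sum>n. f (from_nat_into I n) x)"
    by (simp add: nn_integral_bij_count_space[symmetric, OF bij] nn_integral_count_space_nat)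
  moreover have "from_nat_into I n \<in> I" for n
    using False by (intro from_nat_into) auto
  ultimately show ?thesis
    by simp
qed

text \<open>The squared sinc function, \<open>(sin (pi * t) / (pi * t))\<close> squared, with value
  1 at 0.\<close>

definition wave_kernel :: "real \<Rightarrow> real" where
  "wave_kernel t = (cmod (\<integral>s. wave t s \<partial>unit_lborel))\<^sup>2"

lemma wave_kernel_nonneg: "0 \<le> wave_kernel t"
  by (simp add: wave_kernel_def)

lemma borel_measurable_wave_kernel [measurable]: "wave_kernel \<in> borel_measurable borel"
proof -
  have "(\<lambda>t. \<integral>s. wave t s \<partial>unit_lborel) \<in> borel_measurable borel"
  proof (rule unit_lborel.borel_measurable_lebesgue_integral)
    have [measurable]: "(\<lambda>s. s) \<in> borel_measurable unit_lborel"
      by measurable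
    show "case_prod wave \<in> borel_measurable (borel \<Otimes>\<^sub>M unit_lborel)"
      unfolding case_prod_unfold by measurable
  qed
  then show ?thesis
    unfolding wave_kernel_def by measurable
qed

text \<open>Parseval for \<open>wave t\<close>, which has norm 1 and whose coefficient at the
  integer frequency \<open>k\<close> has squared modulus \<open>wave_kernel (t - k)\<close>.\<close>

lemma sum_wave_kernel: "(\<integral>\<^sup>+k. ennreal (wave_kernel (t + of_int k)) \<partial>count_space UNIV) = 1"
proof -
  have "(\<integral>\<^sup>+k. ennreal (wave_kernel (t + of_int k)) \<partial>count_space UNIV)
      = (\<integral>\<^sup>+k. ennreal (wave_kernel (t - of_int k)) \<partial>count_space UNIV)"
    using nn_integral_bij_count_space[OF bij_uminus, of "\<lambda>k. ennreal (wave_kernel (t - of_int k))"]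
    by simp
  then show ?thesis
    using Fourier_Parseval[OF wave_L2[of t], of 0]
    by (simp add: L2_inner_wave wave_kernel_def)
qed

text \<open>Folding the line reduces the integral to the sums over integer translates, each of which
  is 1.\<close>

lemma integral_wave_kernel: "(\<integral>\<^sup>+b. ennreal (wave_kernel (\<eta> - b)) \<partial>lborel) = 1"
proof -
  have "(\<integral>\<^sup>+b. ennreal (wave_kernel (\<eta> - b)) \<partial>lborel)
      = (\<integral>\<^sup>+j. \<integral>\<^sup>+s. ennreal (wave_kernel (\<eta> - (of_int j + s))) \<partial>unit_lborel \<partial>count_space UNIV)"
    by (rule nn_integral_real_fold) measurable
  also have "\<dots> = (\<integral>\<^sup>+s. \<integral>\<^sup>+j. ennreal (wave_kernel (\<eta> - (of_int j + s))) \<partial>count_space (UNIV :: int set) \<partial>unit_lborel)"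
    by (rule nn_integral_count_space_nn_integral[symmetric]) auto
  also have "\<dots> = (\<integral>\<^sup>+s. 1 \<partial>unit_lborel)"
  proof (rule nn_integral_cong)
    fix s :: real
    have "(\<integral>\<^sup>+j. ennreal (wave_kernel (\<eta> - (of_int j + s))) \<partial>count_space (UNIV :: int set))
      = (\<integral>\<^sup>+j. ennreal (wave_kernel ((\<eta> - s) + of_int j)) \<partial>count_space (UNIV :: int set))"
      using nn_integral_bij_count_space[OF bij_uminus, of "\<lambda>j. ennreal (wave_kernel ((\<eta> - s) + of_int j))"]
      by (simp add: algebra_simps)
    then show "(\<integral>\<^sup>+j. ennreal (wave_kernel (\<eta> - (of_int j + s))) \<partial>count_space (UNIV :: int set)) = 1"
      by (simp add: sum_wave_kernel)
  qed
  also have "\<dots> = 1"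
    by (simp add: emeasure_unit_lborel)
  finally show ?thesis .
qed

text \<open>Models the layer characters. The index is a pair of reals because the wave in
  \<open>wave_product\<close> depends on the second frequency itself; by \<open>u_periodic\<close>
  the layers see only its class modulo one.\<close>

locale periodic_unimodular_family = finite_measure A for A :: "'a measure" +
  fixes u :: "real \<times> real \<Rightarrow> 'a \<Rightarrow> complex"
  assumes u_measurable: "u l \<in> borel_measurable A"
    and norm_u: "cmod (u l a) = 1"
    and u_periodic: "u (x, y + of_int k) = u (x, y)"
    and positive: "measure A (space A) > 0"
begin

abbreviation total :: real where
  "total \<equiv> measure A (space A)"

text \<open>A character of the plane in coordinates that separate the layer point from the height
  above the floor. The second frequency acts twice, through \<open>u l\<close> and through the
  wave.\<close>

definition wave_product :: "real \<times> real \<Rightarrow> 'a \<times> real \<Rightarrow> complex" where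
  "wave_product l x = u l (fst x) * wave (snd l) (snd x)"

sublocale prod: pair_sigma_finite A unit_lborel
  by unfold_locales

lemma finite_measure_prod: "finite_measure (A \<Otimes>\<^sub>M unit_lborel)"
  by (intro finite_measure_pair_measure finite_measure_axioms unit_lborel.finite_measure_axioms)

lemma u_L2: "u l \<in> L2_functions A"
  by (rule L2_functions_bounded[OF finite_measure_axioms u_measurable, of _ 1]) (simp add: norm_u)

lemma wave_product_measurable: "wave_product l \<in> borel_measurable (A \<Otimes>\<^sub>M unit_lborel)"
proof -
  note [measurable] = u_measurable[of l]
  have [measurable]: "wave (snd l) \<in> borel_measurable unit_lborel"
    by measurable
  show ?thesis
    unfolding wave_product_def[abs_def] by measurable
qed

lemma wave_product_L2: "wave_product l \<in> L2_functions (A \<Otimes>\<^sub>M unit_lborel)"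
  by (rule L2_functions_bounded[OF finite_measure_prod wave_product_measurable, of _ 1])
    (simp add: wave_product_def norm_u norm_mult)

lemma L2_product:
  assumes g: "g \<in> L2_functions A" and h: "h \<in> L2_functions unit_lborel"
  shows "(\<lambda>x. g (fst x) * h (snd x)) \<in> L2_functions (A \<Otimes>\<^sub>M unit_lborel)"
    and "(\<integral>x. (cmod (g (fst x) * h (snd x)))\<^sup>2 \<partial>(A \<Otimes>\<^sub>M unit_lborel))
      = (\<integral>x. (cmod (g x))\<^sup>2 \<partial>A) * (\<integral>x. (cmod (h x))\<^sup>2 \<partial>unit_lborel)"
    and "L2_inner (A \<Otimes>\<^sub>M unit_lborel) (\<lambda>x. g (fst x) * h (snd x)) (wave_product l)
      = L2_inner A g (u l) * L2_inner unit_lborel h (wave (snd l))"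
proof -
  have [measurable]: "g \<in> borel_measurable A" "h \<in> borel_measurable unit_lborel"
    using g h by (auto simp: L2_functions_iff)
  note int = prod.product_mult_integral[OF L2_functions_integrable[OF g] L2_functions_integrable[OF h]]
  show "(\<lambda>x. g (fst x) * h (snd x)) \<in> L2_functions (A \<Otimes>\<^sub>M unit_lborel)"
    unfolding L2_functions_iff
  proof
    show "(\<lambda>x. g (fst x) * h (snd x)) \<in> borel_measurable (A \<Otimes>\<^sub>M unit_lborel)"
      by measurable
  qed (use int(1) in \<open>simp add: norm_mult power_mult_distrib\<close>)
  show "(\<integral>x. (cmod (g (fst x) * h (snd x)))\<^sup>2 \<partial>(A \<Otimes>\<^sub>M unit_lborel))
      = (\<integral>x. (cmod (g x))\<^sup>2 \<partial>A) * (\<integral>x. (cmod (h x))\<^sup>2 \<partial>unit_lborel)"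
    using int(2) by (simp add: norm_mult power_mult_distrib)
  show "L2_inner (A \<Otimes>\<^sub>M unit_lborel) (\<lambda>x. g (fst x) * h (snd x)) (wave_product l)
      = L2_inner A g (u l) * L2_inner unit_lborel h (wave (snd l))"
    using prod.product_mult_integral(2)[OF L2_mult_integrable[OF g u_L2[of l]] L2_mult_integrable[OF h wave_L2[of "snd l"]]]
    unfolding L2_inner_def wave_product_def by (simp add: mult_ac)
qed

lemma wave_product_eq: "wave_product l = (\<lambda>x. u l (fst x) * wave (snd l) (snd x))"
  by (simp add: wave_product_def fun_eq_iff)

lemma L2_inner_u_self: "L2_inner A (u l) (u l) = total"
  by (simp add: L2_inner_self norm_u)

lemma L2_inner_wave_product:
  "L2_inner (A \<Otimes>\<^sub>M unit_lborel) (wave_product l) (wave_product l')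
    = L2_inner A (u l) (u l') * (\<integral>s. wave (snd l - snd l') s \<partial>unit_lborel)"
  using L2_product(3)[OF u_L2 wave_L2, of l "snd l" l']
  by (simp add: wave_product_eq[of l] L2_inner_wave)

lemma L2_inner_wave_product_self:
  "L2_inner (A \<Otimes>\<^sub>M unit_lborel) (wave_product l) (wave_product l) = total"
  by (simp add: L2_inner_wave_product L2_inner_u_self)

section \<open>From a basis of the product to a basis of the first factor\<close>

context
  fixes \<Lambda> :: "(real \<times> real) set"
  assumes countable_\<Lambda>: "countable \<Lambda>"
    and basis: "L2_orthogonal_basis (A \<Otimes>\<^sub>M unit_lborel) wave_product \<Lambda>"
begin

text \<open>The inner product over the product space factors, and the wave integral is nonzero
  because a difference below 1 in modulus is no nonzero integer.\<close>

lemma window_orthogonal: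
  assumes "l \<in> \<Lambda>" "l' \<in> \<Lambda>" "l \<noteq> l'" "\<bar>snd l - snd l'\<bar> < 1"
  shows "L2_inner A (u l) (u l') = 0"
proof -
  have "L2_inner A (u l) (u l') * (\<integral>s. wave (snd l - snd l') s \<partial>unit_lborel) = 0"
    using basis assms(1-3) unfolding L2_inner_wave_product[symmetric] L2_orthogonal_basis_def by blast
  moreover have "snd l - snd l' \<notin> \<int> - {0}"
  proof
    assume "snd l - snd l' \<in> \<int> - {0}"
    then obtain z :: int where "snd l - snd l' = of_int z" "z \<noteq> 0"
      by (auto elim!: Ints_cases)
    with assms(4) show False
      by linarith
  qed
  ultimately show ?thesis
    using integral_wave_eq_0_iff by auto
qed

text \<open>The half-open window keeps differences of second coordinates below 1, while its
  translates by integers still cover the line without overlap.\<close>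

definition window_mass :: "('a \<Rightarrow> complex) \<Rightarrow> real \<Rightarrow> ennreal" where
  "window_mass g b = (\<integral>\<^sup>+l. ennreal ((cmod (L2_inner A g (u l)))\<^sup>2) * indicator {b - 1<..b} (snd l) \<partial>count_space \<Lambda>)"

lemma window_mass_eq:
  "window_mass g b
    = (\<integral>\<^sup>+l. ennreal ((cmod (L2_inner A g (u l)))\<^sup>2) \<partial>count_space {l\<in>\<Lambda>. b - 1 < snd l \<and> snd l \<le> b})"
  unfolding window_mass_def
  by (auto simp: nn_integral_count_space_indicator indicator_def intro!: nn_integral_cong)

lemma window_mass_le:
  assumes "g \<in> L2_functions A"
  shows "window_mass g b \<le> ennreal (total * (\<integral>x. (cmod (g x))\<^sup>2 \<partial>A))"
  unfolding window_mass_eq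
  using countable_\<Lambda> u_L2 L2_inner_u_self positive
  by (intro Bessel_inequality[OF assms]) (auto intro: countable_subset intro!: window_orthogonal)

lemma window_mass_measurable [measurable]: "window_mass g \<in> borel_measurable borel"
  unfolding window_mass_def[abs_def]
proof (rule borel_measurable_nn_integral_count_space[OF countable_\<Lambda>])
  fix l :: "real \<times> real"
  \<comment> \<open>Seen as a function of the endpoint \<open>b\<close>, membership in the window is
    membership of \<open>b\<close> in an interval closed on the left; measurability and
    right-continuity come from there.\<close>
  have eq: "indicator {b - 1<..b} (snd l) = (indicator {snd l..<snd l + 1} b :: ennreal)" for b
    by (auto simp: indicator_def)
  show "(\<lambda>b. ennreal ((cmod (L2_inner A g (u l)))\<^sup>2) * indicator {b - 1<..b} (snd l)) \<in> borel_measurable borel"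
    unfolding eq by measurable
qed

text \<open>Parseval for the test function \<open>g\<close> times \<open>wave \<eta>\<close>, whose
  coefficients split into a layer coefficient and a wave integral.\<close>

lemma Parseval_kernel:
  assumes g: "g \<in> L2_functions A"
  shows "(\<integral>\<^sup>+l. ennreal ((cmod (L2_inner A g (u l)))\<^sup>2) * ennreal (wave_kernel (\<eta> - snd l)) \<partial>count_space \<Lambda>)
    = ennreal (total * (\<integral>x. (cmod (g x))\<^sup>2 \<partial>A))"
proof -
  have "(\<integral>\<^sup>+l. ennreal ((cmod (L2_inner (A \<Otimes>\<^sub>M unit_lborel) (\<lambda>x. g (fst x) * wave \<eta> (snd x)) (wave_product l)))\<^sup>2) \<partial>count_space \<Lambda>)
      = ennreal (total * (\<integral>x. (cmod (g (fst x) * wave \<eta> (snd x)))\<^sup>2 \<partial>(A \<Otimes>\<^sub>M unit_lborel)))"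
    using L2_orthogonal_basis_Parseval[OF basis countable_\<Lambda> L2_inner_wave_product_self positive
        L2_product(1)[OF g wave_L2]] .
  then show ?thesis
    unfolding L2_product(3)[OF g wave_L2] L2_product(2)[OF g wave_L2]
    by (simp add: L2_inner_wave wave_kernel_def norm_mult power_mult_distrib ennreal_mult)
qed

text \<open>Writing the endpoint as \<open>b = snd l + s\<close> turns the integral into the mean
  over \<open>s\<close> in (0, 1) of \<open>Parseval_kernel\<close> at \<open>\<eta> - s\<close>,
  and that integrand is constant in \<open>s\<close>.\<close>

lemma window_mass_kernel:
  assumes g: "g \<in> L2_functions A"
  shows "(\<integral>\<^sup>+b. ennreal (wave_kernel (\<eta> - b)) * window_mass g b \<partial>lborel)
    = ennreal (total * (\<integral>x. (cmod (g x))\<^sup>2 \<partial>A))"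
proof -
  define a where "a l = ennreal ((cmod (L2_inner A g (u l)))\<^sup>2)" for l
  have eq: "indicator {b - 1<..b} (snd l) = (indicator {snd l..<snd l + 1} b :: ennreal)"
    for b and l :: "real \<times> real"
    by (auto simp: indicator_def)
  have inner: "(\<integral>\<^sup>+b. ennreal (wave_kernel (\<eta> - b)) * (a l * indicator {snd l..<snd l + 1} b) \<partial>lborel)
      = (\<integral>\<^sup>+s. a l * ennreal (wave_kernel (\<eta> - s - snd l)) \<partial>unit_lborel)" for l
  proof -
    have "(\<integral>\<^sup>+b. ennreal (wave_kernel (\<eta> - b)) * (a l * indicator {snd l..<snd l + 1} b) \<partial>lborel)
        = (\<integral>\<^sup>+s. ennreal (wave_kernel (\<eta> - (snd l + 1 * s))) * (a l * indicator {snd l..<snd l + 1} (snd l + 1 * s)) \<partial>lborel)"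
      by (subst nn_integral_real_affine[where c = 1 and t = "snd l"]) auto
    also have "\<dots> = (\<integral>\<^sup>+s. a l * ennreal (wave_kernel (\<eta> - s - snd l)) * indicator {0<..<1} s \<partial>lborel)"
    proof (rule nn_integral_cong_AE)
      \<comment> \<open>The indicator contains \<open>s = 0\<close>, the open unit interval does
        not.\<close>
      have "AE s in lborel. s \<notin> {0::real}"
        by (rule AE_lborel_notin_countable) simp
      then show "AE s in lborel. ennreal (wave_kernel (\<eta> - (snd l + 1 * s))) * (a l * indicator {snd l..<snd l + 1} (snd l + 1 * s))
          = a l * ennreal (wave_kernel (\<eta> - s - snd l)) * indicator {0<..<1} s"
        by eventually_elim (auto simp: indicator_def algebra_simps)
    qed
    also have "\<dots> = (\<integral>\<^sup>+s. a l * ennreal (wave_kernel (\<eta> - s - snd l)) \<partial>unit_lborel)"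
      unfolding unit_lborel_def by (rule nn_integral_restrict_space[symmetric]) simp
    finally show ?thesis .
  qed
  have "(\<integral>\<^sup>+b. ennreal (wave_kernel (\<eta> - b)) * window_mass g b \<partial>lborel)
      = (\<integral>\<^sup>+b. \<integral>\<^sup>+l. ennreal (wave_kernel (\<eta> - b)) * (a l * indicator {snd l..<snd l + 1} b) \<partial>count_space \<Lambda> \<partial>lborel)"
    unfolding window_mass_def eq a_def by (simp add: nn_integral_cmult)
  also have "\<dots> = (\<integral>\<^sup>+l. \<integral>\<^sup>+b. ennreal (wave_kernel (\<eta> - b)) * (a l * indicator {snd l..<snd l + 1} b) \<partial>lborel \<partial>count_space \<Lambda>)"
    by (rule nn_integral_count_space_nn_integral[OF countable_\<Lambda>]) measurable
  also have "\<dots> = (\<integral>\<^sup>+l. \<integral>\<^sup>+s. a l * ennreal (wave_kernel (\<eta> - s - snd l)) \<partial>unit_lborel \<partial>count_space \<Lambda>)"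
    unfolding inner ..
  also have "\<dots> = (\<integral>\<^sup>+s. \<integral>\<^sup>+l. a l * ennreal (wave_kernel (\<eta> - s - snd l)) \<partial>count_space \<Lambda> \<partial>unit_lborel)"
    by (rule nn_integral_count_space_nn_integral[OF countable_\<Lambda>, symmetric]) measurable
  also have "\<dots> = (\<integral>\<^sup>+s. ennreal (total * (\<integral>x. (cmod (g x))\<^sup>2 \<partial>A)) \<partial>unit_lborel)"
    unfolding a_def Parseval_kernel[OF g] ..
  also have "\<dots> = ennreal (total * (\<integral>x. (cmod (g x))\<^sup>2 \<partial>A))"
    by (simp add: emeasure_unit_lborel)
  finally show ?thesis .
qed

text \<open>The mass never exceeds the Bessel bound, yet its mean against a weight of total mass 1
  attains it. Hence the deficit vanishes almost everywhere that the weight is positive.\<close>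

lemma AE_window_mass_eq:
  assumes g: "g \<in> L2_functions A"
  shows "AE b in lborel. window_mass g b = ennreal (total * (\<integral>x. (cmod (g x))\<^sup>2 \<partial>A))"
proof -
  let ?N = "total * (\<integral>x. (cmod (g x))\<^sup>2 \<partial>A)"
  have "AE b in lborel. ennreal (wave_kernel (of_int k - b)) * ennreal ?N
      - ennreal (wave_kernel (of_int k - b)) * window_mass g b = 0" for k :: int
  proof -
    have le: "ennreal (wave_kernel (of_int k - b)) * window_mass g b
        \<le> ennreal (wave_kernel (of_int k - b)) * ennreal ?N" for b
      by (intro mult_left_mono window_mass_le g) auto
    have "(\<integral>\<^sup>+b. ennreal (wave_kernel (of_int k - b)) * ennreal ?N
        - ennreal (wave_kernel (of_int k - b)) * window_mass g b \<partial>lborel)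
        = (\<integral>\<^sup>+b. ennreal (wave_kernel (of_int k - b)) * ennreal ?N \<partial>lborel)
        - (\<integral>\<^sup>+b. ennreal (wave_kernel (of_int k - b)) * window_mass g b \<partial>lborel)"
      using le by (intro nn_integral_diff) (auto simp: window_mass_kernel[OF g])
    also have "\<dots> = 0"
      by (simp add: window_mass_kernel[OF g] nn_integral_multc integral_wave_kernel)
    finally show ?thesis
      by (subst (asm) nn_integral_0_iff_AE) measurable
  qed
  then have "AE b in lborel. \<forall>k::int. ennreal (wave_kernel (of_int k - b)) * ennreal ?N
      - ennreal (wave_kernel (of_int k - b)) * window_mass g b = 0"
    by (simp add: AE_all_countable)
  then show ?thesis
  proof eventually_elim
    case (elim b)
    \<comment> \<open>A single translate of the kernel may vanish at \<open>b\<close>, but the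
      integer translates add up to 1 there. This spares a description of the zeros.\<close>
    have "\<exists>k::int. wave_kernel (of_int k - b) \<noteq> 0"
    proof (rule ccontr)
      assume "\<not> ?thesis"
      then have "wave_kernel (- b + of_int k) = 0" for k :: int
        by simp
      then show False
        using sum_wave_kernel[of "- b"] by simp
    qed
    then obtain k :: int where "wave_kernel (of_int k - b) > 0"
      using wave_kernel_nonneg by (metis less_eq_real_def)
    moreover have "ennreal (wave_kernel (of_int k - b)) * ennreal ?N
        \<le> ennreal (wave_kernel (of_int k - b)) * window_mass g b"
      using elim by (metis diff_eq_0_iff_ennreal le_less_linear order_less_imp_le ennreal_minus_eq_0)
    ultimately have "ennreal ?N \<le> window_mass g b"
      by (simp add: ennreal_mult_le_mult_iff)
    with window_mass_le[OF g] show ?case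
      by (intro antisym)
  qed
qed

text \<open>The windows are half-open, so the mass is right-continuous in the endpoint.\<close>

lemma window_mass_eq_Parseval:
  assumes g: "g \<in> L2_functions A"
  shows "window_mass g 0 = ennreal (total * (\<integral>x. (cmod (g x))\<^sup>2 \<partial>A))"
proof -
  let ?N = "total * (\<integral>x. (cmod (g x))\<^sup>2 \<partial>A)"
  have "\<exists>y. 0 < y \<and> y < 1 / real (Suc n) \<and> window_mass g y = ennreal ?N" for n
    by (rule AE_lborel_ex_between[OF AE_window_mass_eq[OF g]]) simp
  then obtain b where b: "\<And>n. 0 < b n" "\<And>n. b n < 1 / real (Suc n)"
    "\<And>n. window_mass g (b n) = ennreal ?N"
    by metis
  have b_lim: "b \<longlonglongrightarrow> 0"
    using b(1,2) by (intro tendsto_sandwich[OF _ _ tendsto_const LIMSEQ_inverse_real_of_nat])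
      (auto simp: inverse_eq_divide less_imp_le)
  have b1: "b n < 1" for n
    using b(2)[of n] by (rule less_le_trans) simp
  define a where "a l = ennreal ((cmod (L2_inner A g (u l)))\<^sup>2)" for l
  have "(\<lambda>n. \<integral>\<^sup>+l. a l * indicator {b n - 1<..b n} (snd l) \<partial>count_space \<Lambda>)
      \<longlonglongrightarrow> (\<integral>\<^sup>+l. a l * indicator {0 - 1<..0} (snd l) \<partial>count_space \<Lambda>)"
  \<comment> \<open>For endpoints between 0 and 1 the window lies in the union of the windows ending
    at 0 and at 1, both of finite mass by Bessel.\<close>
  proof (rule nn_integral_dominated_convergence[where
        w = "\<lambda>l. a l * indicator {0 - 1<..0} (snd l) + a l * indicator {1 - 1<..1} (snd l)"])
    have "(\<integral>\<^sup>+l. a l * indicator {0 - 1<..0} (snd l) + a l * indicator {1 - 1<..1} (snd l) \<partial>count_space \<Lambda>)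
        = window_mass g 0 + window_mass g 1"
      unfolding window_mass_def a_def by (rule nn_integral_add) auto
    also have "\<dots> < \<infinity>"
      using window_mass_le[OF g, of 0] window_mass_le[OF g, of 1]
      by (auto simp: less_top[symmetric] top_unique)
    finally show "(\<integral>\<^sup>+l. a l * indicator {0 - 1<..0} (snd l) + a l * indicator {1 - 1<..1} (snd l) \<partial>count_space \<Lambda>) < \<infinity>" .
    show "AE l in count_space \<Lambda>. a l * indicator {b n - 1<..b n} (snd l)
        \<le> a l * indicator {0 - 1<..0} (snd l) + a l * indicator {1 - 1<..1} (snd l)" for n
      using b(1)[of n] b1[of n] by (auto simp: AE_count_space indicator_def)
    show "AE l in count_space \<Lambda>. (\<lambda>n. a l * indicator {b n - 1<..b n} (snd l))
        \<longlonglongrightarrow> a l * indicator {0 - 1<..0} (snd l)"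
    proof (rule AE_I2)
      fix l :: "real \<times> real"
      have "\<forall>\<^sub>F n in sequentially. (snd l > 0 \<longrightarrow> b n < snd l) \<and> (snd l > -1 \<longrightarrow> b n < snd l + 1)"
        using order_tendstoD(2)[OF b_lim, of "snd l"] order_tendstoD(2)[OF b_lim, of "snd l + 1"]
        by (auto simp: eventually_conj_iff)
      then have "\<forall>\<^sub>F n in sequentially. a l * indicator {b n - 1<..b n} (snd l) = a l * indicator {0 - 1<..0} (snd l)"
      proof eventually_elim
        case (elim n)
        then show ?case
          using b(1)[of n] by (auto simp: indicator_def)
      qed
      then show "(\<lambda>n. a l * indicator {b n - 1<..b n} (snd l)) \<longlonglongrightarrow> a l * indicator {0 - 1<..0} (snd l)"
        by (rule tendsto_eventually)
    qed
  qed auto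
  then have "(\<lambda>n. window_mass g (b n)) \<longlonglongrightarrow> window_mass g 0"
    by (simp only: window_mass_def a_def)
  then show ?thesis
    unfolding b(3) by (simp add: LIMSEQ_const_iff)
qed

lemma window_basis: "L2_orthogonal_basis A u {l\<in>\<Lambda>. - 1 < snd l \<and> snd l \<le> 0}"
proof (rule L2_orthogonal_basisI[OF _ u_L2 L2_inner_u_self positive])
  show "countable {l\<in>\<Lambda>. - 1 < snd l \<and> snd l \<le> 0}"
    using countable_\<Lambda> by (rule countable_subset[rotated]) auto
  show "L2_inner A (u l) (u l') = 0"
    if "l \<in> {l\<in>\<Lambda>. - 1 < snd l \<and> snd l \<le> 0}" "l' \<in> {l\<in>\<Lambda>. - 1 < snd l \<and> snd l \<le> 0}" "l \<noteq> l'" for l l'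
    using that by (intro window_orthogonal) auto
  show "ennreal (total * (\<integral>x. (cmod (f x))\<^sup>2 \<partial>A))
      \<le> (\<integral>\<^sup>+l. ennreal ((cmod (L2_inner A f (u l)))\<^sup>2) \<partial>count_space {l\<in>\<Lambda>. - 1 < snd l \<and> snd l \<le> 0})"
    if "f \<in> L2_functions A" for f
    using window_mass_eq_Parseval[OF that] window_mass_eq[of f 0] by simp
qed

end

end

section \<open>From a basis of the first factor to a basis of the product\<close>

lemma nn_integral_count_space_Times:
  fixes f :: "'i \<times> 'j \<Rightarrow> ennreal"
  shows "(\<integral>\<^sup>+p. f p \<partial>count_space (I \<times> J))
    = (\<integral>\<^sup>+i. \<integral>\<^sup>+j. f (i, j) \<partial>count_space J \<partial>count_space I)"
proof -
  have "(\<integral>\<^sup>+p. f p \<partial>count_space (I \<times> J)) = (\<integral>\<^sup>+p. f p * indicator (I \<times> J) p \<partial>count_space UNIV)"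
    by (subst nn_integral_count_space_indicator) auto
  also have "\<dots> = (\<integral>\<^sup>+i. \<integral>\<^sup>+j. f (i, j) * indicator (I \<times> J) (i, j) \<partial>count_space UNIV \<partial>count_space UNIV)"
    by (rule nn_integral_fst_count_space[symmetric])
  also have "\<dots> = (\<integral>\<^sup>+i. (\<integral>\<^sup>+j. f (i, j) * indicator J j \<partial>count_space UNIV) * indicator I i \<partial>count_space UNIV)"
    by (intro nn_integral_cong) (auto simp: indicator_def)
  also have "\<dots> = (\<integral>\<^sup>+i. \<integral>\<^sup>+j. f (i, j) * indicator J j \<partial>count_space UNIV \<partial>count_space I)"
    unfolding nn_integral_restrict_space[of I "count_space UNIV", symmetric, simplified]
    by (simp add: restrict_count_space)
  also have "\<dots> = (\<integral>\<^sup>+i. \<integral>\<^sup>+j. f (i, j) \<partial>count_space J \<partial>count_space I)"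
    unfolding nn_integral_restrict_space[of J "count_space UNIV", symmetric, simplified]
    by (simp add: restrict_count_space)
  finally show ?thesis .
qed

context periodic_unimodular_family
begin

definition shift :: "(real \<times> real) \<times> int \<Rightarrow> real \<times> real" where
  "shift p = (fst (fst p), snd (fst p) + of_int (snd p))"

lemma u_shift: "u (shift (l, k)) = u l"
  using u_periodic[of "fst l" "snd l" k] by (simp add: shift_def)

lemma AE_section_L2:
  assumes f: "f \<in> L2_functions (A \<Otimes>\<^sub>M unit_lborel)"
  shows "AE s in unit_lborel. (\<lambda>a. f (a, s)) \<in> L2_functions A"
proof -
  have int: "integrable (A \<Otimes>\<^sub>M unit_lborel) (\<lambda>(a, s). (cmod (f (a, s)))\<^sup>2)"
    using L2_functions_integrable[OF f] by (simp add: case_prod_unfold)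
  show ?thesis
    using prod.AE_integrable_snd[OF int] AE_space
  proof eventually_elim
    case (elim s)
    have "(\<lambda>a. f (a, s)) \<in> borel_measurable A"
      using measurable_compose[OF measurable_Pair2'[OF elim(2)] L2_functions_measurable[OF f]]
      by simp
    with elim(1) show ?case
      by (simp add: L2_functions_iff)
  qed
qed

definition section_coeff :: "('a \<times> real \<Rightarrow> complex) \<Rightarrow> real \<times> real \<Rightarrow> real \<Rightarrow> complex" where
  "section_coeff f l s = L2_inner A (\<lambda>a. f (a, s)) (u l)"

lemma integrable_section:
  assumes f: "f \<in> L2_functions (A \<Otimes>\<^sub>M unit_lborel)"
  shows "integrable (A \<Otimes>\<^sub>M unit_lborel) (\<lambda>(a, s). f (a, s) * cnj (u l a))"
proof -
  have [measurable]: "u l \<in> borel_measurable A"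
    by (rule u_measurable)
  have "(\<lambda>x. f x * cnj (u l (fst x))) \<in> L2_functions (A \<Otimes>\<^sub>M unit_lborel)"
    by (rule L2_functions_bounded_mult[OF f]) (simp_all add: norm_u)
  from L2_functions_imp_integrable[OF finite_measure_prod this] show ?thesis
    by (simp add: case_prod_unfold)
qed

text \<open>By Fubini, the coefficient is a Fourier coefficient in the height of the layer
  coefficient of the horizontal sections.\<close>

lemma L2_inner_wave_product_section:
  assumes f: "f \<in> L2_functions (A \<Otimes>\<^sub>M unit_lborel)"
  shows "L2_inner (A \<Otimes>\<^sub>M unit_lborel) f (wave_product l)
    = L2_inner unit_lborel (section_coeff f l) (wave (snd l))"
proof -
  have int: "integrable (A \<Otimes>\<^sub>M unit_lborel) (\<lambda>(a, s). f (a, s) * cnj (u l a) * cnj (wave (snd l) s))"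
    using L2_mult_integrable[OF f wave_product_L2[of l]]
    by (simp add: wave_product_def case_prod_unfold mult.assoc)
  have "L2_inner (A \<Otimes>\<^sub>M unit_lborel) f (wave_product l)
      = (\<integral>s. \<integral>a. f (a, s) * cnj (u l a) * cnj (wave (snd l) s) \<partial>A \<partial>unit_lborel)"
    using prod.integral_snd[OF int]
    by (simp add: L2_inner_def wave_product_def case_prod_unfold mult.assoc)
  then show ?thesis
    by (simp add: L2_inner_def section_coeff_def)
qed

text \<open>Parseval on (0, 1) sums over the integer shifts for each \<open>l\<close>; after an
  exchange by Tonelli, Parseval over \<open>\<Lambda>\<close> applies to almost every
  section.\<close>

lemma product_Parseval:
  assumes \<Lambda>: "countable \<Lambda>" and basis: "L2_orthogonal_basis A u \<Lambda>"
    and f: "f \<in> L2_functions (A \<Otimes>\<^sub>M unit_lborel)"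
  shows "(\<integral>\<^sup>+p. ennreal ((cmod (L2_inner (A \<Otimes>\<^sub>M unit_lborel) f (wave_product (shift p))))\<^sup>2) \<partial>count_space (\<Lambda> \<times> UNIV))
    = ennreal (total * (\<integral>x. (cmod (f x))\<^sup>2 \<partial>(A \<Otimes>\<^sub>M unit_lborel)))"
proof -
  let ?G = "section_coeff f"
  have G_meas [measurable]: "?G l \<in> borel_measurable unit_lborel" for l
    using borel_measurable_integrable[OF prod.integrable_snd[OF integrable_section[OF f, of l]]]
    by (simp add: section_coeff_def[abs_def] L2_inner_def)
  have int: "integrable (A \<Otimes>\<^sub>M unit_lborel) (\<lambda>(a, s). (cmod (f (a, s)))\<^sup>2)"
    using L2_functions_integrable[OF f] by (simp add: case_prod_unfold)
  have "(\<integral>\<^sup>+l. \<integral>\<^sup>+s. ennreal ((cmod (?G l s))\<^sup>2) \<partial>unit_lborel \<partial>count_space \<Lambda>)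
      = (\<integral>\<^sup>+s. \<integral>\<^sup>+l. ennreal ((cmod (?G l s))\<^sup>2) \<partial>count_space \<Lambda> \<partial>unit_lborel)"
    by (rule nn_integral_count_space_nn_integral[OF \<Lambda>, symmetric]) measurable
  also have "\<dots> = (\<integral>\<^sup>+s. ennreal (total * (\<integral>a. (cmod (f (a, s)))\<^sup>2 \<partial>A)) \<partial>unit_lborel)"
  proof (rule nn_integral_cong_AE)
    show "AE s in unit_lborel. (\<integral>\<^sup>+l. ennreal ((cmod (?G l s))\<^sup>2) \<partial>count_space \<Lambda>)
        = ennreal (total * (\<integral>a. (cmod (f (a, s)))\<^sup>2 \<partial>A))"
      using AE_section_L2[OF f]
    proof eventually_elim
      case (elim s)
      show ?case
        unfolding section_coeff_def
        by (rule L2_orthogonal_basis_Parseval[OF basis \<Lambda> L2_inner_u_self positive elim])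
    qed
  qed
  also have "\<dots> = ennreal (\<integral>s. total * (\<integral>a. (cmod (f (a, s)))\<^sup>2 \<partial>A) \<partial>unit_lborel)"
    using prod.integrable_snd[OF int] positive
    by (intro nn_integral_eq_integral) (auto intro!: AE_I2 mult_nonneg_nonneg)
  also have "\<dots> = ennreal (total * (\<integral>x. (cmod (f x))\<^sup>2 \<partial>(A \<Otimes>\<^sub>M unit_lborel)))"
    using prod.integral_snd[OF int] by (simp add: case_prod_unfold)
  finally have sum: "(\<integral>\<^sup>+l. \<integral>\<^sup>+s. ennreal ((cmod (?G l s))\<^sup>2) \<partial>unit_lborel \<partial>count_space \<Lambda>)
      = ennreal (total * (\<integral>x. (cmod (f x))\<^sup>2 \<partial>(A \<Otimes>\<^sub>M unit_lborel)))" .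
  \<comment> \<open>Its squared norm is one term of the sum just shown to be finite.\<close>
  have G: "?G l \<in> L2_functions unit_lborel" if "l \<in> \<Lambda>" for l
  proof -
    have "(\<integral>\<^sup>+s. ennreal ((cmod (?G l s))\<^sup>2) \<partial>unit_lborel)
        \<le> (\<integral>\<^sup>+l. \<integral>\<^sup>+s. ennreal ((cmod (?G l s))\<^sup>2) \<partial>unit_lborel \<partial>count_space \<Lambda>)"
      using nn_integral_count_space_ge[of "{l}" \<Lambda>] that by simp
    also have "\<dots> < \<infinity>"
      by (simp add: sum)
    finally have "integrable unit_lborel (\<lambda>s. (cmod (?G l s))\<^sup>2)"
      by (intro integrableI_bounded) simp_all
    then show ?thesis
      by (simp add: L2_functions_iff)
  qed
  have "(\<integral>\<^sup>+p. ennreal ((cmod (L2_inner (A \<Otimes>\<^sub>M unit_lborel) f (wave_product (shift p))))\<^sup>2) \<partial>count_space (\<Lambda> \<times> UNIV))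
      = (\<integral>\<^sup>+l. \<integral>\<^sup>+k. ennreal ((cmod (L2_inner unit_lborel (?G l) (wave (snd l + of_int k))))\<^sup>2) \<partial>count_space UNIV \<partial>count_space \<Lambda>)"
    unfolding nn_integral_count_space_Times L2_inner_wave_product_section[OF f] section_coeff_def u_shift
    by (simp add: shift_def)
  also have "\<dots> = (\<integral>\<^sup>+l. \<integral>\<^sup>+s. ennreal ((cmod (?G l s))\<^sup>2) \<partial>unit_lborel \<partial>count_space \<Lambda>)"
  proof (rule nn_integral_cong)
    fix l assume "l \<in> space (count_space \<Lambda>)"
    then have l: "?G l \<in> L2_functions unit_lborel"
      by (simp add: G)
    show "(\<integral>\<^sup>+k. ennreal ((cmod (L2_inner unit_lborel (?G l) (wave (snd l + of_int k))))\<^sup>2) \<partial>count_space UNIV)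
        = (\<integral>\<^sup>+s. ennreal ((cmod (?G l s))\<^sup>2) \<partial>unit_lborel)"
      unfolding Fourier_Parseval[OF l]
      using L2_functions_integrable[OF l] by (intro nn_integral_eq_integral[symmetric]) auto
  qed
  finally show ?thesis
    using sum by simp
qed

lemma product_basis:
  assumes \<Lambda>: "countable \<Lambda>" and basis: "L2_orthogonal_basis A u \<Lambda>"
  shows "L2_orthogonal_basis (A \<Otimes>\<^sub>M unit_lborel) wave_product (shift ` (\<Lambda> \<times> UNIV))"
proof (rule L2_orthogonal_basis_reindex)
  have orth: "L2_inner A (u l) (u l') = 0" if "l \<in> \<Lambda>" "l' \<in> \<Lambda>" "l \<noteq> l'" for l l'
    using basis that by (simp add: L2_orthogonal_basis_def)
  show "inj_on shift (\<Lambda> \<times> UNIV)"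
  proof (rule inj_onI)
    fix p q assume p: "p \<in> \<Lambda> \<times> UNIV" and q: "q \<in> \<Lambda> \<times> UNIV" and eq: "shift p = shift q"
    \<comment> \<open>Points of \<open>\<Lambda>\<close> differing by an integer would carry the
      same function, which is nonzero and so cannot be orthogonal to itself.\<close>
    have "u (fst p) = u (fst q)"
      using eq u_shift[of "fst p" "snd p"] u_shift[of "fst q" "snd q"] by simp
    then have "L2_inner A (u (fst p)) (u (fst q)) \<noteq> 0"
      using L2_inner_u_self[of "fst p"] positive by simp
    then have "fst p = fst q"
      using orth[of "fst p" "fst q"] p q by (auto simp: mem_Times_iff)
    with eq show "p = q"
      by (auto simp: shift_def prod_eq_iff)
  qed
  show "L2_orthogonal_basis (A \<Otimes>\<^sub>M unit_lborel) (wave_product \<circ> shift) (\<Lambda> \<times> UNIV)"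
  proof (rule L2_orthogonal_basisI[OF _ _ _ positive])
    show "countable (\<Lambda> \<times> (UNIV :: int set))"
      using \<Lambda> by simp
    fix p q :: "(real \<times> real) \<times> int" assume pq: "p \<in> \<Lambda> \<times> UNIV" "q \<in> \<Lambda> \<times> UNIV" "p \<noteq> q"
    have "L2_inner (A \<Otimes>\<^sub>M unit_lborel) (wave_product (shift p)) (wave_product (shift q))
        = L2_inner A (u (fst p)) (u (fst q))
          * L2_inner unit_lborel (wave (snd (fst p) + of_int (snd p))) (wave (snd (fst q) + of_int (snd q)))"
      using u_shift[of "fst p" "snd p"] u_shift[of "fst q" "snd q"]
      by (simp add: L2_inner_wave_product L2_inner_wave) (simp add: shift_def)
    \<comment> \<open>Distinct \<open>l\<close> make the first factor vanish; for equal
      \<open>l\<close> the shifts differ and the second one does.\<close>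
    also have "\<dots> = 0"
      using pq orth[of "fst p" "fst q"] L2_inner_wave_int[of "snd (fst p)" "snd p" "snd q"]
      by (cases "fst p = fst q") (auto simp: prod_eq_iff)
    finally show "L2_inner (A \<Otimes>\<^sub>M unit_lborel) ((wave_product \<circ> shift) p) ((wave_product \<circ> shift) q) = 0"
      by simp
  qed (simp_all add: wave_product_L2 L2_inner_wave_product_self product_Parseval[OF \<Lambda> basis])
qed

end

section \<open>Transfer of spectra\<close>

lemma completion_ex_borel_measurable_complex:
  fixes g :: "'a \<Rightarrow> complex"
  assumes g: "g \<in> borel_measurable (completion M)"
  shows "\<exists>g'\<in>borel_measurable M. (AE x in M. g x = g' x)"
proof -
  have "(\<lambda>x. Re (g x)) \<in> borel_measurable (completion M)" "(\<lambda>x. Im (g x)) \<in> borel_measurable (completion M)"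
    using g by auto
  from this[THEN completion_ex_borel_measurable_real]
  obtain r i where [measurable]: "r \<in> borel_measurable M" "i \<in> borel_measurable M"
    and ae: "AE x in M. Re (g x) = r x" "AE x in M. Im (g x) = i x"
    by blast
  show ?thesis
  proof
    show "(\<lambda>x. Complex (r x) (i x)) \<in> borel_measurable M"
      unfolding Complex_eq by measurable
    show "AE x in M. g x = Complex (r x) (i x)"
      using ae by eventually_elim (simp add: complex_eq_iff)
  qed
qed

text \<open>Spectrality is defined over the completed measure on \<open>E\<close>, whereas products
  and image measures are handled on the Borel set \<open>E'\<close>.\<close>

locale completion_borel_set =
  fixes M :: "'a measure" and E E' :: "'a set"
  assumes E: "E \<in> sets (completion M)" and E': "E' \<in> sets M"
    and AE_eq: "AE x in M. x \<in> E \<longleftrightarrow> x \<in> E'"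
begin

abbreviation completed :: "'a measure" where
  "completed \<equiv> restrict_space (completion M) E"

abbreviation borel_version :: "'a measure" where
  "borel_version \<equiv> restrict_space M E'"

lemma extend_measurable:
  fixes f :: "'a \<Rightarrow> 'b::{banach, second_countable_topology}"
    and g :: "'a \<Rightarrow> 'c::{banach, second_countable_topology}"
  assumes f: "f \<in> borel_measurable completed" and g: "g \<in> borel_measurable borel_version"
  shows "(\<lambda>x. indicator E x *\<^sub>R f x) \<in> borel_measurable (completion M)"
    and "(\<lambda>x. indicator E' x *\<^sub>R g x) \<in> borel_measurable M"
proof -
  have "E \<inter> space M \<in> sets (completion M)"
    using sets.Int_space_eq2[OF E] E by simp
  then show "(\<lambda>x. indicator E x *\<^sub>R f x) \<in> borel_measurable (completion M)"
    using f borel_measurable_restrict_space_iff[of E "completion M" f] by simp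
  show "(\<lambda>x. indicator E' x *\<^sub>R g x) \<in> borel_measurable M"
    using g E' borel_measurable_restrict_space_iff[of E' M g] by simp
qed

lemma integral_eq:
  fixes f :: "'a \<Rightarrow> 'b::{banach, second_countable_topology}"
  assumes f: "f \<in> borel_measurable completed" and g: "g \<in> borel_measurable borel_version"
    and ae: "AE x in M. x \<in> E' \<longrightarrow> f x = g x"
  shows "integral\<^sup>L completed f = integral\<^sup>L borel_version g"
    and "integrable completed f \<longleftrightarrow> integrable borel_version g"
proof -
  note fm = extend_measurable(1)[OF f g] and gm = extend_measurable(2)[OF f g]
  have ae': "AE x in completion M. indicator E x *\<^sub>R f x = indicator E' x *\<^sub>R g x"
    unfolding AE_completion_iff using ae AE_eq by eventually_elim (auto simp: indicator_def)
  have sp: "E \<inter> space (completion M) \<in> sets (completion M)" "E' \<inter> space M \<in> sets M"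
    using E E' by auto
  have "integral\<^sup>L completed f = (\<integral>x. indicator E x *\<^sub>R f x \<partial>completion M)"
    using sp by (intro integral_restrict_space)
  also have "\<dots> = (\<integral>x. indicator E' x *\<^sub>R g x \<partial>completion M)"
    by (rule integral_cong_AE[OF fm measurable_completion[OF gm] ae'])
  also have "\<dots> = (\<integral>x. indicator E' x *\<^sub>R g x \<partial>M)"
    using gm by (rule integral_completion)
  also have "\<dots> = integral\<^sup>L borel_version g"
    using sp by (intro integral_restrict_space[symmetric])
  finally show "integral\<^sup>L completed f = integral\<^sup>L borel_version g" .
  have "integrable completed f \<longleftrightarrow> integrable (completion M) (\<lambda>x. indicator E x *\<^sub>R f x)"
    using sp by (intro integrable_restrict_space)
  also have "\<dots> \<longleftrightarrow> integrable (completion M) (\<lambda>x. indicator E' x *\<^sub>R g x)"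
    by (rule integrable_cong_AE[OF fm measurable_completion[OF gm] ae'])
  also have "\<dots> \<longleftrightarrow> integrable M (\<lambda>x. indicator E' x *\<^sub>R g x)"
    using gm by (rule integrable_completion)
  also have "\<dots> \<longleftrightarrow> integrable borel_version g"
    using sp by (intro integrable_restrict_space[symmetric])
  finally show "integrable completed f \<longleftrightarrow> integrable borel_version g" .
qed

context
  fixes e :: "'i \<Rightarrow> 'a \<Rightarrow> complex"
  assumes e: "\<And>i. e i \<in> borel_measurable M"
begin

lemma e_measurable [measurable]:
  "e i \<in> borel_measurable completed" "e i \<in> borel_measurable borel_version"
  using e by (auto intro: measurable_restrict_space1 measurable_completion)

lemma inner_eq: "L2_inner completed (e i) (e j) = L2_inner borel_version (e i) (e j)"
  unfolding L2_inner_def by (rule integral_eq) auto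

lemma e_L2_iff: "e i \<in> L2_functions completed \<longleftrightarrow> e i \<in> L2_functions borel_version"
  unfolding L2_functions_iff using integral_eq(2)[of "\<lambda>x. (cmod (e i x))\<^sup>2" "\<lambda>x. (cmod (e i x))\<^sup>2"]
  by simp

lemma dist_eq:
  assumes "f \<in> borel_measurable completed" "g \<in> borel_measurable borel_version"
    and "AE x in M. x \<in> E' \<longrightarrow> f x = g x"
  shows "(\<integral>x. (cmod (f x - (\<Sum>i\<in>F. c i * e i x)))\<^sup>2 \<partial>completed)
    = (\<integral>x. (cmod (g x - (\<Sum>i\<in>F. c i * e i x)))\<^sup>2 \<partial>borel_version)"
proof (rule integral_eq)
  note [measurable] = assms(1,2)
  show "(\<lambda>x. (cmod (f x - (\<Sum>i\<in>F. c i * e i x)))\<^sup>2) \<in> borel_measurable completed"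
    "(\<lambda>x. (cmod (g x - (\<Sum>i\<in>F. c i * e i x)))\<^sup>2) \<in> borel_measurable borel_version"
    by measurable
qed (use assms(3) in \<open>auto elim!: eventually_mono\<close>)

lemma L2_iff:
  assumes "f \<in> borel_measurable completed" "g \<in> borel_measurable borel_version"
    and "AE x in M. x \<in> E' \<longrightarrow> f x = g x"
  shows "f \<in> L2_functions completed \<longleftrightarrow> g \<in> L2_functions borel_version"
proof -
  have "integrable completed (\<lambda>x. (cmod (f x))\<^sup>2) \<longleftrightarrow> integrable borel_version (\<lambda>x. (cmod (g x))\<^sup>2)"
    using assms by (intro integral_eq) (auto elim!: eventually_mono)
  then show ?thesis
    using assms(1,2) by (simp add: L2_functions_iff)
qed

text \<open>Partners for the transfer: a Borel function is extended by zero, and a function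
  measurable for the completion is replaced by a Borel function equal to it almost
  everywhere.\<close>

lemma L2_orthogonal_basis_completion_iff:
  "L2_orthogonal_basis completed e I \<longleftrightarrow> L2_orthogonal_basis borel_version e I"
proof
  assume basis: "L2_orthogonal_basis completed e I"
  show "L2_orthogonal_basis borel_version e I"
  proof (rule L2_orthogonal_basis_transfer[OF basis])
    show "e i \<in> L2_functions borel_version" if "i \<in> I" for i
      using basis that by (simp add: L2_orthogonal_basis_def e_L2_iff)
    fix g assume g: "g \<in> L2_functions borel_version"
    then have gm: "g \<in> borel_measurable borel_version"
      by (simp add: L2_functions_iff)
    define f where "f x = indicator E' x *\<^sub>R g x" for x
    have "f \<in> borel_measurable M"
      unfolding f_def[abs_def] by (rule extend_measurable(2)[OF measurable_const gm]) simp
    then have fm: "f \<in> borel_measurable completed"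
      by (intro measurable_restrict_space1 measurable_completion)
    have ae: "AE x in M. x \<in> E' \<longrightarrow> f x = g x"
      by (simp add: f_def)
    show "\<exists>f\<in>L2_functions completed. \<forall>F c. F \<subseteq> I \<longrightarrow>
        (\<integral>x. (cmod (g x - (\<Sum>i\<in>F. c i * e i x)))\<^sup>2 \<partial>borel_version)
        = (\<integral>x. (cmod (f x - (\<Sum>i\<in>F. c i * e i x)))\<^sup>2 \<partial>completed)"
      using L2_iff[OF fm gm ae] g dist_eq[OF fm gm ae] by (intro bexI[of _ f]) auto
  qed (simp add: inner_eq)
next
  assume basis: "L2_orthogonal_basis borel_version e I"
  show "L2_orthogonal_basis completed e I"
  proof (rule L2_orthogonal_basis_transfer[OF basis])
    show "e i \<in> L2_functions completed" if "i \<in> I" for i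
      using basis that by (simp add: L2_orthogonal_basis_def e_L2_iff)
    fix f assume f: "f \<in> L2_functions completed"
    then have fm: "f \<in> borel_measurable completed"
      by (simp add: L2_functions_iff)
    have "(\<lambda>x. indicator E x *\<^sub>R f x) \<in> borel_measurable (completion M)"
      by (rule extend_measurable(1)[OF fm measurable_const]) simp
    then obtain g where g: "g \<in> borel_measurable M" "AE x in M. indicator E x *\<^sub>R f x = g x"
      using completion_ex_borel_measurable_complex by blast
    have gm: "g \<in> borel_measurable borel_version"
      using g(1) by (rule measurable_restrict_space1)
    have ae: "AE x in M. x \<in> E' \<longrightarrow> f x = g x"
      using g(2) AE_eq by eventually_elim (auto simp: indicator_def)
    show "\<exists>g\<in>L2_functions borel_version. \<forall>F c. F \<subseteq> I \<longrightarrow>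
        (\<integral>x. (cmod (f x - (\<Sum>i\<in>F. c i * e i x)))\<^sup>2 \<partial>completed)
        = (\<integral>x. (cmod (g x - (\<Sum>i\<in>F. c i * e i x)))\<^sup>2 \<partial>borel_version)"
      using L2_iff[OF fm gm ae] f dist_eq[OF fm gm ae] by (intro bexI[of _ g]) auto
  qed (simp add: inner_eq)
qed

end

end

text \<open>Composition with a measure-preserving \<open>T\<close> is isometric; the left inverse
  \<open>T'\<close> makes every function on \<open>M\<close> such a composition, so density passes
  both ways.\<close>

lemma L2_orthogonal_basis_distr_iff:
  assumes T: "T \<in> M \<rightarrow>\<^sub>M N" and distr: "distr M N T = N"
    and T': "T' \<in> N \<rightarrow>\<^sub>M M" and inverse: "\<And>x. x \<in> space M \<Longrightarrow> T' (T x) = x"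
    and e: "\<And>i. e i \<in> borel_measurable N"
  shows "L2_orthogonal_basis N e I \<longleftrightarrow> L2_orthogonal_basis M (\<lambda>i x. e i (T x)) I"
proof -
  have integral: "(\<integral>x. h x \<partial>N) = (\<integral>x. h (T x) \<partial>M)" if "h \<in> borel_measurable N"
    for h :: "'b \<Rightarrow> 'd::{banach, second_countable_topology}"
    using integral_distr[OF T that] by (simp add: distr)
  have integrable: "integrable N h \<longleftrightarrow> integrable M (\<lambda>x. h (T x))" if "h \<in> borel_measurable N"
    for h :: "'b \<Rightarrow> 'd::{banach, second_countable_topology}"
    using integrable_distr_eq[OF T that] by (simp add: distr)
  have L2: "f \<in> L2_functions N \<longleftrightarrow> (\<lambda>x. f (T x)) \<in> L2_functions M" if f: "f \<in> borel_measurable N" for f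
  proof -
    have "(\<lambda>x. f (T x)) \<in> borel_measurable M"
      using T f by (rule measurable_compose)
    moreover have "integrable N (\<lambda>x. (cmod (f x))\<^sup>2) \<longleftrightarrow> integrable M (\<lambda>x. (cmod (f (T x)))\<^sup>2)"
      using f by (intro integrable) simp
    ultimately show ?thesis
      using f by (simp add: L2_functions_iff)
  qed
  have inner: "L2_inner N (e i) (e j) = L2_inner M (\<lambda>x. e i (T x)) (\<lambda>x. e j (T x))" for i j
    unfolding L2_inner_def using e[of i] e[of j] by (intro integral) simp
  have dist: "(\<integral>x. (cmod (f x - (\<Sum>i\<in>F. c i * e i x)))\<^sup>2 \<partial>N)
      = (\<integral>x. (cmod (f (T x) - (\<Sum>i\<in>F. c i * e i (T x))))\<^sup>2 \<partial>M)"
    if [measurable]: "f \<in> borel_measurable N" for f c and F :: "'c set"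
  proof -
    note [measurable] = e
    show ?thesis
      by (rule integral) measurable
  qed
  show ?thesis
  proof
    assume basis: "L2_orthogonal_basis N e I"
    show "L2_orthogonal_basis M (\<lambda>i x. e i (T x)) I"
    proof (rule L2_orthogonal_basis_transfer[OF basis])
      show "(\<lambda>x. e i (T x)) \<in> L2_functions M" if "i \<in> I" for i
        using basis that L2[OF e] by (simp add: L2_orthogonal_basis_def)
      fix g assume g: "g \<in> L2_functions M"
      have f: "(\<lambda>y. g (T' y)) \<in> borel_measurable N"
        using measurable_compose[OF T' L2_functions_measurable[OF g]] .
      have "(\<lambda>x. g (T' (T x))) \<in> L2_functions M \<longleftrightarrow> g \<in> L2_functions M"
        unfolding L2_functions_iff
        by (intro conj_cong measurable_cong Bochner_Integration.integrable_cong) (simp_all add: inverse)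
      then have "(\<lambda>y. g (T' y)) \<in> L2_functions N"
        using L2[OF f] g by simp
      moreover have "(\<integral>x. (cmod (g x - (\<Sum>i\<in>F. c i * e i (T x))))\<^sup>2 \<partial>M)
          = (\<integral>x. (cmod (g (T' x) - (\<Sum>i\<in>F. c i * e i x)))\<^sup>2 \<partial>N)" for F c
        unfolding dist[OF f] by (intro Bochner_Integration.integral_cong) (simp_all add: inverse)
      ultimately show "\<exists>f\<in>L2_functions N. \<forall>F c. F \<subseteq> I \<longrightarrow>
          (\<integral>x. (cmod (g x - (\<Sum>i\<in>F. c i * e i (T x))))\<^sup>2 \<partial>M)
          = (\<integral>x. (cmod (f x - (\<Sum>i\<in>F. c i * e i x)))\<^sup>2 \<partial>N)"
        by (intro bexI[of _ "\<lambda>y. g (T' y)"]) auto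
    qed (simp add: inner)
  next
    assume basis: "L2_orthogonal_basis M (\<lambda>i x. e i (T x)) I"
    show "L2_orthogonal_basis N e I"
    proof (rule L2_orthogonal_basis_transfer[OF basis])
      show "e i \<in> L2_functions N" if "i \<in> I" for i
        using basis that L2[OF e] by (simp add: L2_orthogonal_basis_def)
      fix f assume f: "f \<in> L2_functions N"
      then show "\<exists>g\<in>L2_functions M. \<forall>F c. F \<subseteq> I \<longrightarrow>
          (\<integral>x. (cmod (f x - (\<Sum>i\<in>F. c i * e i x)))\<^sup>2 \<partial>N)
          = (\<integral>x. (cmod (g x - (\<Sum>i\<in>F. c i * e i (T x))))\<^sup>2 \<partial>M)"
        using L2[OF L2_functions_measurable[OF f]] dist[OF L2_functions_measurable[OF f]]
        by (intro bexI[of _ "\<lambda>x. f (T x)"]) auto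
    qed (simp add: inner)
  qed
qed

text \<open>Covers \<open>S = {}\<close>: spectrality asks for no positive measure, and the empty
  family is a basis of the zero space.\<close>

lemma is_spectral_wrt_empty: "is_spectral_wrt ch M {}"
proof -
  have "space (restrict_space (completion M) {}) = {}"
    by (simp add: space_restrict_space)
  then have "(\<integral>x. f x \<partial>restrict_space (completion M) {}) = 0" for f :: "_ \<Rightarrow> real"
    by (simp add: integral_restrict_space)
  then show ?thesis
    unfolding is_spectral_wrt_def L2_orthogonal_basis_def
    by (intro conjI exI[of _ "{}"]) auto
qed

definition layer_character :: "real \<times> real \<Rightarrow> real \<times> int \<Rightarrow> complex" where
  "layer_character l x = wave (fst l) (fst x) * wave (snd l) (of_int (snd x))"

lemma character_real_int_abs_torus: "character_real_int (x, abs_torus y) = layer_character (x, y)"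
  by (simp add: fun_eq_iff character_real_int_def layer_character_def wave_def torus_character.abs_eq)

lemma character_plane_eq: "character_plane l x = wave (fst l) (fst x) * wave (snd l) (snd x)"
  by (simp add: character_plane_def wave_def inner_prod_def exp_add[symmetric] distrib_left)

lemma borel_character_plane: "character_plane l \<in> borel_measurable lborel"
proof -
  have "character_plane l \<in> borel_measurable borel"
    unfolding character_plane_eq[abs_def] by (intro borel_measurable_continuous_onI continuous_intros)
  then show ?thesis
    by simp
qed

lemma borel_layer_character: "layer_character l \<in> borel_measurable lborel_count"
  unfolding layer_character_def[abs_def] by measurable

lemma borel_character_real_int: "character_real_int \<sigma> \<in> borel_measurable lborel_count"
proof -
  obtain y where "snd \<sigma> = abs_torus y"
    using Quotient_abs_rep[OF Quotient_torus] by metis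
  then show ?thesis
    using character_real_int_abs_torus[of "fst \<sigma>" y] borel_layer_character[of "(fst \<sigma>, y)"]
    by (metis prod.collapse)
qed

section \<open>Folding the slabs onto the layers times the unit interval\<close>

context finite_borel_slabs
begin

abbreviation slab_measure :: "(real \<times> real) measure" where
  "slab_measure \<equiv> restrict_space lborel (slab_union S W)"

abbreviation layer_measure :: "(real \<times> int) measure" where
  "layer_measure \<equiv> restrict_space lborel_count (layer_union S W)"

lemma slab_borel: "slab_union S W \<in> sets lborel"
  using borel_slab_union[OF finite_S borel_W] by simp

lemma layer_borel: "layer_union S W \<in> sets lborel_count"
  using borel_layer_union[OF finite_S borel_W] by simp

lemma space_layer_measure: "space layer_measure = layer_union S W"
  by (simp add: space_restrict_space)

lemma space_slab_measure: "space slab_measure = slab_union S W"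
  by (simp add: space_restrict_space)

lemma layer_family:
  assumes "S \<noteq> {}"
  shows "periodic_unimodular_family layer_measure layer_character"
proof -
  have "emeasure lborel_count (layer_union S W) < \<infinity>"
    using fmeasurable_unions(2) layer_borel by (simp add: fmeasurable_def)
  moreover have "measure lborel_count (layer_union S W) > 0"
    using assms bounded_positive_set_layer_iff layer_borel by (simp add: bounded_positive_set_def)
  ultimately have fin: "finite_measure layer_measure"
    and pos: "measure layer_measure (space layer_measure) > 0"
    using layer_borel
    by (auto intro!: finite_measureI simp: space_layer_measure emeasure_restrict_space measure_restrict_space)
  show ?thesis
  proof (intro periodic_unimodular_family.intro periodic_unimodular_family_axioms.intro fin pos)
    show "layer_character l \<in> borel_measurable layer_measure" for l
      by (rule measurable_restrict_space1[OF borel_layer_character])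
    show "cmod (layer_character l a) = 1" for l a
      by (simp add: layer_character_def norm_mult)
    show "layer_character (x, y + of_int k) = layer_character (x, y)" for x y and k :: int
      by (simp add: layer_character_def fun_eq_iff wave_add_left wave_int_int)
  qed
qed

definition unfold_layer :: "(real \<times> int) \<times> real \<Rightarrow> real \<times> real" where
  "unfold_layer p = (fst (fst p), of_int (snd (fst p)) + snd p)"

definition fold_slab :: "real \<times> real \<Rightarrow> (real \<times> int) \<times> real" where
  "fold_slab z = ((fst z, \<lfloor>snd z\<rfloor>), snd z - of_int \<lfloor>snd z\<rfloor>)"

lemma int_plus_unit:
  fixes s :: real
  assumes "0 < s" "s < 1"
  shows "of_int j + s \<notin> \<int>" "\<lfloor>of_int j + s\<rfloor> = j"
proof -
  show *: "\<lfloor>of_int j + s\<rfloor> = j"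
    using assms by linarith
  show "of_int j + s \<notin> \<int>"
  proof
    assume "of_int j + s \<in> \<int>"
    then obtain n :: int where n: "of_int j + s = of_int n"
      by (rule Ints_cases)
    with * have "n = j"
      by simp
    with n assms(1) show False
      by simp
  qed
qed

lemma unfold_layer_mem:
  assumes "s \<in> {0<..<1}"
  shows "unfold_layer (a, s) \<in> slab_union S W \<longleftrightarrow> a \<in> layer_union S W"
  using mem_slab_union_iff[of "of_int (snd a) + s" "fst a" S W] int_plus_unit[of s "snd a"] assms
  by (simp add: unfold_layer_def)

lemma fold_unfold:
  assumes "s \<in> {0<..<1}"
  shows "fold_slab (unfold_layer (a, s)) = (a, s)"
  using int_plus_unit[of s "snd a"] assms by (simp add: unfold_layer_def fold_slab_def)

lemma measurable_unfold_layer: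
  "unfold_layer \<in> layer_measure \<Otimes>\<^sub>M unit_lborel \<rightarrow>\<^sub>M slab_measure"
proof (rule measurable_restrict_space2)
  show "unfold_layer \<in> space (layer_measure \<Otimes>\<^sub>M unit_lborel) \<rightarrow> slab_union S W"
    using unfold_layer_mem by (auto simp: space_pair_measure space_layer_measure)
  have fst: "fst \<in> borel_measurable layer_measure" and snd: "snd \<in> layer_measure \<rightarrow>\<^sub>M count_space UNIV"
    by (rule measurable_restrict_space1; measurable)+
  have id: "(\<lambda>s. s) \<in> borel_measurable unit_lborel"
    by measurable
  have [measurable]: "(\<lambda>p. fst (fst p)) \<in> borel_measurable (layer_measure \<Otimes>\<^sub>M unit_lborel)"
    by (rule measurable_compose[OF measurable_fst fst])
  have [measurable]: "(\<lambda>p. real_of_int (snd (fst p))) \<in> borel_measurable (layer_measure \<Otimes>\<^sub>M unit_lborel)"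
    by (rule measurable_compose[OF measurable_compose[OF measurable_fst snd]]) simp
  have [measurable]: "(\<lambda>p. snd p) \<in> borel_measurable (layer_measure \<Otimes>\<^sub>M unit_lborel)"
    by (rule measurable_compose[OF measurable_snd id])
  have "unfold_layer \<in> layer_measure \<Otimes>\<^sub>M unit_lborel \<rightarrow>\<^sub>M borel \<Otimes>\<^sub>M borel"
    unfolding unfold_layer_def[abs_def] by (intro measurable_Pair borel_measurable_add) measurable
  then show "unfold_layer \<in> layer_measure \<Otimes>\<^sub>M unit_lborel \<rightarrow>\<^sub>M lborel"
    by (simp add: borel_prod)
qed

lemma measurable_fold_slab: "fold_slab \<in> slab_measure \<rightarrow>\<^sub>M layer_measure \<Otimes>\<^sub>M unit_lborel"
proof -
  have z: "snd z \<notin> \<int>" "(fst z, \<lfloor>snd z\<rfloor>) \<in> layer_union S W" if zE: "z \<in> slab_union S W" for z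
  proof -
    obtain j where j: "j \<in> S" "fst z \<in> W j" "of_int j < snd z" "snd z < of_int j + 1"
      using zE by (auto simp: slab_union_def mem_Times_iff)
    then have "snd z = of_int j + (snd z - of_int j)" "0 < snd z - of_int j" "snd z - of_int j < 1"
      by simp_all
    then show "snd z \<notin> \<int>"
      using int_plus_unit(1)[of "snd z - of_int j" j] by simp
    then show "(fst z, \<lfloor>snd z\<rfloor>) \<in> layer_union S W"
      using mem_slab_union_iff[of "snd z" "fst z" S W] zE by simp
  qed
  have m: "(fst :: real \<times> real \<Rightarrow> real) \<in> borel_measurable slab_measure"
    "(snd :: real \<times> real \<Rightarrow> real) \<in> borel_measurable slab_measure"
    by (auto intro!: measurable_restrict_space1 borel_measurable_continuous_onI continuous_intros)
  note [measurable] = m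
  show ?thesis
    unfolding fold_slab_def[abs_def]
  proof (rule measurable_Pair)
    show "(\<lambda>z. (fst z, \<lfloor>snd z\<rfloor>)) \<in> slab_measure \<rightarrow>\<^sub>M layer_measure"
    proof (rule measurable_restrict_space2)
      have "(\<lambda>z. (fst z, \<lfloor>snd z\<rfloor>)) \<in> slab_measure \<rightarrow>\<^sub>M borel"
        by (rule borel_real_int_measurable) measurable
      then show "(\<lambda>z. (fst z, \<lfloor>snd z\<rfloor>)) \<in> slab_measure \<rightarrow>\<^sub>M lborel_count"
        by (simp cong: measurable_cong_sets)
    qed (use z in \<open>auto simp: space_slab_measure\<close>)
    show "(\<lambda>z. snd z - of_int \<lfloor>snd z\<rfloor>) \<in> slab_measure \<rightarrow>\<^sub>M unit_lborel"
      unfolding unit_lborel_def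
    proof (rule measurable_restrict_space2)
      show "(\<lambda>z. snd z - of_int \<lfloor>snd z\<rfloor>) \<in> space slab_measure \<rightarrow> {0<..<1}"
      proof (rule funcsetI)
        fix z assume "z \<in> space slab_measure"
        then have "snd z \<noteq> of_int \<lfloor>snd z\<rfloor>"
          using z(1)[of z] by (metis Ints_of_int space_slab_measure)
        then show "snd z - of_int \<lfloor>snd z\<rfloor> \<in> {0<..<1}"
          unfolding greaterThanLessThan_iff by linarith
      qed
      have "(\<lambda>z. snd z - of_int \<lfloor>snd z\<rfloor>) \<in> borel_measurable slab_measure"
        by measurable
      then show "(\<lambda>z. snd z - of_int \<lfloor>snd z\<rfloor>) \<in> slab_measure \<rightarrow>\<^sub>M lborel"
        by simp
    qed
  qed
qed

text \<open>By Tonelli, the integrals over (0, 1) at all layers combine into one integral over the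
  heights, the integers being null.\<close>

lemma distr_unfold_layer:
  "distr (layer_measure \<Otimes>\<^sub>M unit_lborel) slab_measure unfold_layer = slab_measure"
proof (rule measure_eqI)
  fix B assume "B \<in> sets (distr (layer_measure \<Otimes>\<^sub>M unit_lborel) slab_measure unfold_layer)"
  then have B: "B \<in> sets slab_measure"
    by simp
  then have B_sub: "B \<subseteq> slab_union S W" and B_borel: "B \<in> sets borel"
    using slab_borel by (auto simp: sets_restrict_space_iff)
  have [measurable]: "B \<in> sets (borel \<Otimes>\<^sub>M borel)"
    using B_borel by (simp only: borel_prod)
  have id: "(\<lambda>s. s) \<in> borel_measurable unit_lborel"
    by measurable
  let ?b = "\<lambda>x j s. indicator B (x, of_int j + s) :: ennreal"
  have "emeasure (distr (layer_measure \<Otimes>\<^sub>M unit_lborel) slab_measure unfold_layer) B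
      = (\<integral>\<^sup>+z. indicator B z \<partial>distr (layer_measure \<Otimes>\<^sub>M unit_lborel) slab_measure unfold_layer)"
    using B by simp
  also have "\<dots> = (\<integral>\<^sup>+p. indicator B (unfold_layer p) \<partial>(layer_measure \<Otimes>\<^sub>M unit_lborel))"
    using B by (intro nn_integral_distr measurable_unfold_layer) simp
  also have "\<dots> = (\<integral>\<^sup>+a. \<integral>\<^sup>+s. indicator B (unfold_layer (a, s)) \<partial>unit_lborel \<partial>layer_measure)"
    using measurable_compose[OF measurable_unfold_layer borel_measurable_indicator[OF B]]
    by (intro unit_lborel.nn_integral_fst[symmetric]) simp
  also have "\<dots> = (\<integral>\<^sup>+a. (\<integral>\<^sup>+s. ?b (fst a) (snd a) s \<partial>unit_lborel) * indicator (layer_union S W) a \<partial>lborel_count)"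
    using layer_borel by (subst nn_integral_restrict_space) (auto simp: unfold_layer_def)
  also have "\<dots> = (\<integral>\<^sup>+a. (\<integral>\<^sup>+s. ?b (fst a) (snd a) s \<partial>unit_lborel) \<partial>lborel_count)"
  proof (rule nn_integral_cong)
    fix a :: "real \<times> int"
    show "(\<integral>\<^sup>+s. ?b (fst a) (snd a) s \<partial>unit_lborel) * indicator (layer_union S W) a
        = (\<integral>\<^sup>+s. ?b (fst a) (snd a) s \<partial>unit_lborel)"
    proof (cases "a \<in> layer_union S W")
      case False
      then have "?b (fst a) (snd a) s = 0" if "s \<in> {0<..<1}" for s
        using unfold_layer_mem[OF that, of a] B_sub by (auto simp: unfold_layer_def indicator_def)
      then have "(\<integral>\<^sup>+s. ?b (fst a) (snd a) s \<partial>unit_lborel) = (\<integral>\<^sup>+s. 0 \<partial>unit_lborel)"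
        by (intro nn_integral_cong) simp
      then show ?thesis
        by simp
    qed simp
  qed
  also have "\<dots> = (\<integral>\<^sup>+x. \<integral>\<^sup>+j. \<integral>\<^sup>+s. ?b x j s \<partial>unit_lborel \<partial>count_space UNIV \<partial>lborel)"
  proof -
    have "(\<lambda>a. \<integral>\<^sup>+s. ?b (fst a) (snd a) s \<partial>unit_lborel) \<in> borel_measurable (lborel \<Otimes>\<^sub>M count_space UNIV)"
    proof (rule unit_lborel.borel_measurable_nn_integral)
      show "(\<lambda>(a, s). ?b (fst a) (snd a) s) \<in> borel_measurable ((lborel \<Otimes>\<^sub>M count_space UNIV) \<Otimes>\<^sub>M unit_lborel)"
      proof -
        let ?P = "(lborel \<Otimes>\<^sub>M count_space UNIV) \<Otimes>\<^sub>M unit_lborel :: ((real \<times> int) \<times> real) measure"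
        have "(\<lambda>p. fst (fst p)) \<in> borel_measurable ?P"
          by (rule measurable_compose[OF measurable_fst]) simp
        moreover have "(\<lambda>p. real_of_int (snd (fst p))) \<in> borel_measurable ?P"
          by (rule measurable_compose[OF measurable_compose[OF measurable_fst measurable_snd]]) simp
        moreover have "(\<lambda>p. snd p) \<in> borel_measurable ?P"
          by (rule measurable_compose[OF measurable_snd id])
        ultimately have "(\<lambda>p. (fst (fst p), of_int (snd (fst p)) + snd p)) \<in> ?P \<rightarrow>\<^sub>M borel \<Otimes>\<^sub>M borel"
          by (intro measurable_Pair borel_measurable_add)
        from measurable_compose[OF this borel_measurable_indicator[of B]] show ?thesis
          by (simp add: case_prod_unfold)
      qed
    qed
    then show ?thesis
      unfolding lborel_count_def
      by (subst lborel_count_pair.M2.nn_integral_fst[symmetric]) simp_all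
  qed
  also have "\<dots> = (\<integral>\<^sup>+x. \<integral>\<^sup>+y. indicator B (x, y) \<partial>lborel \<partial>lborel)"
    by (intro nn_integral_cong nn_integral_real_fold[symmetric]) measurable
  also have "\<dots> = (\<integral>\<^sup>+z. indicator B z \<partial>(lborel \<Otimes>\<^sub>M lborel))"
    by (rule lborel.nn_integral_fst) measurable
  also have "\<dots> = emeasure slab_measure B"
    using B_borel B_sub slab_borel unfolding lborel_prod
    by (simp add: emeasure_restrict_space)
  finally show "emeasure (distr (layer_measure \<Otimes>\<^sub>M unit_lborel) slab_measure unfold_layer) B
      = emeasure slab_measure B" .
qed simp

text \<open>At height \<open>j + s\<close> the vertical wave splits into its value at
  \<open>j\<close>, which belongs to the layer character, and its value at \<open>s\<close>.\<close>

lemma L2_basis_slab_iff_product: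
  assumes "S \<noteq> {}"
  shows "L2_orthogonal_basis slab_measure character_plane \<Lambda>
    \<longleftrightarrow> L2_orthogonal_basis (layer_measure \<Otimes>\<^sub>M unit_lborel)
      (periodic_unimodular_family.wave_product layer_character) \<Lambda>"
proof -
  interpret periodic_unimodular_family layer_measure layer_character
    by (rule layer_family) fact
  have "(\<lambda>l x. character_plane l (unfold_layer x)) = wave_product"
    by (simp add: fun_eq_iff character_plane_eq unfold_layer_def wave_product_def
        layer_character_def wave_add_right mult.assoc)
  moreover have "fold_slab (unfold_layer x) = x" if "x \<in> space (layer_measure \<Otimes>\<^sub>M unit_lborel)" for x
    using that fold_unfold[of "snd x" "fst x"] by (auto simp: space_pair_measure)
  ultimately show ?thesis
    using L2_orthogonal_basis_distr_iff[OF measurable_unfold_layer distr_unfold_layer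
        measurable_fold_slab _ measurable_restrict_space1[OF borel_character_plane], where I = \<Lambda>]
    by simp
qed

text \<open>The half-open window meets every class modulo one at most once, so passing to the torus
  loses no point. Conversely any choice of representatives works, since \<open>product_basis\<close>
  adds all integer shifts.\<close>

lemma spectrum_slab_iff_layer:
  assumes "S \<noteq> {}"
  shows "(\<exists>\<Lambda>. countable \<Lambda> \<and> L2_orthogonal_basis slab_measure character_plane \<Lambda>)
    \<longleftrightarrow> (\<exists>\<Sigma>. countable \<Sigma> \<and> L2_orthogonal_basis layer_measure character_real_int \<Sigma>)"
proof -
  interpret periodic_unimodular_family layer_measure layer_character
    by (rule layer_family) fact
  define \<pi> where "\<pi> l = (fst l, abs_torus (snd l))" for l :: "real \<times> real"
  have \<pi>: "character_real_int (\<pi> l) = layer_character l" for l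
    by (simp add: \<pi>_def character_real_int_abs_torus)
  define \<rho> where "\<rho> \<sigma> = (fst \<sigma>, rep_torus (snd \<sigma>))" for \<sigma> :: "real \<times> torus"
  have \<pi>\<rho>: "\<pi> (\<rho> \<sigma>) = \<sigma>" for \<sigma>
    by (simp add: \<pi>_def \<rho>_def Quotient_abs_rep[OF Quotient_torus])
  show ?thesis
    unfolding L2_basis_slab_iff_product[OF assms]
  proof (intro iffI; elim exE conjE)
    fix \<Lambda> assume \<Lambda>: "countable \<Lambda>"
      and basis: "L2_orthogonal_basis (layer_measure \<Otimes>\<^sub>M unit_lborel) wave_product \<Lambda>"
    let ?\<Lambda> = "{l\<in>\<Lambda>. - 1 < snd l \<and> snd l \<le> 0}"
    have "inj_on \<pi> ?\<Lambda>"
    proof (rule inj_onI)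
      fix l l' assume l: "l \<in> ?\<Lambda>" "l' \<in> ?\<Lambda>" "\<pi> l = \<pi> l'"
      then have "snd l - snd l' \<in> \<int>"
        by (simp add: \<pi>_def torus.abs_eq_iff)
      then obtain n :: int where n: "snd l - snd l' = of_int n"
        by (auto elim: Ints_cases)
      with l(1,2) have "n = 0"
        by auto
      with n l(3) show "l = l'"
        by (simp add: \<pi>_def prod_eq_iff)
    qed
    moreover have "L2_orthogonal_basis layer_measure (character_real_int \<circ> \<pi>) ?\<Lambda>"
      using window_basis[OF \<Lambda> basis] by (simp add: o_def \<pi>)
    ultimately have "L2_orthogonal_basis layer_measure character_real_int (\<pi> ` ?\<Lambda>)"
      by (rule L2_orthogonal_basis_reindex[rotated])
    moreover have "countable ?\<Lambda>"
      using \<Lambda> by (rule countable_subset[rotated]) auto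
    then have "countable (\<pi> ` ?\<Lambda>)"
      by (rule countable_image)
    ultimately show "\<exists>\<Sigma>. countable \<Sigma> \<and> L2_orthogonal_basis layer_measure character_real_int \<Sigma>"
      by blast
  next
    fix \<Sigma> assume \<Sigma>: "countable \<Sigma>" and basis: "L2_orthogonal_basis layer_measure character_real_int \<Sigma>"
    have "layer_character \<circ> \<rho> = character_real_int"
      by (rule ext) (simp add: \<pi>[symmetric] \<pi>\<rho>)
    moreover have "inj_on \<rho> \<Sigma>"
      by (metis \<pi>\<rho> inj_onI)
    ultimately have "L2_orthogonal_basis layer_measure layer_character (\<rho> ` \<Sigma>)"
      using basis by (intro L2_orthogonal_basis_reindex) simp_all
    from product_basis[OF _ this] \<Sigma>
    have "L2_orthogonal_basis (layer_measure \<Otimes>\<^sub>M unit_lborel) wave_product (shift ` (\<rho> ` \<Sigma> \<times> UNIV))"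
      by simp
    moreover have "countable (shift ` (\<rho> ` \<Sigma> \<times> UNIV))"
      using \<Sigma> by simp
    ultimately show "\<exists>\<Lambda>. countable \<Lambda> \<and> L2_orthogonal_basis (layer_measure \<Otimes>\<^sub>M unit_lborel) wave_product \<Lambda>"
      by blast
  qed
qed

end

section \<open>Spectra for Lebesgue measurable layers, and the theorem\<close>

context finite_slabs
begin

lemma is_spectral_slab_iff_layer:
  "is_spectral_wrt character_plane lborel (slab_union S W)
    \<longleftrightarrow> is_spectral_wrt character_real_int lborel_count (layer_union S W)"
proof (cases "S = {}")
  case True
  then have "slab_union S W = {}" "layer_union S W = {}"
    by (simp_all add: slab_union_def layer_union_def)
  then show ?thesis
    by (simp add: is_spectral_wrt_empty)
next
  case False
  interpret borel_part: finite_borel_slabs S "borel_part W"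
    by (rule finite_borel_slabs_borel_part)
  obtain N where N: "N \<in> null_sets lborel" "\<forall>j\<in>S. W j - N = borel_part W j - N"
    using ex_null_set_borel_part by blast
  have meas: "slab_union S W \<in> sets (completion lborel)" "layer_union S W \<in> sets (completion lborel_count)"
    using fmeasurable_unions by (auto dest: fmeasurableD)
  interpret slab: completion_borel_set lborel "slab_union S W" "slab_union S (borel_part W)"
  proof
    have "AE z in (lborel :: (real \<times> real) measure). fst z \<notin> N"
      by (rule AE_lborel_prod_fst[OF AE_not_in[OF N(1)]])
    then show "AE z in lborel. z \<in> slab_union S W \<longleftrightarrow> z \<in> slab_union S (borel_part W)"
      by eventually_elim (rule slab_union_borel_part_cong[OF N(2)])
  qed (use meas borel_part.slab_borel in auto)
  interpret layer: completion_borel_set lborel_count "layer_union S W" "layer_union S (borel_part W)"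
  proof
    have "AE z in lborel_count. fst z \<notin> N"
      using AE_not_in[OF N(1)] by (simp add: AE_lborel_count_iff)
    then show "AE z in lborel_count. z \<in> layer_union S W \<longleftrightarrow> z \<in> layer_union S (borel_part W)"
      by eventually_elim (rule layer_union_borel_part_cong[OF N(2)])
  qed (use meas borel_part.layer_borel in auto)
  show ?thesis
    using borel_part.spectrum_slab_iff_layer[OF False] meas
    unfolding is_spectral_wrt_def slab.L2_orthogonal_basis_completion_iff[OF borel_character_plane]
      layer.L2_orthogonal_basis_completion_iff[OF borel_character_real_int]
    by simp
qed

end

theorem theorem1p6:
  fixes S :: "int set" and W :: "int \<Rightarrow> real set"
  assumes "finite S"
    and "\<And>j. j \<in> S \<Longrightarrow> bounded (W j)"
    and "\<And>j. j \<in> S \<Longrightarrow> W j \<in> lmeasurable"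
    and "\<And>j. j \<in> S \<Longrightarrow> measure lebesgue (W j) > 0"
  shows "(is_tile lborel (slab_union S W) \<longleftrightarrow> is_tile lborel_count (layer_union S W)) \<and>
    (is_weak_tile lborel (slab_union S W) \<longleftrightarrow> is_weak_tile lborel_count (layer_union S W)) \<and>
    (is_spectral_wrt character_plane lborel (slab_union S W) \<longleftrightarrow>
       is_spectral_wrt character_real_int lborel_count (layer_union S W))"
proof -
  interpret finite_slabs S W
    using assms by (rule finite_slabs.intro)
  show ?thesis
    using is_tile_slab_iff_layer is_weak_tile_slab_iff_layer is_spectral_slab_iff_layer by blast
qed

end
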